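(* Let $R$ be a commutative ring containing the rationals, and let $(\mathcal A,\Delta,d)$ be a differential Batalin-Vilkovisky algebra over $R$ satisfying the statement of the Kählerian formality lemma. Let $\mathfrak g$ be the differential graded Lie algebra obtained by regrading the underlying differential Gerstenhaber algebra $(\mathcal A,[\cdot,\cdot],d)$, that is, $\mathfrak g_{-n}=\mathcal A^{n+1}$. Put $\mathfrak m=(\ker\Delta,\,d|_{\ker\Delta})$, regraded in the same way, and identify $\mathrm H(\mathfrak g)$ with $\mathrm H(\mathcal A,\Delta)$ (with zero differential) via the homology isomorphisms of the formality lemma. Extend the projection $\pi=\mathrm{proj}\colon \ker\Delta\to \mathrm H(\mathcal A,\Delta)$ to a contraction $$(\nabla\colon\mathrm H(\mathfrak g)\to\mathfrak m,\ \ \pi\colon\mathfrak m\to\mathrm H(\mathfrak g),\ \ h\colon\mathfrak m\to\mathfrak m)$$ of chain complexes of $\mathfrak m$ onto $\mathrm H(\mathfrak g)$. Then, as a graded Lie algebra, $\mathrm H(\mathfrak g)$ is abelian, and the data determine (there exists, constructed from these data) a solution $\tau\in\mathrm{Hom}(\mathcal S^{\mathrm c}[s\mathrm H(\mathfrak g)],\mathfrak g)$ (of degree $-1$) of the master equation $d\tau=\tfrac12[\tau,\tau]$ in such a way that the following hold: (i) The values of $\tau$ lie in $\mathfrak m$, that is, the composite $\Delta\circ\tau\colon \mathcal S^{\mathrm c}[s\mathrm H(\mathfrak g)]\to\mathfrak g$ is zero; (ii) the composite $\pi\tau$ coincides with the universal twisting cochain $\mathcal S^{\mathrm c}[s\mathrm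 H(\mathfrak g)]\to\mathrm H(\mathfrak g)$ for the abelian graded Lie algebra $\mathrm H(\mathfrak g)$; whence (iii) for $k\ge2$, the values of the component $\tau_k$ of $\tau$ on $\mathcal S^{\mathrm c}_k[s\mathrm H(\mathfrak g)]$ lie in $\mathrm{im}\,\Delta$.
   Context: A Gerstenhaber algebra is a graded commutative $R$-algebra $\mathcal A$ with a bracket $[\cdot,\cdot]\colon\mathcal A\otimes\mathcal A\to\mathcal A$ of degree $-1$ which is a graded Lie bracket when $\mathcal A$ is regraded down by one, such that for each homogeneous $a$ the operation $[a,\cdot]$ is a derivation of $\mathcal A$ of degree $|a|-1$. A differential Gerstenhaber algebra has in addition a differential $d$ of degree $+1$ which is a derivation of the multiplication. A Batalin-Vilkovisky algebra $(\mathcal A,\Delta)$ is a Gerstenhaber algebra $\mathcal A$ with an $R$-linear operator $\Delta$ of degree $-1$ with $\Delta\Delta=0$ generating the bracket: $[a,b]=(-1)^{|a|}(\Delta(ab)-(\Delta a)b-(-1)^{|a|}a(\Delta b))$ for homogeneous $a,b$. A differential Batalin-Vilkovisky algebra $(\mathcal A,\Delta,d)$ is a Batalin-Vilkovisky algebra with a differential $d$ of degree $+1$ making $(\mathcal A,[\cdot,\cdot],d)$ a differential Gerstenhaber algebra and such that $d\Delta+\Delta d=0$. Then $d$ is also a derivation of the bracket, so $\mathfrak g$ with $\mathfrak g_{-n}=\mathcal A^{n+1}$ (i.e. $\mathfrak g_1=\mathcal A^0$, $\mathfrak g_0=\mathcal A^1$, etc.), with bracket $[\cdot,\cdot]$ and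 differential $d$ of degree $-1$ in this regrading, is an ordinary dg Lie algebra. $(\mathcal A,\Delta,d)$ satisfies the statement of the Kählerian formality lemma if the maps $$(\ker\Delta,d|_{\ker\Delta})\xrightarrow{\ \subseteq\ }(\mathcal A,d),\qquad (\ker\Delta,d|_{\ker\Delta})\xrightarrow{\ \mathrm{proj}\ }\mathrm H(\mathcal A,\Delta)=\ker\Delta/\mathrm{im}\,\Delta$$ are chain maps inducing isomorphisms on homology, where $\mathrm H(\mathcal A,\Delta)$ is endowed with the zero differential. A contraction of a chain complex $N$ onto a chain complex $M$ is a triple of chain maps $\pi\colon N\to M$, $\nabla\colon M\to N$ and a degree $1$ morphism $h\colon N\to N$ of graded modules with $\pi\nabla=\mathrm{Id}$, $dh+hd=\nabla\pi-\mathrm{Id}$, $\pi h=0$, $h\nabla=0$, $hh=0$. $s$ is suspension, $(sM)_j=M_{j-1}$. $\mathcal S^{\mathrm c}[M]=\bigoplus_{k\ge0}\mathcal S^{\mathrm c}_k[M]$ is the graded symmetric coalgebra, $\mathcal S^{\mathrm c}_0[M]=R$, $\mathcal S^{\mathrm c}_k[M]=(M^{\otimes k})^{\Sigma_k}$ (graded invariants), a subcoalgebra of the tensor coalgebra with deconcatenation diagonal. Here $\mathcal S^{\mathrm c}[s\mathrm H(\mathfrak g)]$ has zero differential, so $d\tau$ is the composite of $\tau$ with the differential of $\mathfrak g$. For $a,b\colon C\to\mathfrak g$ with $C$ a coalgebra, $[a,b]$ is the cup bracket, the composite of the diagonal of $C$, $a\otimes b$ (with Koszul signs), and the bracket of $\mathfrak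 g$. The universal twisting cochain $\mathcal S^{\mathrm c}[s\mathfrak h]\to\mathfrak h$ of a graded Lie algebra $\mathfrak h$ sends $sx\mapsto x$ on $\mathcal S^{\mathrm c}_1$ and vanishes on $\mathcal S^{\mathrm c}_k$ for $k\neq1$. *)

theory Defs
  imports Complex_Main "HOL-Library.Poly_Mapping" "HOL-Combinatorics.Permutations"
begin

section \<open>Algebras over a commutative ring\<close>

definition contains_rationals :: "(rat \<Rightarrow> 'r::comm_ring_1) \<Rightarrow> bool" where
  "contains_rationals q \<longleftrightarrow>
     inj q \<and> q 1 = 1 \<and> (\<forall>x y. q (x + y) = q x + q y) \<and> (\<forall>x y. q (x * y) = q x * q y)"

text \<open>The sign \<open>(-1)\<^sup>n\<close> applied to \<open>x\<close>.\<close>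

definition sgn_pow :: "int \<Rightarrow> 'a::uminus \<Rightarrow> 'a" where
  "sgn_pow n x = (if even n then x else - x)"

text \<open>
  The underlying total module of a graded algebra is the whole type \<open>'a\<close>; the grading is a family
  of submodules of which it is the internal direct sum.  The unit is an element \<open>u\<close> rather than the
  class constant \<open>1\<close>, so that the zero algebra is not excluded.
\<close>

locale graded_comm_algebra = module scale
  for scale :: "'r::comm_ring_1 \<Rightarrow> 'a::ring \<Rightarrow> 'a"  (infixr "*s" 75) +
  fixes A :: "int \<Rightarrow> 'a set"
  assumes subspace_A: "subspace (A n)"
    and direct_sum:
      "\<exists>!c. (\<forall>n. c n \<in> A n) \<and> finite {n. c n \<noteq> 0} \<and> x = (\<Sum>n | c n \<noteq> 0. c n)"
    and scale_mult: "(r *s x) * y = r *s (x * y)"  "x * (r *s y) = r *s (x * y)"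
    and mult_degree: "x \<in> A m \<Longrightarrow> y \<in> A n \<Longrightarrow> x * y \<in> A (m + n)"
    and unit: "\<exists>u \<in> A 0. \<forall>x. u * x = x \<and> x * u = x"
    and graded_commutative: "x \<in> A m \<Longrightarrow> y \<in> A n \<Longrightarrow> x * y = sgn_pow (m * n) (y * x)"

definition linear_of_degree ::
    "('r::comm_ring_1 \<Rightarrow> 'a::ab_group_add \<Rightarrow> 'a) \<Rightarrow> (int \<Rightarrow> 'a set) \<Rightarrow> int \<Rightarrow> ('a \<Rightarrow> 'a) \<Rightarrow> bool" where
  "linear_of_degree scale A p f \<longleftrightarrow>
     module_hom scale scale f \<and> (\<forall>n. \<forall>x \<in> A n. f x \<in> A (n + p))"

definition derivation_of_degree ::
    "('r::comm_ring_1 \<Rightarrow> 'a::ring \<Rightarrow> 'a) \<Rightarrow> (int \<Rightarrow> 'a set) \<Rightarrow> int \<Rightarrow> ('a \<Rightarrow> 'a) \<Rightarrow> bool" where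
  "derivation_of_degree scale A p f \<longleftrightarrow>
     linear_of_degree scale A p f \<and>
     (\<forall>m n. \<forall>x \<in> A m. \<forall>y \<in> A n. f (x * y) = f x * y + sgn_pow (p * m) (x * f y))"

definition graded_Lie_bracket ::
    "('r::comm_ring_1 \<Rightarrow> 'a::ab_group_add \<Rightarrow> 'a) \<Rightarrow> (int \<Rightarrow> 'a set) \<Rightarrow> ('a \<Rightarrow> 'a \<Rightarrow> 'a) \<Rightarrow> bool" where
  "graded_Lie_bracket scale L br \<longleftrightarrow>
     (\<forall>x. module_hom scale scale (br x)) \<and> (\<forall>y. module_hom scale scale (\<lambda>x. br x y)) \<and>
     (\<forall>i j. \<forall>x \<in> L i. \<forall>y \<in> L j. br x y \<in> L (i + j)) \<and>
     (\<forall>i j. \<forall>x \<in> L i. \<forall>y \<in> L j. br x y = - sgn_pow (i * j) (br y x)) \<and>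
     (\<forall>i j k. \<forall>x \<in> L i. \<forall>y \<in> L j. \<forall>z \<in> L k.
        br x (br y z) = br (br x y) z + sgn_pow (i * j) (br y (br x z)))"

text \<open>The family \<open>\<lambda>n. A (n + 1)\<close> is \<open>A\<close> regraded down by one.\<close>

locale gerstenhaber_algebra = graded_comm_algebra scale A
  for scale :: "'r::comm_ring_1 \<Rightarrow> 'a::ring \<Rightarrow> 'a"  (infixr "*s" 75) and A +
  fixes bracket :: "'a \<Rightarrow> 'a \<Rightarrow> 'a"
  assumes bracket_Lie: "graded_Lie_bracket scale (\<lambda>n. A (n + 1)) bracket"
    and bracket_derivation: "a \<in> A m \<Longrightarrow> derivation_of_degree scale A (m - 1) (bracket a)"

locale differential_gerstenhaber_algebra = gerstenhaber_algebra scale A bracket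
  for scale :: "'r::comm_ring_1 \<Rightarrow> 'a::ring \<Rightarrow> 'a"  (infixr "*s" 75) and A bracket +
  fixes d :: "'a \<Rightarrow> 'a"
  assumes d_derivation: "derivation_of_degree scale A 1 d"
    and d_squared: "d (d x) = 0"

locale BV_algebra = gerstenhaber_algebra scale A bracket
  for scale :: "'r::comm_ring_1 \<Rightarrow> 'a::ring \<Rightarrow> 'a"  (infixr "*s" 75) and A bracket +
  fixes \<Delta> :: "'a \<Rightarrow> 'a"
  assumes Delta_degree: "linear_of_degree scale A (-1) \<Delta>"
    and Delta_squared: "\<Delta> (\<Delta> x) = 0"
    and Delta_generates: "a \<in> A m \<Longrightarrow> b \<in> A n \<Longrightarrow>
      bracket a b = sgn_pow m (\<Delta> (a * b) - \<Delta> a * b - sgn_pow m (a * \<Delta> b))"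

locale differential_BV_algebra =
  BV_algebra scale A bracket \<Delta> + differential_gerstenhaber_algebra scale A bracket d
  for scale :: "'r::comm_ring_1 \<Rightarrow> 'a::ring \<Rightarrow> 'a"  (infixr "*s" 75) and A bracket \<Delta> d +
  assumes d_Delta: "d (\<Delta> x) + \<Delta> (d x) = 0"


section \<open>Graded modules and quotients\<close>

text \<open>
  Homology modules and tensor powers are quotients, whose elements are cosets.  They do not fill a
  type, so a graded module is recorded by its homogeneous components together with its operations,
  which are relevant only on those components.
\<close>

record ('r, 'm) graded_module =
  component :: "int \<Rightarrow> 'm set"
  gadd :: "'m \<Rightarrow> 'm \<Rightarrow> 'm"
  gzero :: 'm
  gscale :: "'r \<Rightarrow> 'm \<Rightarrow> 'm"

definition submodule_family ::
    "('r \<Rightarrow> 'a::ab_group_add \<Rightarrow> 'a) \<Rightarrow> (int \<Rightarrow> 'a set) \<Rightarrow> ('r, 'a) graded_module" where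
  "submodule_family scale G = \<lparr>component = G, gadd = (+), gzero = 0, gscale = scale\<rparr>"

definition residue :: "'a::ab_group_add set \<Rightarrow> 'a \<Rightarrow> 'a set" where
  "residue N x = (\<lambda>y. x + y) ` N"

text \<open>The image of the family \<open>G\<close> in the quotient by the submodule \<open>N\<close>.\<close>

definition quotient_family ::
    "('r \<Rightarrow> 'a::ab_group_add \<Rightarrow> 'a) \<Rightarrow> (int \<Rightarrow> 'a set) \<Rightarrow> 'a set \<Rightarrow> ('r, 'a set) graded_module" where
  "quotient_family scale G N =
     \<lparr>component = (\<lambda>n. residue N ` G n),
      gadd = (\<lambda>X Y. {x + y |x y. x \<in> X \<and> y \<in> Y}),
      gzero = N,
      gscale = (\<lambda>r X. \<Union>x\<in>X. residue N (scale r x))\<rparr>"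

text \<open>
  The map between quotients induced by a map \<open>f\<close> of representatives; \<open>N\<close> is the submodule divided
  out in the target.
\<close>

definition induced :: "('a \<Rightarrow> 'b) \<Rightarrow> 'b::ab_group_add set \<Rightarrow> 'a set \<Rightarrow> 'b set" where
  "induced f N X = (\<Union>x\<in>X. residue N (f x))"

definition graded_hom ::
    "int \<Rightarrow> ('r, 'm) graded_module \<Rightarrow> ('r, 'n) graded_module \<Rightarrow> ('m \<Rightarrow> 'n) \<Rightarrow> bool" where
  "graded_hom p M N f \<longleftrightarrow>
     (\<forall>i. \<forall>x \<in> component M i. f x \<in> component N (i + p) \<and>
        (\<forall>y \<in> component M i. f (gadd M x y) = gadd N (f x) (f y)) \<and>
        (\<forall>r. f (gscale M r x) = gscale N r (f x)))"

text \<open>The suspension map itself is the identity on elements; only the degree is shifted.\<close>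

definition suspension :: "('r, 'm) graded_module \<Rightarrow> ('r, 'm) graded_module" where
  "suspension M = M\<lparr>component := (\<lambda>j. component M (j - 1))\<rparr>"

text \<open>A contraction of the chain complex \<open>(N, d\<^sub>N)\<close> onto the chain complex \<open>(M, d\<^sub>M)\<close>.\<close>

definition contraction ::
    "('r::comm_ring_1, 'n) graded_module \<Rightarrow> ('n \<Rightarrow> 'n) \<Rightarrow> ('r, 'm) graded_module \<Rightarrow> ('m \<Rightarrow> 'm) \<Rightarrow>
     ('n \<Rightarrow> 'm) \<Rightarrow> ('m \<Rightarrow> 'n) \<Rightarrow> ('n \<Rightarrow> 'n) \<Rightarrow> bool" where
  "contraction N dN M dM \<pi> nabla h \<longleftrightarrow>
     graded_hom 0 N M \<pi> \<and> (\<forall>i. \<forall>x \<in> component N i. \<pi> (dN x) = dM (\<pi> x)) \<and>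
     graded_hom 0 M N nabla \<and> (\<forall>i. \<forall>y \<in> component M i. nabla (dM y) = dN (nabla y)) \<and>
     graded_hom 1 N N h \<and>
     (\<forall>i. \<forall>y \<in> component M i. \<pi> (nabla y) = y) \<and>
     (\<forall>i. \<forall>x \<in> component N i.
        gadd N (dN (h x)) (h (dN x)) = gadd N (nabla (\<pi> x)) (gscale N (-1) x)) \<and>
     (\<forall>i. \<forall>x \<in> component N i. \<pi> (h x) = gzero M) \<and>
     (\<forall>i. \<forall>y \<in> component M i. h (nabla y) = gzero N) \<and>
     (\<forall>i. \<forall>x \<in> component N i. h (h x) = gzero N)"


section \<open>Homology\<close>

text \<open>
  Homology of the graded submodule \<open>K\<close> of \<open>\<Oplus>\<^sub>n G n\<close> with respect to \<open>D\<close>, which is supposed to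
  map \<open>K\<close> to itself.  The full boundary module \<open>D ` K\<close> is divided out in each degree; for homogeneous
  \<open>D\<close> and a direct sum \<open>G\<close> this amounts to the usual quotient.
\<close>

definition homology ::
    "('r \<Rightarrow> 'a::ab_group_add \<Rightarrow> 'a) \<Rightarrow> (int \<Rightarrow> 'a set) \<Rightarrow> 'a set \<Rightarrow> ('a \<Rightarrow> 'a) \<Rightarrow>
     ('r, 'a set) graded_module" where
  "homology scale G K D = quotient_family scale (\<lambda>n. {x \<in> G n \<inter> K. D x = 0}) (D ` K)"

definition ker :: "('a \<Rightarrow> 'b::zero) \<Rightarrow> 'a set" where
  "ker f = {x. f x = 0}"

text \<open>
  The first two conjuncts say that the inclusion of, and the projection from, the kernel of
  \<open>\<Delta>\<close> are chain maps, the target of the projection having zero differential.  The homology of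
  that target is identified with the target itself.
\<close>

definition kaehlerian_formality ::
    "('r \<Rightarrow> 'a::ab_group_add \<Rightarrow> 'a) \<Rightarrow> (int \<Rightarrow> 'a set) \<Rightarrow> ('a \<Rightarrow> 'a) \<Rightarrow> ('a \<Rightarrow> 'a) \<Rightarrow> bool" where
  "kaehlerian_formality scale A \<Delta> d \<longleftrightarrow>
     d ` ker \<Delta> \<subseteq> ker \<Delta> \<and>
     (\<forall>x \<in> ker \<Delta>. residue (range \<Delta>) (d x) = gzero (homology scale A UNIV \<Delta>)) \<and>
     (\<forall>n. bij_betw (induced (\<lambda>x. x) (range d))
            (component (homology scale A (ker \<Delta>) d) n) (component (homology scale A UNIV d) n)) \<and>
     (\<forall>n. bij_betw (induced (\<lambda>x. x) (range \<Delta>))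
            (component (homology scale A (ker \<Delta>) d) n) (component (homology scale A UNIV \<Delta>) n))"

definition homology_bracket ::
    "('a \<Rightarrow> 'a \<Rightarrow> 'a) \<Rightarrow> 'a::ab_group_add set \<Rightarrow> 'a set \<Rightarrow> 'a set \<Rightarrow> 'a set" where
  "homology_bracket br B X Y = (\<Union>x\<in>X. \<Union>y\<in>Y. residue B (br x y))"

definition abelian_bracket :: "('r, 'm) graded_module \<Rightarrow> ('m \<Rightarrow> 'm \<Rightarrow> 'm) \<Rightarrow> bool" where
  "abelian_bracket H br \<longleftrightarrow>
     (\<forall>i j. \<forall>X \<in> component H i. \<forall>Y \<in> component H j. br X Y = gzero H)"

text \<open>Lower grading of the dg Lie algebra: component \<open>-n\<close> is \<open>A (n + 1)\<close>.\<close>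

definition regrade :: "(int \<Rightarrow> 'a set) \<Rightarrow> int \<Rightarrow> 'a set" where
  "regrade A j = A (1 - j)"

definition Lie_module ::
    "('r \<Rightarrow> 'a::ab_group_add \<Rightarrow> 'a) \<Rightarrow> (int \<Rightarrow> 'a set) \<Rightarrow> ('r, 'a) graded_module" where
  "Lie_module scale A = submodule_family scale (regrade A)"

definition ker_module ::
    "('r \<Rightarrow> 'a::ab_group_add \<Rightarrow> 'a) \<Rightarrow> (int \<Rightarrow> 'a set) \<Rightarrow> ('a \<Rightarrow> 'a) \<Rightarrow> ('r, 'a) graded_module" where
  "ker_module scale A \<Delta> = submodule_family scale (\<lambda>j. regrade A j \<inter> ker \<Delta>)"


section \<open>Tensor products\<close>

text \<open>The free module on a type \<open>'g\<close> of generators is \<open>'g \<Rightarrow>\<^sub>0 'r\<close>.\<close>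

definition free_scale :: "'r::comm_ring_1 \<Rightarrow> ('g \<Rightarrow>\<^sub>0 'r) \<Rightarrow> ('g \<Rightarrow>\<^sub>0 'r)" where
  "free_scale r p = Poly_Mapping.map ((*) r) p"

abbreviation gen :: "'g \<Rightarrow> ('g \<Rightarrow>\<^sub>0 'r::comm_ring_1)" where
  "gen g \<equiv> Poly_Mapping.single g 1"

definition linear_extension ::
    "('r::comm_ring_1 \<Rightarrow> 'b::ab_group_add \<Rightarrow> 'b) \<Rightarrow> ('g \<Rightarrow> 'b) \<Rightarrow> ('g \<Rightarrow>\<^sub>0 'r) \<Rightarrow> 'b" where
  "linear_extension scale \<phi> p =
     (\<Sum>g \<in> Poly_Mapping.keys p. scale (Poly_Mapping.lookup p g) (\<phi> g))"

text \<open>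
  The tensor product \<open>M \<otimes> N\<close> is generated by the symbols \<open>((i, x), (j, y))\<close>, standing for
  \<open>x \<otimes> y\<close>, with \<open>x\<close> homogeneous of degree \<open>i\<close> and \<open>y\<close> homogeneous of degree \<open>j\<close>.
\<close>

definition tensor_relations ::
    "('r::comm_ring_1, 'm) graded_module \<Rightarrow> ('r, 'n) graded_module \<Rightarrow>
     ((int \<times> 'm) \<times> (int \<times> 'n) \<Rightarrow>\<^sub>0 'r) set" where
  "tensor_relations M N = module.span free_scale
     ({gen ((i, gadd M x x'), (j, y)) - gen ((i, x), (j, y)) - gen ((i, x'), (j, y)) |i j x x' y.
         x \<in> component M i \<and> x' \<in> component M i \<and> y \<in> component N j} \<union>
      {gen ((i, x), (j, gadd N y y')) - gen ((i, x), (j, y)) - gen ((i, x), (j, y')) |i j x y y'.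
         x \<in> component M i \<and> y \<in> component N j \<and> y' \<in> component N j} \<union>
      {gen ((i, gscale M r x), (j, y)) - free_scale r (gen ((i, x), (j, y))) |i j r x y.
         x \<in> component M i \<and> y \<in> component N j} \<union>
      {gen ((i, x), (j, gscale N r y)) - free_scale r (gen ((i, x), (j, y))) |i j r x y.
         x \<in> component M i \<and> y \<in> component N j})"

definition tensor ::
    "('r::comm_ring_1, 'm) graded_module \<Rightarrow> ('r, 'n) graded_module \<Rightarrow>
     ('r, ((int \<times> 'm) \<times> (int \<times> 'n) \<Rightarrow>\<^sub>0 'r) set) graded_module" where
  "tensor M N = quotient_family free_scale
     (\<lambda>n. {p. \<forall>((i, x), (j, y)) \<in> Poly_Mapping.keys p.
               x \<in> component M i \<and> y \<in> component N j \<and> i + j = n})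
     (tensor_relations M N)"


section \<open>The tensor coalgebra and the symmetric coalgebra\<close>

text \<open>
  The tensor coalgebra is generated by words \<open>[(i\<^sub>1, x\<^sub>1), \<dots>, (i\<^sub>k, x\<^sub>k)]\<close>, standing for
  \<open>x\<^sub>1 \<otimes> \<dots> \<otimes> x\<^sub>k\<close>, with each \<open>x\<^sub>l\<close> homogeneous of degree \<open>i\<^sub>l\<close>.  The empty word spans the copy
  of the ground ring in weight 0.
\<close>

type_synonym ('r, 'm) tensors = "((int \<times> 'm) list \<Rightarrow>\<^sub>0 'r) set"

definition words :: "('r, 'm) graded_module \<Rightarrow> (int \<times> 'm) list set" where
  "words M = {w. \<forall>(i, x) \<in> set w. x \<in> component M i}"

definition word_degree :: "(int \<times> 'm) list \<Rightarrow> int" where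
  "word_degree w = sum_list (map fst w)"

definition word_relations ::
    "('r::comm_ring_1, 'm) graded_module \<Rightarrow> ((int \<times> 'm) list \<Rightarrow>\<^sub>0 'r) set" where
  "word_relations M = module.span free_scale
     ({gen (u @ (i, gadd M x y) # v) - gen (u @ (i, x) # v) - gen (u @ (i, y) # v) |i x y u v.
         u \<in> words M \<and> v \<in> words M \<and> x \<in> component M i \<and> y \<in> component M i} \<union>
      {gen (u @ (i, gscale M r x) # v) - free_scale r (gen (u @ (i, x) # v)) |i r x u v.
         u \<in> words M \<and> v \<in> words M \<and> x \<in> component M i})"

abbreviation tensor_class ::
    "('r::comm_ring_1, 'm) graded_module \<Rightarrow> ((int \<times> 'm) list \<Rightarrow>\<^sub>0 'r) \<Rightarrow> ('r, 'm) tensors" where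
  "tensor_class M \<equiv> residue (word_relations M)"

definition tensor_coalgebra ::
    "('r::comm_ring_1, 'm) graded_module \<Rightarrow> ('r, ('r, 'm) tensors) graded_module" where
  "tensor_coalgebra M = quotient_family free_scale
     (\<lambda>n. {p. Poly_Mapping.keys p \<subseteq> {w \<in> words M. word_degree w = n}}) (word_relations M)"

definition tensor_power ::
    "('r::comm_ring_1, 'm) graded_module \<Rightarrow> nat \<Rightarrow> int \<Rightarrow> ('r, 'm) tensors set" where
  "tensor_power M k n =
     tensor_class M ` {p. Poly_Mapping.keys p \<subseteq> {w \<in> words M. length w = k \<and> word_degree w = n}}"

definition koszul_exponent :: "(nat \<Rightarrow> nat) \<Rightarrow> (int \<times> 'm) list \<Rightarrow> int" where
  "koszul_exponent \<sigma> w =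
     (\<Sum>(i, j) \<in> {(i, j). i < j \<and> j < length w \<and> \<sigma> i > \<sigma> j}. fst (w ! \<sigma> i) * fst (w ! \<sigma> j))"

text \<open>
  The operation on the \<open>k\<close>-th tensor power of a permutation \<open>\<sigma>\<close> of \<open>{..<k}\<close>, which puts the factor
  number \<open>\<sigma> i\<close> in position \<open>i\<close>.  It is extended by zero to the other tensor powers, the
  representatives of a class in the \<open>k\<close>-th tensor power being determined only up to relations among
  words of arbitrary length.
\<close>

definition permute_tensors ::
    "('r::comm_ring_1, 'm) graded_module \<Rightarrow> nat \<Rightarrow> (nat \<Rightarrow> nat) \<Rightarrow> ('r, 'm) tensors \<Rightarrow> ('r, 'm) tensors"
  where
  "permute_tensors M k \<sigma> = induced (linear_extension free_scale
     (\<lambda>w. if length w = k then sgn_pow (koszul_exponent \<sigma> w) (gen (permute_list \<sigma> w)) else 0))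
     (word_relations M)"

definition symmetric_power ::
    "('r::comm_ring_1, 'm) graded_module \<Rightarrow> nat \<Rightarrow> int \<Rightarrow> ('r, 'm) tensors set" where
  "symmetric_power M k n =
     {c \<in> tensor_power M k n. \<forall>\<sigma>. \<sigma> permutes {..<k} \<longrightarrow> permute_tensors M k \<sigma> c = c}"

text \<open>
  The elements of degree \<open>n\<close> of \<open>\<Oplus>\<^sub>k S\<^sub>k\<close>: finite sums of elements of degree \<open>n\<close> of the symmetric
  powers, the sums being formed on representatives.
\<close>

definition symmetric_coalgebra ::
    "('r::comm_ring_1, 'm) graded_module \<Rightarrow> ('r, ('r, 'm) tensors) graded_module" where
  "symmetric_coalgebra M = (tensor_coalgebra M)\<lparr>component :=
     (\<lambda>n. {tensor_class M (\<Sum>k<K. p k) |(K::nat) p.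
             \<forall>k<K. tensor_class M (p k) \<in> symmetric_power M k n})\<rparr>"

definition deconcatenation ::
    "('r::comm_ring_1, 'm) graded_module \<Rightarrow> ('r, 'm) tensors \<Rightarrow>
     ((int \<times> ('r, 'm) tensors) \<times> (int \<times> ('r, 'm) tensors) \<Rightarrow>\<^sub>0 'r) set" where
  "deconcatenation M = induced (linear_extension free_scale
     (\<lambda>w. \<Sum>l\<le>length w.
        gen ((word_degree (take l w), tensor_class M (gen (take l w))),
             (word_degree (drop l w), tensor_class M (gen (drop l w))))))
     (tensor_relations (tensor_coalgebra M) (tensor_coalgebra M))"

text \<open>
  The diagonal of the symmetric coalgebra \<open>S\<close> as a subcoalgebra of the tensor coalgebra \<open>T\<close>: the
  element of \<open>S \<otimes> S\<close> whose image in \<open>T \<otimes> T\<close> is the deconcatenation of \<open>c\<close>.  Over a ring containing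
  the rationals \<open>S\<close> is a retract of \<open>T\<close>, whence it is unique.
\<close>

definition symmetric_diagonal ::
    "('r::comm_ring_1, 'm) graded_module \<Rightarrow> ('r, 'm) tensors \<Rightarrow>
     ((int \<times> ('r, 'm) tensors) \<times> (int \<times> ('r, 'm) tensors) \<Rightarrow>\<^sub>0 'r) set" where
  "symmetric_diagonal M c =
     (THE z. (\<exists>n. z \<in> component (tensor (symmetric_coalgebra M) (symmetric_coalgebra M)) n) \<and>
        induced (\<lambda>p. p) (tensor_relations (tensor_coalgebra M) (tensor_coalgebra M)) z =
        deconcatenation M c)"

text \<open>
  The cup bracket of \<open>a\<close> and \<open>b\<close>, where \<open>b\<close> has degree \<open>q\<close>.  By the Koszul rule,
  \<open>(a \<otimes> b) (u \<otimes> v) = (-1)\<^bsup>q\<bar>u\<bar>\<^esup> a u \<otimes> b v\<close>.  The linear extension is constant on the class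
  of representatives to which it is applied.
\<close>

definition cup_bracket ::
    "('r::comm_ring_1 \<Rightarrow> 'a::ab_group_add \<Rightarrow> 'a) \<Rightarrow> ('a \<Rightarrow> 'a \<Rightarrow> 'a) \<Rightarrow> ('r, 'm) graded_module \<Rightarrow> int \<Rightarrow>
     (('r, 'm) tensors \<Rightarrow> 'a) \<Rightarrow> (('r, 'm) tensors \<Rightarrow> 'a) \<Rightarrow> ('r, 'm) tensors \<Rightarrow> 'a" where
  "cup_bracket scale br M q a b c =
     the_elem (linear_extension scale (\<lambda>((i, u), (j, v)). sgn_pow (q * i) (br (a u) (b v))) `
       symmetric_diagonal M c)"

text \<open>
  The universal twisting cochain of a graded Lie algebra depends only on its underlying graded module
  \<open>H\<close>.  The classes of the one-letter words make up the symmetric power of weight 1.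
\<close>

definition universal_twisting_cochain ::
    "('r::comm_ring_1, 'm) graded_module \<Rightarrow> (('r, 'm) tensors \<Rightarrow> 'm) \<Rightarrow> bool" where
  "universal_twisting_cochain H t \<longleftrightarrow>
     graded_hom (-1) (symmetric_coalgebra (suspension H)) H t \<and>
     (\<forall>j. \<forall>x \<in> component (suspension H) j. t (tensor_class (suspension H) (gen [(j, x)])) = x) \<and>
     (\<forall>k n. k \<noteq> 1 \<longrightarrow> (\<forall>c \<in> symmetric_power (suspension H) k n. t c = gzero H))"

end

theory Submission
  imports Defs
begin

text \<open>
  The solution is built recursively: \<open>\<tau>\<^sub>1 = \<nabla>\<close> and
  \<open>\<tau>\<^sub>k = - 1/2 h (\<Sum>\<^bsub>i + j = k\<^esub> [\<tau>\<^sub>i, \<tau>\<^sub>j])\<close>.  On \<open>ker \<Delta>\<close> the bracket is \<open>\<plusminus> \<Delta> (x y)\<close>, so the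
  cup bracket takes values in \<open>im \<Delta>\<close> and is killed by \<open>\<pi>\<close>; it is a cycle by the Jacobi identity, whence
  \<open>d h + h d = \<nabla> \<pi> - Id\<close> turns the recursion into the master equation.

  The recursion is run on arbitrary words rather than on symmetric tensors, with the cup bracket
  replaced by its average over all signed permutations of the letters.  As a symmetric tensor equals its own
  average, the two versions agree on the symmetric coalgebra.  The diagonal of the latter exists and
  is unique because averaging makes it a retract of the tensor coalgebra and because averaging over
  a Young subgroup is absorbed by averaging over the full symmetric group.
\<close>

text \<open>The cup bracket is defined through a definite description of the diagonal inside a
  tensor product of quotients, which does not lend itself to recursion, whereas on words the
  diagonal is cutting by \<open>take\<close> and \<open>drop\<close>. The price is that single words
  are not symmetric: antisymmetry and the Jacobi identity permute their arguments and are invisible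
  word by word. They become available inside an average, which does not change when the blocks of a
  cut word are rotated with their Koszul sign.

  The minus sign in the recursion comes from the convention for the homotopy: on a cycle in im
  \<Delta> it reads d h = - Id. The rationals enter through 1/2, through 1/k! in the averages, and
  through 1/3, because the Jacobi identity only shows that three times the relevant sum over three
  blocks vanishes. The cochain is 0 on the empty word, so cuts with an empty half contribute nothing
  and each weight depends only on smaller ones.\<close>

section \<open>Signs, and degrees of words\<close>

lemma sgn_pow_0 [simp]: "sgn_pow 0 x = x"
  by (simp add: sgn_pow_def)

lemma sgn_pow_sgn_pow [simp]: "sgn_pow m (sgn_pow n x) = sgn_pow (m + n) (x :: 'b::group_add)"
  by (simp add: sgn_pow_def)

lemma sgn_pow_cong: "even (m - n) \<Longrightarrow> sgn_pow m x = sgn_pow n (x :: 'b::group_add)"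
  by (auto simp: sgn_pow_def)

lemma sgn_pow_zero [simp]: "sgn_pow n 0 = (0 :: 'b::group_add)"
  by (simp add: sgn_pow_def)

lemma sgn_pow_neg [simp]: "sgn_pow n (- x) = - sgn_pow n (x :: 'b::group_add)"
  by (simp add: sgn_pow_def)

lemma sgn_pow_add: "sgn_pow n (x + y) = sgn_pow n x + sgn_pow n (y :: 'b::ab_group_add)"
  by (simp add: sgn_pow_def)

lemma sgn_pow_sum: "sgn_pow n (sum f S) = (\<Sum>x\<in>S. sgn_pow n (f x :: 'b::ab_group_add))"
  by (simp add: sgn_pow_def sum_negf)

lemma sgn_pow_minus: "sgn_pow n (x - y) = sgn_pow n x - sgn_pow n (y :: 'b::ab_group_add)"
  by (simp add: sgn_pow_def)

lemma (in module) scale_sgn_pow: "scale r (sgn_pow n x) = sgn_pow n (scale r x)"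
  by (simp add: sgn_pow_def)

lemma (in module_hom) hom_sgn_pow: "f (sgn_pow n x) = sgn_pow n (f x)"
  by (simp add: sgn_pow_def neg)

lemma word_degree_append [simp]: "word_degree (u @ v) = word_degree u + word_degree v"
  by (simp add: word_degree_def)

lemma word_degree_Cons [simp]: "word_degree ((i, x) # v) = i + word_degree v"
  by (simp add: word_degree_def)

lemma word_degree_Nil [simp]: "word_degree [] = 0"
  by (simp add: word_degree_def)

lemma word_degree_take_drop: "word_degree (take l w) + word_degree (drop l w) = word_degree w"
  by (metis append_take_drop_id word_degree_append)

lemma word_degree_mset: "mset u = mset w \<Longrightarrow> word_degree u = word_degree w"
  unfolding word_degree_def by (metis mset_map sum_mset_sum_list)

lemma words_Nil [simp]: "[] \<in> words M"
  by (simp add: words_def)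

lemma words_append [simp]: "u @ v \<in> words M \<longleftrightarrow> u \<in> words M \<and> v \<in> words M"
  by (auto simp: words_def)

lemma words_Cons [simp]: "(i, x) # v \<in> words M \<longleftrightarrow> x \<in> component M i \<and> v \<in> words M"
  by (auto simp: words_def)

lemma words_take [simp]: "w \<in> words M \<Longrightarrow> take l w \<in> words M"
  by (auto simp: words_def dest: in_set_takeD)

lemma words_drop [simp]: "w \<in> words M \<Longrightarrow> drop l w \<in> words M"
  by (auto simp: words_def dest: in_set_dropD)

lemma words_mset: "mset u = mset w \<Longrightarrow> u \<in> words M \<longleftrightarrow> w \<in> words M"
  by (drule mset_eq_setD) (simp add: words_def)


section \<open>Koszul signs\<close>

text \<open>Only degrees enter the exponent, so replacing a letter by another of the same degree, as
  in a multilinearity argument, leaves the sign alone.\<close>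

lemma koszul_exponent_map_fst:
  assumes "map fst u = map fst w" "\<sigma> permutes {..<length u}"
  shows "koszul_exponent \<sigma> u = koszul_exponent \<sigma> w"
proof -
  have l: "length u = length w" using assms(1) by (metis length_map)
  have *: "fst (u ! i) = fst (w ! i)" if "i < length u" for i
    using assms(1) that l by (metis nth_map)
  show ?thesis
    unfolding koszul_exponent_def l
    using permutes_in_image[OF assms(2)] * l
    by (intro sum.cong) auto
qed

text \<open>Cocycle rule: a pair of positions is inverted by \<open>\<sigma> \<circ> \<tau>\<close>
  exactly when either \<tau> inverts it or \<sigma> inverts its image under \<tau>, but not both.
  The exponents therefore agree modulo 2, though not in general as integers.\<close>

lemma even_koszul_exponent_compose:
  assumes s: "\<sigma> permutes {..<length w}" and t: "\<tau> permutes {..<length w}"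
  shows "even (koszul_exponent (\<sigma> \<circ> \<tau>) w
     - (koszul_exponent \<sigma> w + koszul_exponent \<tau> (permute_list \<sigma> w)))"
proof -
  define k where "k = length w"
  define Q where "Q = {(i::nat, j). i < j \<and> j < k}"
  define e where "e i = fst (w ! i)" for i
  have fQ: "finite Q"
    by (rule finite_subset[of _ "{..<k} \<times> {..<k}"]) (auto simp: Q_def)
  \<comment> \<open>The contribution of the unordered pair of \<open>a\<close> and \<open>b\<close>
    to the exponent of \<sigma>. Its symmetry allows the sum over increasing pairs to be transported
    along \<tau>.\<close>
  define g where "g a b = (if (a < b \<and> \<sigma> a > \<sigma> b) \<or> (b < a \<and> \<sigma> b > \<sigma> a)
    then e (\<sigma> a) * e (\<sigma> b) else 0)" for a b
  have tl: "\<tau> i < k" if "i < k" for i using permutes_in_image[OF t] that by (auto simp: k_def)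
  have til: "inv \<tau> i < k" if "i < k" for i
    using permutes_in_image[OF permutes_inv[OF t]] that by (auto simp: k_def)
  have inj: "inj \<sigma>" "inj \<tau>" using permutes_inj s t by auto
  note ti = permutes_inverses[OF t]
  have gs: "g a b = g b a" for a b by (auto simp: g_def)
  have K: "koszul_exponent \<rho> v = (\<Sum>(i,j)\<in>Q. if \<rho> i > \<rho> j then fst (v!\<rho> i) * fst (v!\<rho> j) else 0)"
    if "length v = k" for \<rho> and v :: "(int \<times> 'b) list"
    unfolding koszul_exponent_def that
    by (rule sum.mono_neutral_cong_left[OF fQ]) (auto simp: Q_def split: if_splits)
  \<comment> \<open>\<tau> permutes unordered pairs; \<open>min\<close> and \<open>max\<close> put
    the image back into increasing order.\<close>
  have "(\<Sum>(i,j)\<in>Q. g (\<tau> i) (\<tau> j)) = (\<Sum>(i,j)\<in>Q. g i j)"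
  proof (rule sum.reindex_bij_witness[where
        j = "\<lambda>(i,j). (min (\<tau> i) (\<tau> j), max (\<tau> i) (\<tau> j))" and
        i = "\<lambda>(i,j). (min (inv \<tau> i) (inv \<tau> j), max (inv \<tau> i) (inv \<tau> j))"])
    fix p assume "p \<in> Q"
    then obtain i j where p: "p = (i,j)" "i < j" "j < k" by (auto simp: Q_def)
    have tne: "\<tau> i \<noteq> \<tau> j" using p inj by (auto dest: injD)
    have ine: "inv \<tau> i \<noteq> inv \<tau> j" using p ti by (metis less_irrefl)
    have "i < k" using p by simp
    note b = tl[OF this] tl[OF p(3)] til[OF this] til[OF p(3)]
    show "(case (case p of (i, j) \<Rightarrow> (min (\<tau> i) (\<tau> j), max (\<tau> i) (\<tau> j))) of
              (i, j) \<Rightarrow> (min (inv \<tau> i) (inv \<tau> j), max (inv \<tau> i) (inv \<tau> j))) = p"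
      using p ti by (auto simp: min_def max_def)
    show "(case p of (i, j) \<Rightarrow> (min (\<tau> i) (\<tau> j), max (\<tau> i) (\<tau> j))) \<in> Q"
      using p tne b by (auto simp: Q_def min_def max_def)
    show "(case (case p of (i, j) \<Rightarrow> (min (inv \<tau> i) (inv \<tau> j), max (inv \<tau> i) (inv \<tau> j))) of
              (i, j) \<Rightarrow> (min (\<tau> i) (\<tau> j), max (\<tau> i) (\<tau> j))) = p"
      using p ti by (auto simp: min_def max_def)
    show "(case p of (i, j) \<Rightarrow> (min (inv \<tau> i) (inv \<tau> j), max (inv \<tau> i) (inv \<tau> j))) \<in> Q"
      using p ine b by (auto simp: Q_def min_def max_def)
    show "(case (case p of (i, j) \<Rightarrow> (min (\<tau> i) (\<tau> j), max (\<tau> i) (\<tau> j))) of (i, j) \<Rightarrow> g i j)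
       = (case p of (i, j) \<Rightarrow> g (\<tau> i) (\<tau> j))"
      using p gs by (auto simp: min_def max_def)
  qed
  moreover have "koszul_exponent \<sigma> w = (\<Sum>(i,j)\<in>Q. g i j)"
    unfolding K[OF k_def[symmetric]] by (rule sum.cong) (auto simp: Q_def g_def e_def)
  ultimately have Ks: "koszul_exponent \<sigma> w = (\<Sum>(i,j)\<in>Q. g (\<tau> i) (\<tau> j))" by simp
  have Kt: "koszul_exponent \<tau> (permute_list \<sigma> w) =
      (\<Sum>(i,j)\<in>Q. if \<tau> i > \<tau> j then e (\<sigma> (\<tau> i)) * e (\<sigma> (\<tau> j)) else 0)"
    apply (subst K)
     apply (simp add: k_def)
    apply (rule sum.cong)
     apply (auto simp: Q_def e_def)
     apply (subst (1 2) permute_list_nth[OF s])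
       apply (use tl in \<open>auto simp: k_def\<close>)
    done
  have Kst: "koszul_exponent (\<sigma> \<circ> \<tau>) w =
      (\<Sum>(i,j)\<in>Q. if \<sigma> (\<tau> i) > \<sigma> (\<tau> j) then e (\<sigma> (\<tau> i)) * e (\<sigma> (\<tau> j)) else 0)"
    unfolding K[OF k_def[symmetric]] e_def comp_apply by (rule refl)
  \<comment> \<open>The three exponents are now sums over the same pairs, so evenness can be checked
    summand by summand.\<close>
  show ?thesis
    unfolding Ks Kt Kst sum.distrib[symmetric] sum_subtractf[symmetric]
  proof (rule dvd_sum, clarify, goal_cases)
    case (1 i j)
    then have "\<tau> i \<noteq> \<tau> j" "\<sigma> (\<tau> i) \<noteq> \<sigma> (\<tau> j)" using inj by (auto simp: Q_def dest!: injD)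
    then show ?case by (auto simp: g_def)
  qed
qed

section \<open>Block sums and block rotations\<close>

text \<open>The general element of the Young subgroup that preserves a cut after \<open>l\<close>
  letters. Averaging over such elements is averaging the two halves of a cut word
  separately.\<close>

definition direct_sum_perm :: "nat \<Rightarrow> (nat \<Rightarrow> nat) \<Rightarrow> (nat \<Rightarrow> nat) \<Rightarrow> nat \<Rightarrow> nat" where
  "direct_sum_perm l \<sigma> \<tau> i = (if i < l then \<sigma> i else l + \<tau> (i - l))"

lemma direct_sum_perm_permutes:
  assumes s: "\<sigma> permutes {..<l}" and t: "\<tau> permutes {..<k - l}" and "l \<le> k"
  shows "direct_sum_perm l \<sigma> \<tau> permutes {..<k}"
proof (rule bij_imp_permutes)
  have sl: "\<sigma> i < l \<longleftrightarrow> i < l" for i using permutes_in_image[OF s] by auto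
  have tl: "\<tau> i < k - l \<longleftrightarrow> i < k - l" for i using permutes_in_image[OF t] by auto
  show "bij_betw (direct_sum_perm l \<sigma> \<tau>) {..<k} {..<k}"
  proof (rule bij_betwI')
    fix i j assume "i \<in> {..<k}" "j \<in> {..<k}"
    have "\<sigma> i = \<sigma> j \<longleftrightarrow> i = j" "\<tau> (i - l) = \<tau> (j - l) \<longleftrightarrow> i - l = j - l"
      using inj_eq[OF permutes_inj[OF s]] inj_eq[OF permutes_inj[OF t]] by auto
    then show "direct_sum_perm l \<sigma> \<tau> i = direct_sum_perm l \<sigma> \<tau> j \<longleftrightarrow> i = j"
      using sl[of i] sl[of j] by (auto simp: direct_sum_perm_def)
  next
    fix i assume "i \<in> {..<k}"
    then show "direct_sum_perm l \<sigma> \<tau> i \<in> {..<k}"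
      using sl[of i] tl[of "i - l"] \<open>l \<le> k\<close> by (auto simp: direct_sum_perm_def)
  next
    fix y assume y: "y \<in> {..<k}"
    show "\<exists>x\<in>{..<k}. y = direct_sum_perm l \<sigma> \<tau> x"
    proof (cases "y < l")
      case True
      then show ?thesis using permutes_inverses[OF s] sl[of "inv \<sigma> y"] \<open>l \<le> k\<close>
        by (intro bexI[of _ "inv \<sigma> y"]) (auto simp: direct_sum_perm_def)
    next
      case False
      then show ?thesis using permutes_inverses[OF t] tl[of "inv \<tau> (y - l)"] y
        by (intro bexI[of _ "l + inv \<tau> (y - l)"]) (auto simp: direct_sum_perm_def)
    qed
  qed
  fix i assume "i \<notin> {..<k}"
  then show "direct_sum_perm l \<sigma> \<tau> i = i"
    using t \<open>l \<le> k\<close> by (auto simp: direct_sum_perm_def permutes_def)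
qed

lemma permute_list_direct_sum_perm:
  assumes s: "\<sigma> permutes {..<l}" and t: "\<tau> permutes {..<length w - l}" and l: "l \<le> length w"
  shows "permute_list (direct_sum_perm l \<sigma> \<tau>) w =
    permute_list \<sigma> (take l w) @ permute_list \<tau> (drop l w)"
proof (rule nth_equalityI)
  show "length (permute_list (direct_sum_perm l \<sigma> \<tau>) w)
    = length (permute_list \<sigma> (take l w) @ permute_list \<tau> (drop l w))" using l by simp
  fix i assume i: "i < length (permute_list (direct_sum_perm l \<sigma> \<tau>) w)"
  have "\<sigma> i < l" if "i < l" using permutes_in_image[OF s] that by auto
  then show "permute_list (direct_sum_perm l \<sigma> \<tau>) w ! i =
    (permute_list \<sigma> (take l w) @ permute_list \<tau> (drop l w)) ! i"
    using i l by (auto simp: nth_append permute_list_def direct_sum_perm_def)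
qed

text \<open>A pair straddling the cut is never inverted, so the inversions are those of \<sigma>
  together with those of \<tau> shifted by \<open>l\<close>.\<close>

lemma koszul_exponent_direct_sum_perm:
  assumes s: "\<sigma> permutes {..<l}" and t: "\<tau> permutes {..<length w - l}" and l: "l \<le> length w"
  shows "koszul_exponent (direct_sum_perm l \<sigma> \<tau>) w =
    koszul_exponent \<sigma> (take l w) + koszul_exponent \<tau> (drop l w)"
proof -
  define k where "k = length w"
  have sl: "\<sigma> i < l \<longleftrightarrow> i < l" for i using permutes_in_image[OF s] by auto
  define S where "S = {(i::nat, j). i < j \<and> j < l \<and> \<sigma> i > \<sigma> j}"
  define T where "T = {(i::nat, j). i < j \<and> j < k - l \<and> \<tau> i > \<tau> j}"
  have f: "finite S" "finite T"
    by (rule finite_subset[of _ "{..<k} \<times> {..<k}"], use l in \<open>auto simp: S_def T_def k_def\<close>)+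
  have eq: "{(i, j). i < j \<and> j < length w \<and> direct_sum_perm l \<sigma> \<tau> i > direct_sum_perm l \<sigma> \<tau> j}
    = S \<union> (\<lambda>(i,j). (l + i, l + j)) ` T" (is "?L = ?R")
  proof (intro set_eqI iffI)
    fix p assume "p \<in> ?R"
    then show "p \<in> ?L" using l by (auto simp: S_def T_def direct_sum_perm_def k_def)
  next
    fix p assume "p \<in> ?L"
    then obtain i j where p: "p = (i,j)" "i < j" "j < k"
       "direct_sum_perm l \<sigma> \<tau> i > direct_sum_perm l \<sigma> \<tau> j" by (auto simp: k_def)
    consider "j < l" | "i < l" "l \<le> j" | "l \<le> i" by linarith
    then show "p \<in> ?R"
    proof cases
      case 1
      then show ?thesis using p by (auto simp: S_def direct_sum_perm_def)
    next
      case 2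
      then show ?thesis using p sl[of i] by (auto simp: direct_sum_perm_def)
    next
      case 3
      then have "(i - l, j - l) \<in> T" "p = (\<lambda>(i,j). (l + i, l + j)) (i - l, j - l)"
        using p by (auto simp: T_def direct_sum_perm_def)
      then show ?thesis by blast
    qed
  qed
  have inj: "inj_on (\<lambda>(i,j). (l + i, l + j :: nat)) T" by (auto simp: inj_on_def)
  have dis: "S \<inter> (\<lambda>(i,j). (l + i, l + j)) ` T = {}" by (auto simp: S_def)
  show ?thesis
    unfolding koszul_exponent_def eq
    apply (subst sum.union_disjoint[OF f(1) finite_imageI[OF f(2)] dis])
    apply (subst sum.reindex[OF inj])
    apply (rule arg_cong2[where f = "(+)"])
    subgoal
      using l by (intro sum.cong) (auto simp: S_def direct_sum_perm_def sl)
    subgoal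
      using l by (intro sum.cong) (auto simp: T_def k_def direct_sum_perm_def)
    done
qed

text \<open>Adapted to \<open>permute_list\<close>, which reads the letter at the image of a
  position: the effect is to move the first \<open>l\<close> letters behind the others.\<close>

definition rotation_perm :: "nat \<Rightarrow> nat \<Rightarrow> nat \<Rightarrow> nat" where
  "rotation_perm k l i = (if i < k - l then i + l else if i < k then i - (k - l) else i)"

lemma rotation_perm_permutes:
  assumes "l \<le> k"
  shows "rotation_perm k l permutes {..<k}"
proof (rule bij_imp_permutes)
  show "bij_betw (rotation_perm k l) {..<k} {..<k}"
    by (rule bij_betw_byWitness[where f' = "\<lambda>j. if j < l then j + (k - l) else j - l"])
      (use assms in \<open>auto simp: rotation_perm_def\<close>)
qed (auto simp: rotation_perm_def)

lemma permute_list_rotation_perm: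
  "l \<le> length w \<Longrightarrow> permute_list (rotation_perm (length w) l) w = drop l w @ take l w"
  by (rule nth_equalityI) (auto simp: permute_list_def rotation_perm_def nth_append add.commute)

lemma word_degree_conv_sum: "word_degree w = (\<Sum>i<length w. fst (w ! i))"
  by (simp add: word_degree_def sum_list_sum_nth atLeast0LessThan)

text \<open>The inverted pairs are exactly those with one position in each of the two exchanged
  blocks, so the exponent factors into two sums of degrees.\<close>

lemma koszul_exponent_rotation_perm:
  assumes l: "l \<le> length w"
  shows "koszul_exponent (rotation_perm (length w) l) w =
    word_degree (take l w) * word_degree (drop l w)"
proof -
  define k where "k = length w"
  have eq: "{(i, j). i < j \<and> j < k \<and> rotation_perm k l i > rotation_perm k l j}
    = {..<k - l} \<times> {k - l..<k}"
    using l by (auto simp: rotation_perm_def k_def split: if_splits)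
  have 1: "word_degree (drop l w) = (\<Sum>i<k - l. fst (w ! rotation_perm k l i))"
    by (simp add: word_degree_conv_sum rotation_perm_def k_def add.commute)
  have 2: "word_degree (take l w) = (\<Sum>j=k - l..<k. fst (w ! rotation_perm k l j))"
    unfolding word_degree_conv_sum
    by (rule sum.reindex_bij_witness[where i = "\<lambda>j. j - (k - l)" and j = "\<lambda>j. j + (k - l)"])
      (use l in \<open>auto simp: rotation_perm_def k_def\<close>)
  show ?thesis
    unfolding koszul_exponent_def eq[unfolded k_def] 1[unfolded k_def] 2[unfolded k_def]
    by (simp add: sum_product sum.cartesian_product mult.commute)
qed

text \<open>The letter \<open>a\<close> lands at the position that \<sigma> sends to
  \<open>length u\<close>, and its surroundings do not depend on \<open>a\<close>. This uniformity
  is what carries an identity in one letter through a permutation.\<close>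

lemma permute_list_insert:
  assumes "\<sigma> permutes {..<length u + Suc (length v)}"
  obtains u' v' where "\<And>a. permute_list \<sigma> (u @ a # v) = u' @ a # v'"
    "\<And>a. mset (u' @ a # v') = mset (u @ a # v)"
proof -
  define p where "p = inv \<sigma> (length u)"
  define W where "W a = permute_list \<sigma> (u @ a # v)" for a
  have sp: "\<sigma> p = length u" using permutes_inverses[OF assms] by (simp add: p_def)
  have pl: "p < length u + Suc (length v)"
    using permutes_in_image[OF assms, of p] sp by auto
  have lW: "length (W a) = length u + Suc (length v)" for a by (simp add: W_def)
  have nW: "W a ! i = (u @ a # v) ! \<sigma> i" if "i < length u + Suc (length v)" for a i
    using that unfolding W_def permute_list_def by (subst nth_map) (auto simp del: upt_Suc)
  have ne: "\<sigma> i \<noteq> length u" if "i \<noteq> p" for i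
    using that sp permutes_inj[OF assms] by (metis injD)
  have eq: "W a ! i = W b ! i" if "i < length u + Suc (length v)" "i \<noteq> p" for a b i
    using that ne[OF that(2)] by (auto simp: nW nth_append nth_Cons')
  \<comment> \<open>\<open>undefined\<close> only picks some letter: outside position
    \<open>p\<close> all the words \<open>W a\<close> agree.\<close>
  have "W a = take p (W undefined) @ a # drop (Suc p) (W undefined)" for a
  proof -
    have 1: "W a = take p (W a) @ W a ! p # drop (Suc p) (W a)"
      using pl lW by (intro id_take_nth_drop) simp
    have 2: "take p (W a) = take p (W undefined)"
      using pl lW by (auto intro!: nth_equalityI eq)
    have 3: "drop (Suc p) (W a) = drop (Suc p) (W undefined)"
      using pl lW by (auto intro!: nth_equalityI eq)
    have 4: "W a ! p = a" using pl sp by (simp add: nW)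
    show ?thesis using 1 2 3 4 by metis
  qed
  note D = this
  show thesis
  proof (rule that)
    fix a show "permute_list \<sigma> (u @ a # v) = take p (W undefined) @ a # drop (Suc p) (W undefined)"
      using D[of a] unfolding W_def .
    then show "mset (take p (W undefined) @ a # drop (Suc p) (W undefined)) = mset (u @ a # v)"
      using assms by (metis mset_permute_list length_append length_Cons)
  qed
qed


section \<open>Averages over permutations\<close>

definition signed_term :: "((int \<times> 'm) list \<Rightarrow> 'b::uminus) \<Rightarrow> (int \<times> 'm) list \<Rightarrow> (nat \<Rightarrow> nat) \<Rightarrow> 'b" where
  "signed_term F w \<sigma> = sgn_pow (koszul_exponent \<sigma> w) (F (permute_list \<sigma> w))"

text \<open>Averages are taken with values in three kinds of module: the algebra, combinations of
  words, and combinations of pairs of tensor classes. A locale over the target serves all of them,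
  and \<open>average_hom\<close> passes from one to another.\<close>

locale rational_module = module scale
  for scale :: "'r::comm_ring_1 \<Rightarrow> 'b::ab_group_add \<Rightarrow> 'b" +
  fixes q :: "rat \<Rightarrow> 'r"
  assumes q: "contains_rationals q"
begin

lemma q_simps: "q 1 = 1" "q (x + y) = q x + q y" "q (x * y) = q x * q y"
  using q by (auto simp: contains_rationals_def)

lemma q_0: "q 0 = 0"
  using q_simps(2)[of 0 0] by simp

lemma q_of_nat: "q (of_nat n) = of_nat n"
  by (induction n) (auto simp: q_0 q_simps)

lemma q_inverse_of_nat: "n \<noteq> 0 \<Longrightarrow> q (1 / of_nat n) * of_nat n = 1"
  by (metis q_of_nat q_simps(1) q_simps(3) nonzero_eq_divide_eq of_nat_eq_0_iff)

lemma scale_q_divide: "n \<noteq> 0 \<Longrightarrow> scale (q (1 / of_nat n)) (scale (of_nat n) x) = x"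
  by (simp add: q_inverse_of_nat)

definition average :: "((int \<times> 'm) list \<Rightarrow> 'b) \<Rightarrow> (int \<times> 'm) list \<Rightarrow> 'b" where
  "average F w = scale (q (1 / of_nat (fact (length w))))
     (\<Sum>\<sigma> | \<sigma> permutes {..<length w}. signed_term F w \<sigma>)"

text \<open>Only rearrangements of \<open>w\<close> are ever evaluated, so whatever is invariant
  under rearrangement, such as length, degree or membership in \<open>words M\<close>, may be used
  in comparing \<open>F\<close> with \<open>G\<close>.\<close>

lemma average_cong:
  assumes "\<And>w'. mset w' = mset w \<Longrightarrow> F w' = G w'"
  shows "average F w = average G w"
  unfolding average_def signed_term_def
  by (intro arg_cong[where f = "scale _"] sum.cong arg_cong[where f = "sgn_pow _"] assms)
    (auto intro: mset_permute_list)

lemma average_add: "average (\<lambda>w. F w + G w) w = average F w + average G w"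
  by (simp add: average_def signed_term_def sgn_pow_add sum.distrib scale_right_distrib)

lemma average_zero [simp]: "average (\<lambda>w. 0) w = 0"
  by (simp add: average_def signed_term_def)

lemma average_uminus: "average (\<lambda>w. - F w) w = - average F w"
  by (simp add: average_def signed_term_def sum_negf)

lemma average_diff: "average (\<lambda>w. F w - G w) w = average F w - average G w"
  using average_add[of F "\<lambda>w. - G w" w] by (simp add: average_uminus)

lemma average_sum: "average (\<lambda>w. \<Sum>i\<in>I. F i w) w = (\<Sum>i\<in>I. average (F i) w)"
  by (induction I rule: infinite_finite_induct) (auto simp: average_add)

lemma average_subspace:
  assumes "subspace S" "\<And>w'. mset w' = mset w \<Longrightarrow> F w' \<in> S"
  shows "average F w \<in> S"
proof -
  have "signed_term F w \<sigma> \<in> S" if "\<sigma> permutes {..<length w}" for \<sigma>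
    using assms that by (auto simp: signed_term_def sgn_pow_def subspace_neg)
  then show ?thesis
    unfolding average_def using assms(1) by (auto intro!: subspace_scale subspace_sum)
qed

lemma average_hom:
  assumes "rational_module scale2 q" "module_hom scale scale2 f"
  shows "f (average F w) = rational_module.average scale2 q (\<lambda>w. f (F w)) w"
proof -
  interpret m2: rational_module scale2 q by fact
  interpret f: module_hom scale scale2 f by fact
  show ?thesis
    by (simp add: average_def m2.average_def signed_term_def
        f.scale f.sum f.hom_sgn_pow)
qed

lemma average_scale: "average (\<lambda>w. scale r (F w)) w = scale r (average F w)"
  by (simp add: average_def signed_term_def scale_sgn_pow[symmetric]
      scale_sum_right[symmetric] mult.commute)

text \<open>By the cocycle rule the terms become those of \<open>\<sigma> \<circ> \<rho>\<close>,
  and right translation by \<rho> is a bijection of the symmetric group.\<close>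

lemma average_permute:
  assumes "\<rho> permutes {..<length w}"
  shows "average (\<lambda>w. sgn_pow (koszul_exponent \<rho> w) (F (permute_list \<rho> w))) w = average F w"
proof -
  have "(\<Sum>\<sigma> | \<sigma> permutes {..<length w}.
      signed_term (\<lambda>w. sgn_pow (koszul_exponent \<rho> w) (F (permute_list \<rho> w))) w \<sigma>)
    = (\<Sum>\<sigma> | \<sigma> permutes {..<length w}. signed_term F w (\<sigma> \<circ> \<rho>))"
    unfolding signed_term_def
    by (rule sum.cong) (auto simp: permute_list_compose[OF assms]
        intro!: sgn_pow_cong dest: even_koszul_exponent_compose[OF _ assms])
  also have "\<dots> = (\<Sum>\<sigma> | \<sigma> permutes {..<length w}. signed_term F w \<sigma>)"
    by (rule sum_permutations_compose_right[OF assms, symmetric])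
  finally show ?thesis by (simp add: average_def)
qed

lemma average_const_sum:
  assumes "\<And>\<sigma>. \<sigma> permutes {..<k} \<Longrightarrow> f \<sigma> = x"
  shows "scale (q (1 / of_nat (fact k))) (\<Sum>\<sigma> | \<sigma> permutes {..<k}. f \<sigma>) = x"
proof -
  have "(\<Sum>\<sigma> | \<sigma> permutes {..<k}. f \<sigma>) = (\<Sum>\<sigma> | \<sigma> permutes {..<k}. x)"
    using assms by (intro sum.cong) auto
  also have "\<dots> = scale (of_nat (fact k)) x"
    by (simp only: sum_constant_scale card_permutations[OF card_lessThan finite_lessThan])
  finally show ?thesis by (simp only: scale_q_divide[OF fact_nonzero])
qed

text \<open>A permutation of the left block, extended by the identity, is absorbed by the full
  average, so the inner average is a mean of l! equal terms.\<close>

lemma average_take: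
  assumes l: "l \<le> length w"
  shows "average (\<lambda>w. average (\<lambda>u. F u (drop l w)) (take l w)) w
    = average (\<lambda>w. F (take l w) (drop l w)) w"
proof -
  let ?G = "\<lambda>\<sigma> w. sgn_pow (koszul_exponent \<sigma> (take l w)) (F (permute_list \<sigma> (take l w)) (drop l w))"
  have "average (\<lambda>w. average (\<lambda>u. F u (drop l w)) (take l w)) w =
    average (\<lambda>w. scale (q (1 / of_nat (fact l))) (\<Sum>\<sigma> | \<sigma> permutes {..<l}. ?G \<sigma> w)) w"
    using l by (intro average_cong)
      (auto simp: average_def[of _ "take l _"] signed_term_def min_absorb2 dest: mset_eq_length)
  \<comment> \<open>The block average is now an explicit sum over \<sigma> whose index set and
    normalisation depend on \<open>l\<close> only, so it can be moved outside the full
    average.\<close>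
  also have "\<dots> = scale (q (1 / of_nat (fact l))) (\<Sum>\<sigma> | \<sigma> permutes {..<l}. average (?G \<sigma>) w)"
    by (simp only: average_scale average_sum)
  also have "\<dots> = average (\<lambda>w. F (take l w) (drop l w)) w"
  proof (rule average_const_sum)
    fix \<sigma> :: "nat \<Rightarrow> nat" assume s: "\<sigma> permutes {..<l}"
    have i: "id permutes {..<length w - l}" by (rule permutes_id)
    let ?\<rho> = "direct_sum_perm l \<sigma> id"
    have K0: "koszul_exponent id v = 0" for v :: "(int \<times> 'c) list"
      by (auto simp: koszul_exponent_def intro!: sum.neutral)
    have "average (?G \<sigma>) w = average (\<lambda>w. sgn_pow (koszul_exponent ?\<rho> w)
       ((\<lambda>w. F (take l w) (drop l w)) (permute_list ?\<rho> w))) w"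
      using l i by (intro average_cong)
       (auto simp: koszul_exponent_direct_sum_perm[OF s] permute_list_direct_sum_perm[OF s] K0
           dest: mset_eq_length)
    also have "\<dots> = average (\<lambda>w. F (take l w) (drop l w)) w"
      by (rule average_permute[OF direct_sum_perm_permutes[OF s i l]])
    finally show "average (?G \<sigma>) w = average (\<lambda>w. F (take l w) (drop l w)) w" .
  qed
  finally show ?thesis .
qed

lemma average_drop:
  assumes l: "l \<le> length w"
  shows "average (\<lambda>w. average (\<lambda>v. F (take l w) v) (drop l w)) w
    = average (\<lambda>w. F (take l w) (drop l w)) w"
proof -
  define k where "k = length w - l"
  let ?G = "\<lambda>\<sigma> w. sgn_pow (koszul_exponent \<sigma> (drop l w)) (F (take l w) (permute_list \<sigma> (drop l w)))"
  have "average (\<lambda>w. average (\<lambda>v. F (take l w) v) (drop l w)) w =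
    average (\<lambda>w. scale (q (1 / of_nat (fact k))) (\<Sum>\<sigma> | \<sigma> permutes {..<k}. ?G \<sigma> w)) w"
    by (intro average_cong)
      (auto simp: average_def[of _ "drop l _"] signed_term_def k_def dest!: mset_eq_length)
  also have "\<dots> = scale (q (1 / of_nat (fact k))) (\<Sum>\<sigma> | \<sigma> permutes {..<k}. average (?G \<sigma>) w)"
    by (simp only: average_scale average_sum)
  also have "\<dots> = average (\<lambda>w. F (take l w) (drop l w)) w"
  proof (rule average_const_sum)
    fix \<sigma> :: "nat \<Rightarrow> nat" assume s: "\<sigma> permutes {..<k}"
    have i: "id permutes {..<l}" by (rule permutes_id)
    let ?\<rho> = "direct_sum_perm l id \<sigma>"
    have K0: "koszul_exponent id v = 0" for v :: "(int \<times> 'c) list"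
      by (auto simp: koszul_exponent_def intro!: sum.neutral)
    have "average (?G \<sigma>) w = average (\<lambda>w. sgn_pow (koszul_exponent ?\<rho> w)
       ((\<lambda>w. F (take l w) (drop l w)) (permute_list ?\<rho> w))) w"
    proof (intro average_cong)
      fix w' assume m: "mset w' = mset w"
      have L: "length w' = length w" using m by (rule mset_eq_length)
      have s': "\<sigma> permutes {..<length w' - l}" using s by (simp add: k_def L)
      have l': "l \<le> length w'" using l by (simp add: L)
      show "?G \<sigma> w' = sgn_pow (koszul_exponent ?\<rho> w')
       ((\<lambda>w. F (take l w) (drop l w)) (permute_list ?\<rho> w'))"
        using l' by (simp add: koszul_exponent_direct_sum_perm[OF i s' l']
           permute_list_direct_sum_perm[OF i s' l'] K0)
    qed
    also have "\<dots> = average (\<lambda>w. F (take l w) (drop l w)) w"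
      by (rule average_permute[OF direct_sum_perm_permutes[OF i s[unfolded k_def] l]])
    finally show "average (?G \<sigma>) w = average (\<lambda>w. F (take l w) (drop l w)) w" .
  qed
  finally show ?thesis .
qed

text \<open>Invariance under the block rotation. This is the form in which graded cocommutativity is
  used: inside an average the halves of a cut may be exchanged.\<close>

lemma average_rotate:
  assumes l: "l \<le> length w"
  shows "average (\<lambda>w. sgn_pow (word_degree (take l w) * word_degree (drop l w))
      (F (drop l w @ take l w))) w = average F w"
proof -
  let ?\<rho> = "rotation_perm (length w) l"
  have "average (\<lambda>w. sgn_pow (word_degree (take l w) * word_degree (drop l w))
      (F (drop l w @ take l w))) w = average (\<lambda>w. sgn_pow (koszul_exponent ?\<rho> w) (F (permute_list ?\<rho> w))) w"
  proof (rule average_cong)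
    fix w' assume "mset w' = mset w"
    then have L: "length w = length w'" by (metis mset_eq_length)
    then have l': "l \<le> length w'" using l by simp
    show "sgn_pow (word_degree (take l w') * word_degree (drop l w')) (F (drop l w' @ take l w'))
      = sgn_pow (koszul_exponent ?\<rho> w') (F (permute_list ?\<rho> w'))"
      by (simp add: L koszul_exponent_rotation_perm[OF l'] permute_list_rotation_perm[OF l'])
  qed
  also have "\<dots> = average F w" by (rule average_permute[OF rotation_perm_permutes[OF l]])
  finally show ?thesis .
qed

end

section \<open>Free modules and cosets\<close>

lemma image_eq_singleton: "a \<in> X \<Longrightarrow> (\<And>x. x \<in> X \<Longrightarrow> f x = c) \<Longrightarrow> f ` X = {c}"
  by auto

lemma lookup_free_scale [simp]:
  "Poly_Mapping.lookup (free_scale r p) g = r * Poly_Mapping.lookup p g"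
  by (simp add: free_scale_def Poly_Mapping.map.rep_eq when_def)

interpretation free: module free_scale
  by unfold_locales (rule poly_mapping_eqI; simp add: lookup_add algebra_simps)+

lemma free_scale_gen: "free_scale r (gen g) = Poly_Mapping.single g r"
  by (rule poly_mapping_eqI) (simp add: lookup_single when_def)

lemma keys_subspace:
  fixes G :: "'g set"
  shows "free.subspace {p :: 'g \<Rightarrow>\<^sub>0 'r::comm_ring_1. Poly_Mapping.keys p \<subseteq> G}"
proof -
  have "Poly_Mapping.keys p \<subseteq> G \<longleftrightarrow> (\<forall>g. g \<notin> G \<longrightarrow> Poly_Mapping.lookup p g = 0)"
    for p :: "'g \<Rightarrow>\<^sub>0 'r"
    by (auto simp: in_keys_iff)
  then show ?thesis by (simp add: free.subspace_def lookup_add)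
qed

context module
begin

lemma linear_extension_superset:
  assumes "finite S" "Poly_Mapping.keys p \<subseteq> S"
  shows "linear_extension scale \<phi> p = (\<Sum>g\<in>S. scale (Poly_Mapping.lookup p g) (\<phi> g))"
  unfolding linear_extension_def
  by (rule sum.mono_neutral_left) (use assms in \<open>auto simp: in_keys_iff\<close>)

lemma linear_extension_module_hom: "module_hom free_scale scale (linear_extension scale \<phi>)"
proof (rule module_hom.intro[OF free.module_axioms module_axioms], unfold_locales)
  fix p p' :: "'c \<Rightarrow>\<^sub>0 'a" and r
  let ?S = "Poly_Mapping.keys p \<union> Poly_Mapping.keys p'"
  have f: "finite ?S" by simp
  have k: "Poly_Mapping.keys (p + p') \<subseteq> ?S" by (rule Poly_Mapping.keys_add)
  have k': "Poly_Mapping.keys (free_scale r p) \<subseteq> ?S" by (auto simp: in_keys_iff)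
  show "linear_extension scale \<phi> (p + p') = linear_extension scale \<phi> p + linear_extension scale \<phi> p'"
    by (subst (1 2 3) linear_extension_superset[OF f])
      (use k in \<open>auto simp: lookup_add scale_left_distrib sum.distrib\<close>)
  show "linear_extension scale \<phi> (free_scale r p) = scale r (linear_extension scale \<phi> p)"
    by (subst (1 2) linear_extension_superset[OF f])
      (use k' in \<open>auto simp: scale_sum_right\<close>)
qed

lemma linear_extension_gen [simp]: "linear_extension scale \<phi> (gen g) = \<phi> g"
  by (subst linear_extension_superset[of "{g}"]) auto

lemma linear_extension_cong:
  "(\<And>g. g \<in> Poly_Mapping.keys p \<Longrightarrow> \<phi> g = \<psi> g) \<Longrightarrow>
    linear_extension scale \<phi> p = linear_extension scale \<psi> p"
  by (simp add: linear_extension_def)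

lemma linear_extension_diff:
  "linear_extension scale (\<lambda>g. \<phi> g - \<psi> g) p = linear_extension scale \<phi> p - linear_extension scale \<psi> p"
  by (simp add: linear_extension_def scale_right_diff_distrib sum_subtractf)

lemma linear_extension_scale:
  "linear_extension scale (\<lambda>g. scale r (\<phi> g)) p = scale r (linear_extension scale \<phi> p)"
  by (simp add: linear_extension_def scale_sum_right mult.commute)

lemma linear_extension_sum:
  "linear_extension scale (\<lambda>g. \<Sum>i\<in>I. \<phi> i g) p = (\<Sum>i\<in>I. linear_extension scale (\<phi> i) p)"
  unfolding linear_extension_def by (subst sum.swap) (simp add: scale_sum_right)

lemma linear_extension_subspace:
  "subspace S \<Longrightarrow> (\<And>g. g \<in> Poly_Mapping.keys p \<Longrightarrow> \<phi> g \<in> S) \<Longrightarrow> linear_extension scale \<phi> p \<in> S"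
  unfolding linear_extension_def by (intro subspace_sum subspace_scale)

end

lemma module_hom_linear_extension:
  assumes "module_hom s1 s2 f"
  shows "f (linear_extension s1 \<phi> p) = linear_extension s2 (\<lambda>g. f (\<phi> g)) p"
proof -
  interpret module_hom s1 s2 f by fact
  show ?thesis by (simp add: linear_extension_def sum scale)
qed

lemma linear_extension_gen_id: "linear_extension free_scale gen p = p"
  unfolding linear_extension_def free_scale_gen
  by (rule poly_mapping_eqI) (simp add: lookup_sum lookup_single when_def in_keys_iff)

lemma module_hom_span_subset:
  assumes "module_hom s1 s2 f" "module.subspace s2 S" "\<And>x. x \<in> B \<Longrightarrow> f x \<in> S"
    "p \<in> module.span s1 B"
  shows "f p \<in> S"
proof -
  interpret module_hom s1 s2 f by fact
  show ?thesis
    using m2.span_minimal[of "f ` B" S] assms(2-) by (auto simp: span_image)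
qed

context module
begin

lemma mem_residue: "y \<in> residue N x \<longleftrightarrow> y - x \<in> N"
proof
  assume "y - x \<in> N"
  then show "y \<in> residue N x" unfolding residue_def by (intro image_eqI[of _ _ "y - x"]) auto
qed (auto simp: residue_def)

lemma self_mem_residue: "subspace N \<Longrightarrow> x \<in> residue N x"
  by (simp add: mem_residue subspace_0)

lemma residue_eq_iff:
  assumes N: "subspace N"
  shows "residue N x = residue N y \<longleftrightarrow> x - y \<in> N"
proof
  assume "residue N x = residue N y"
  then have "x \<in> residue N y" using self_mem_residue[OF N, of x] by simp
  then show "x - y \<in> N" by (simp add: mem_residue)
next
  assume *: "x - y \<in> N"
  have "z - x \<in> N \<longleftrightarrow> z - y \<in> N" for z
    using subspace_add[OF N *, of "z - x"] subspace_diff[OF N _ *, of "z - y"] by auto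
  then show "residue N x = residue N y" by (auto simp: mem_residue)
qed

lemma residue_0: "residue N 0 = N"
  by (auto simp: mem_residue)

lemma residue_eq_0_iff: "subspace N \<Longrightarrow> residue N x = N \<longleftrightarrow> x \<in> N"
  using residue_eq_iff[of N x 0] by (simp add: residue_0)

lemma quotient_gadd:
  assumes N: "subspace N"
  shows "gadd (quotient_family scale G N) (residue N x) (residue N y) = residue N (x + y)"
proof -
  have "z \<in> residue N (x + y) \<Longrightarrow> \<exists>a b. z = a + b \<and> a \<in> residue N x \<and> b \<in> residue N y" for z
    by (intro exI[of _ "z - y"] exI[of _ y])
      (simp add: mem_residue subspace_0[OF N] diff_diff_eq add.commute)
  moreover have "a + b \<in> residue N (x + y)" if "a \<in> residue N x" "b \<in> residue N y" for a b
    using subspace_add[OF N, of "a - x" "b - y"] that by (simp add: mem_residue algebra_simps)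
  ultimately show ?thesis unfolding quotient_family_def by (auto simp del: mem_residue)
qed

lemma quotient_gscale:
  assumes N: "subspace N"
  shows "gscale (quotient_family scale G N) r (residue N x) = residue N (scale r x)"
proof -
  have "residue N (scale r a) = residue N (scale r x)" if "a \<in> residue N x" for a
    using subspace_scale[OF N, of "a - x" r] that
    by (simp add: mem_residue residue_eq_iff[OF N] scale_right_diff_distrib)
  then have "(\<Union>a\<in>residue N x. residue N (scale r a)) = residue N (scale r x)"
    using self_mem_residue[OF N, of x] by (intro SUP_eq_const) blast+
  then show ?thesis by (simp add: quotient_family_def)
qed

lemma quotient_gzero: "gzero (quotient_family scale G N) = N"
  by (simp add: quotient_family_def)

end

text \<open>All representatives of a coset give the same target coset, so the union that defines
  \<open>induced\<close> collapses.\<close>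

lemma induced_residue:
  assumes "module_hom s1 s2 f" "module.subspace s1 N" "module.subspace s2 N'"
    "\<And>x. x \<in> N \<Longrightarrow> f x \<in> N'"
  shows "induced f N' (residue N x) = residue N' (f x)"
proof -
  interpret module_hom s1 s2 f by fact
  have "residue N' (f y) = residue N' (f x)" if "y \<in> residue N x" for y
    using that assms(4)[of "y - x"] by (simp add: m1.mem_residue m2.residue_eq_iff[OF assms(3)] diff)
  then show ?thesis
    unfolding induced_def using m1.self_mem_residue[OF assms(2), of x] by (intro SUP_eq_const) blast+
qed


section \<open>Multilinear functions of words\<close>

text \<open>Linearity in each letter is asked for only modulo a submodule \<open>S\<close>:
  functions with values in a free module on symbols are linear up to relations, while
  \<open>S = {0}\<close> is used for values in the algebra.\<close>

definition multilinear_mod ::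
    "('r::comm_ring_1 \<Rightarrow> 'b::ab_group_add \<Rightarrow> 'b) \<Rightarrow> ('r, 'm) graded_module \<Rightarrow> 'b set \<Rightarrow>
     ((int \<times> 'm) list \<Rightarrow> 'b) \<Rightarrow> bool" where
  "multilinear_mod scale M S F \<longleftrightarrow>
     (\<forall>u\<in>words M. \<forall>v\<in>words M. \<forall>i. \<forall>x\<in>component M i.
        (\<forall>y\<in>component M i. F (u @ (i, gadd M x y) # v) - F (u @ (i, x) # v) - F (u @ (i, y) # v) \<in> S) \<and>
        (\<forall>r. F (u @ (i, gscale M r x) # v) - scale r (F (u @ (i, x) # v)) \<in> S))"

lemma multilinear_modI:
  assumes "\<And>u v i x y. u \<in> words M \<Longrightarrow> v \<in> words M \<Longrightarrow> x \<in> component M i \<Longrightarrow> y \<in> component M i \<Longrightarrow>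
      F (u @ (i, gadd M x y) # v) - F (u @ (i, x) # v) - F (u @ (i, y) # v) \<in> S"
    "\<And>u v i x r. u \<in> words M \<Longrightarrow> v \<in> words M \<Longrightarrow> x \<in> component M i \<Longrightarrow>
      F (u @ (i, gscale M r x) # v) - scale r (F (u @ (i, x) # v)) \<in> S"
  shows "multilinear_mod scale M S F"
  using assms by (auto simp: multilinear_mod_def)

lemma multilinear_mod_add:
  "multilinear_mod scale M S F \<Longrightarrow> u \<in> words M \<Longrightarrow> v \<in> words M \<Longrightarrow> x \<in> component M i \<Longrightarrow>
    y \<in> component M i \<Longrightarrow>
    F (u @ (i, gadd M x y) # v) - F (u @ (i, x) # v) - F (u @ (i, y) # v) \<in> S"
  by (auto simp: multilinear_mod_def)

lemma multilinear_mod_scale: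
  "multilinear_mod scale M S F \<Longrightarrow> u \<in> words M \<Longrightarrow> v \<in> words M \<Longrightarrow> x \<in> component M i \<Longrightarrow>
    F (u @ (i, gscale M r x) # v) - scale r (F (u @ (i, x) # v)) \<in> S"
  by (auto simp: multilinear_mod_def)

lemma word_relations_subspace [simp]: "free.subspace (word_relations M)"
  by (simp add: word_relations_def)

lemma tensor_relations_subspace [simp]: "free.subspace (tensor_relations M N)"
  by (simp add: tensor_relations_def)

lemma gen_multilinear: "multilinear_mod free_scale M (word_relations M) gen"
  unfolding word_relations_def
  apply (rule multilinear_modI)
   apply (rule free.span_base, rule UnI1, blast)
  apply (rule free.span_base, rule UnI2, blast)
  done

text \<open>Universal property of the tensor powers: the extension sends each spanning relation into
  \<open>S\<close>.\<close>

lemma (in module) linear_extension_word_relations: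
  assumes "multilinear_mod scale M S F" "subspace S" "p \<in> word_relations M"
  shows "linear_extension scale F p \<in> S"
proof -
  interpret hom: module_hom free_scale scale "linear_extension scale F"
    by (rule linear_extension_module_hom)
  show ?thesis
    apply (rule module_hom_span_subset[OF hom.module_hom_axioms assms(2) _ assms(3)[unfolded word_relations_def]])
    apply (auto simp: hom.diff hom.scale)
    using assms(1) by (auto intro: multilinear_mod_add multilinear_mod_scale)
qed

context module
begin

text \<open>In every cut the varied letter lies in exactly one half, and linearity in that half
  applies. Changing the letter keeps the length, so the cuts of the words involved correspond to
  each other.\<close>

lemma multilinear_mod_split:
  assumes S: "subspace S"
    and 1: "\<And>v. v \<in> words M \<Longrightarrow> multilinear_mod scale M S (\<lambda>u. F u v)"
    and 2: "\<And>u. u \<in> words M \<Longrightarrow> multilinear_mod scale M S (F u)"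
  shows "multilinear_mod scale M S (\<lambda>w. \<Sum>l\<le>length w. F (take l w) (drop l w))"
proof (rule multilinear_modI)
  fix u v i x y assume uv: "u \<in> words M" "v \<in> words M" and x: "x \<in> component M i" and y: "y \<in> component M i"
  let ?G = "\<lambda>a l. F (take l (u @ (i, a) # v)) (drop l (u @ (i, a) # v))"
  have "?G (gadd M x y) l - ?G x l - ?G y l \<in> S" for l
  proof (cases "l \<le> length u")
    case True
    then have *: "take l (u @ (i, a) # v) = take l u" "drop l (u @ (i, a) # v) = drop l u @ (i, a) # v" for a
      by simp_all
    show ?thesis unfolding * by (rule multilinear_mod_add[OF 2]) (use uv x y in simp_all)
  next
    case False
    \<comment> \<open>The cut lies behind the varied letter, and \<open>n\<close> is its position
      within \<open>v\<close>.\<close>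
    then obtain n where "l = length u + Suc n" using less_imp_Suc_add[of "length u" l] by auto
    then have *: "take l (u @ (i, a) # v) = u @ (i, a) # take n v" "drop l (u @ (i, a) # v) = drop n v" for a
      by simp_all
    show ?thesis unfolding * by (rule multilinear_mod_add[OF 1]) (use uv x y in simp_all)
  qed
  then show "(\<Sum>l\<le>length (u @ (i, gadd M x y) # v). ?G (gadd M x y) l)
    - (\<Sum>l\<le>length (u @ (i, x) # v). ?G x l) - (\<Sum>l\<le>length (u @ (i, y) # v). ?G y l) \<in> S"
    unfolding length_append list.size sum_subtractf[symmetric] by (intro subspace_sum[OF S])
next
  fix u v i x r assume uv: "u \<in> words M" "v \<in> words M" and x: "x \<in> component M i"
  let ?G = "\<lambda>a l. F (take l (u @ (i, a) # v)) (drop l (u @ (i, a) # v))"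
  have "?G (gscale M r x) l - scale r (?G x l) \<in> S" for l
  proof (cases "l \<le> length u")
    case True
    then have *: "take l (u @ (i, a) # v) = take l u" "drop l (u @ (i, a) # v) = drop l u @ (i, a) # v" for a
      by simp_all
    show ?thesis unfolding * by (rule multilinear_mod_scale[OF 2]) (use uv x in simp_all)
  next
    case False
    then obtain n where "l = length u + Suc n" using less_imp_Suc_add[of "length u" l] by auto
    then have *: "take l (u @ (i, a) # v) = u @ (i, a) # take n v" "drop l (u @ (i, a) # v) = drop n v" for a
      by simp_all
    show ?thesis unfolding * by (rule multilinear_mod_scale[OF 1]) (use uv x in simp_all)
  qed
  then show "(\<Sum>l\<le>length (u @ (i, gscale M r x) # v). ?G (gscale M r x) l)
    - scale r (\<Sum>l\<le>length (u @ (i, x) # v). ?G x l) \<in> S"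
    unfolding length_append list.size scale_sum_right sum_subtractf[symmetric]
    by (intro subspace_sum[OF S])
qed

lemma sgn_pow_subspace: "subspace S \<Longrightarrow> x \<in> S \<Longrightarrow> sgn_pow n x \<in> S"
  by (simp add: sgn_pow_def subspace_neg)

end

context rational_module
begin

text \<open>After the permutation the varied letter stands at one place, in surroundings independent
  of it, and the sign does not see it; linearity of \<open>F\<close> at the new place
  applies.\<close>

lemma multilinear_signed_term:
  assumes S: "subspace S" and F: "multilinear_mod scale M S F"
    and uv: "u \<in> words M" "v \<in> words M" and x: "x \<in> component M i"
    and s: "\<sigma> permutes {..<length u + Suc (length v)}"
  shows "y \<in> component M i \<Longrightarrow> signed_term F (u @ (i, gadd M x y) # v) \<sigma>
      - signed_term F (u @ (i, x) # v) \<sigma> - signed_term F (u @ (i, y) # v) \<sigma> \<in> S"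
    and "signed_term F (u @ (i, gscale M r x) # v) \<sigma> - scale r (signed_term F (u @ (i, x) # v) \<sigma>) \<in> S"
proof -
  obtain u' v' where p: "\<And>a. permute_list \<sigma> (u @ a # v) = u' @ a # v'"
    and m: "\<And>a. mset (u' @ a # v') = mset (u @ a # v)"
    using permute_list_insert[OF s] by metis
  have uv': "u' \<in> words M" "v' \<in> words M"
    using words_mset[OF m[of "(i,x)"], of M] uv x by auto
  have K: "koszul_exponent \<sigma> (u @ (i, a) # v) = koszul_exponent \<sigma> (u @ (i, x) # v)" for a
    by (rule koszul_exponent_map_fst) (use s in auto)
  show "signed_term F (u @ (i, gadd M x y) # v) \<sigma>
      - signed_term F (u @ (i, x) # v) \<sigma> - signed_term F (u @ (i, y) # v) \<sigma> \<in> S"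
    if "y \<in> component M i"
    unfolding signed_term_def p K[of "gadd M x _"] K[of y] sgn_pow_minus[symmetric]
    by (intro sgn_pow_subspace S multilinear_mod_add[OF F] uv' x that)
  show "signed_term F (u @ (i, gscale M r x) # v) \<sigma> - scale r (signed_term F (u @ (i, x) # v) \<sigma>) \<in> S"
    unfolding signed_term_def p K[of "gscale M r x"] scale_sgn_pow sgn_pow_minus[symmetric]
    by (intro sgn_pow_subspace S multilinear_mod_scale[OF F] uv' x)
qed

lemma multilinear_average:
  assumes S: "subspace S" and F: "multilinear_mod scale M S F"
  shows "multilinear_mod scale M S (average F)"
  apply (rule multilinear_modI)
  subgoal for u v i x y
    unfolding average_def length_append list.size scale_right_diff_distrib[symmetric] sum_subtractf[symmetric]
    using multilinear_signed_term(1)[OF S F, of u v x i _ y]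
    by (intro subspace_scale[OF S] subspace_sum[OF S]) auto
  subgoal for u v i x r
    unfolding average_def length_append list.size scale_left_commute[of r] scale_sum_right[of r]
      scale_right_diff_distrib[symmetric] sum_subtractf[symmetric]
    using multilinear_signed_term(2)[OF S F, of u v x i _ r]
    by (intro subspace_scale[OF S] subspace_sum[OF S]) auto
  done

end

lemma tensor_relations_base:
  shows "x \<in> component M i \<Longrightarrow> x' \<in> component M i \<Longrightarrow> y \<in> component N j \<Longrightarrow>
      gen ((i, gadd M x x'), (j, y)) - gen ((i, x), (j, y)) - gen ((i, x'), (j, y)) \<in> tensor_relations M N"
    and "x \<in> component M i \<Longrightarrow> y \<in> component N j \<Longrightarrow> y' \<in> component N j \<Longrightarrow>
      gen ((i, x), (j, gadd N y y')) - gen ((i, x), (j, y)) - gen ((i, x), (j, y')) \<in> tensor_relations M N"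
    and "x \<in> component M i \<Longrightarrow> y \<in> component N j \<Longrightarrow>
      gen ((i, gscale M r x), (j, y)) - free_scale r (gen ((i, x), (j, y))) \<in> tensor_relations M N"
    and "x \<in> component M i \<Longrightarrow> y \<in> component N j \<Longrightarrow>
      gen ((i, x), (j, gscale N r y)) - free_scale r (gen ((i, x), (j, y))) \<in> tensor_relations M N"
  unfolding tensor_relations_def
  apply (rule free.span_base, rule UnI1, rule UnI1, rule UnI1, blast)
  apply (rule free.span_base, rule UnI1, rule UnI1, rule UnI2, blast)
  apply (rule free.span_base, rule UnI1, rule UnI2, blast)
  apply (rule free.span_base, rule UnI2, blast)
  done

lemma (in module) linear_extension_tensor_relations:
  assumes S: "subspace S" and p: "p \<in> tensor_relations M N"
    and "\<And>i j x x' y. x \<in> component M i \<Longrightarrow> x' \<in> component M i \<Longrightarrow> y \<in> component N j \<Longrightarrow>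
      f ((i, gadd M x x'), (j, y)) - f ((i, x), (j, y)) - f ((i, x'), (j, y)) \<in> S"
    and "\<And>i j x y y'. x \<in> component M i \<Longrightarrow> y \<in> component N j \<Longrightarrow> y' \<in> component N j \<Longrightarrow>
      f ((i, x), (j, gadd N y y')) - f ((i, x), (j, y)) - f ((i, x), (j, y')) \<in> S"
    and "\<And>i j x y r. x \<in> component M i \<Longrightarrow> y \<in> component N j \<Longrightarrow>
      f ((i, gscale M r x), (j, y)) - scale r (f ((i, x), (j, y))) \<in> S"
    and "\<And>i j x y r. x \<in> component M i \<Longrightarrow> y \<in> component N j \<Longrightarrow>
      f ((i, x), (j, gscale N r y)) - scale r (f ((i, x), (j, y))) \<in> S"
  shows "linear_extension scale f p \<in> S"
proof -
  interpret hom: module_hom free_scale scale "linear_extension scale f"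
    by (rule linear_extension_module_hom)
  show ?thesis
    apply (rule module_hom_span_subset[OF hom.module_hom_axioms S _ p[unfolded tensor_relations_def]])
    using assms(3-) by (auto simp: hom.diff hom.scale)
qed


section \<open>The symmetric coalgebra as a retract of the tensor coalgebra\<close>

locale symmetric_retract =
  fixes q :: "rat \<Rightarrow> 'r::comm_ring_1" and M :: "('r, 'm) graded_module"
  assumes q: "contains_rationals q"
begin

sublocale word: rational_module "free_scale :: 'r \<Rightarrow> ((int \<times> 'm) list \<Rightarrow>\<^sub>0 'r) \<Rightarrow> _" q
  by unfold_locales (rule q)

sublocale pair: rational_module "free_scale :: 'r \<Rightarrow>
    ((int \<times> ('r, 'm) tensors) \<times> (int \<times> ('r, 'm) tensors) \<Rightarrow>\<^sub>0 'r) \<Rightarrow> _" q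
  by unfold_locales (rule q)

abbreviation "rel \<equiv> word_relations M"
abbreviation "cls \<equiv> tensor_class M"
abbreviation "T \<equiv> tensor_coalgebra M"
abbreviation "S \<equiv> symmetric_coalgebra M"
abbreviation "relTT \<equiv> tensor_relations T T"
abbreviation "relSS \<equiv> tensor_relations S S"

text \<open>A coset of degree \<open>n\<close> has other representatives as well, since relations of
  all degrees are divided out together. These are the ones that permit arguments by degree.\<close>

definition homogeneous_reps :: "int \<Rightarrow> ((int \<times> 'm) list \<Rightarrow>\<^sub>0 'r) set" where
  "homogeneous_reps n = {p. Poly_Mapping.keys p \<subseteq> {w \<in> words M. word_degree w = n}}"

definition symmetrize :: "((int \<times> 'm) list \<Rightarrow>\<^sub>0 'r) \<Rightarrow> ((int \<times> 'm) list \<Rightarrow>\<^sub>0 'r)" where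
  "symmetrize = linear_extension free_scale (word.average gen)"

text \<open>The retraction of the tensor coalgebra onto the symmetric one: its values are symmetric,
  and symmetric classes are fixed.\<close>

definition symmetrize_class :: "('r, 'm) tensors \<Rightarrow> ('r, 'm) tensors" where
  "symmetrize_class = induced symmetrize rel"

lemma homogeneous_reps_subspace: "free.subspace (homogeneous_reps n)"
  unfolding homogeneous_reps_def by (rule keys_subspace)

lemma gen_homogeneous_reps: "w \<in> words M \<Longrightarrow> word_degree w = n \<Longrightarrow> gen w \<in> homogeneous_reps n"
  by (auto simp: homogeneous_reps_def)

lemma symmetrize_hom: "module_hom free_scale free_scale symmetrize"
  unfolding symmetrize_def by (rule free.linear_extension_module_hom)

sublocale symmetrize: module_hom free_scale free_scale symmetrize
  by (rule symmetrize_hom)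

lemma symmetrize_gen [simp]: "symmetrize (gen w) = word.average gen w"
  by (simp add: symmetrize_def)

lemma symmetrize_rel: "p \<in> rel \<Longrightarrow> symmetrize p \<in> rel"
  unfolding symmetrize_def
  by (rule free.linear_extension_word_relations[OF word.multilinear_average[OF _ gen_multilinear]]) simp_all

lemma symmetrize_class [simp]: "symmetrize_class (cls p) = cls (symmetrize p)"
  unfolding symmetrize_class_def
  by (rule induced_residue[OF symmetrize_hom]) (auto intro: symmetrize_rel)

lemma cls_eq_iff: "cls p = cls p' \<longleftrightarrow> p - p' \<in> rel"
  by (rule free.residue_eq_iff) simp

lemma component_T: "component T n = cls ` homogeneous_reps n"
  by (simp add: tensor_coalgebra_def homogeneous_reps_def quotient_family_def)

lemma gadd_T: "gadd T (cls a) (cls b) = cls (a + b)"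
  unfolding tensor_coalgebra_def by (rule free.quotient_gadd) simp

lemma gscale_T: "gscale T r (cls a) = cls (free_scale r a)"
  unfolding tensor_coalgebra_def by (rule free.quotient_gscale) simp

lemma gadd_S: "gadd S = gadd T"
  by (simp add: symmetric_coalgebra_def)

lemma gscale_S: "gscale S = gscale T"
  by (simp add: symmetric_coalgebra_def)

section \<open>Invariant tensors and the image of averaging\<close>

definition permute_reps :: "nat \<Rightarrow> (nat \<Rightarrow> nat) \<Rightarrow> ((int \<times> 'm) list \<Rightarrow>\<^sub>0 'r) \<Rightarrow> ((int \<times> 'm) list \<Rightarrow>\<^sub>0 'r)"
  where "permute_reps k \<sigma> = linear_extension free_scale
     (\<lambda>w. if length w = k then signed_term gen w \<sigma> else 0)"

lemma permute_reps_hom: "module_hom free_scale free_scale (permute_reps k \<sigma>)"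
  unfolding permute_reps_def by (rule free.linear_extension_module_hom)

text \<open>Changing a letter keeps the length, so the extension by zero to words of length other
  than \<open>k\<close> is compatible with the relations.\<close>

lemma permute_reps_multilinear:
  assumes "\<sigma> permutes {..<k}"
  shows "multilinear_mod free_scale M rel (\<lambda>w. if length w = k then signed_term gen w \<sigma> else 0)"
  apply (rule multilinear_modI)
  subgoal for u v i x y
    using word.multilinear_signed_term(1)[OF word_relations_subspace gen_multilinear, of u M v x i \<sigma> y] assms
    by (auto simp: free.subspace_0)
  subgoal for u v i x r
    using word.multilinear_signed_term(2)[OF word_relations_subspace gen_multilinear, of u M v x i \<sigma> r] assms
    by (auto simp: free.subspace_0)
  done

lemma permute_tensors_cls:
  assumes "\<sigma> permutes {..<k}"
  shows "permute_tensors M k \<sigma> (cls p) = cls (permute_reps k \<sigma> p)"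
proof -
  have "permute_tensors M k \<sigma> = induced (permute_reps k \<sigma>) rel"
    unfolding permute_tensors_def permute_reps_def signed_term_def ..
  moreover have "permute_reps k \<sigma> p \<in> rel" if "p \<in> rel" for p
    unfolding permute_reps_def
    by (rule free.linear_extension_word_relations[OF permute_reps_multilinear[OF assms] _ that]) simp
  ultimately show ?thesis by (simp add: induced_residue[OF permute_reps_hom])
qed

text \<open>Invariance under each \<sigma> is a congruence modulo relations, and the mean of these
  k! congruences is the claim. The representative is chosen with all words of length
  \<open>k\<close>, so that the factor 1/k! is common to them.\<close>

lemma symmetric_power_elim:
  assumes "c \<in> symmetric_power M k n"
  obtains p where "c = cls p" "Poly_Mapping.keys p \<subseteq> {w \<in> words M. length w = k \<and> word_degree w = n}"
    "symmetrize p - p \<in> rel"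
proof -
  obtain p where p: "c = cls p" "Poly_Mapping.keys p \<subseteq> {w \<in> words M. length w = k \<and> word_degree w = n}"
    and s: "\<And>\<sigma>. \<sigma> permutes {..<k} \<Longrightarrow> permute_tensors M k \<sigma> c = c"
    using assms by (auto simp: symmetric_power_def tensor_power_def)
  have "symmetrize p = linear_extension free_scale (\<lambda>w. free_scale (q (1 / of_nat (fact k)))
      (\<Sum>\<sigma> | \<sigma> permutes {..<k}. if length w = k then signed_term gen w \<sigma> else 0)) p"
    unfolding symmetrize_def using p(2)
    by (intro free.linear_extension_cong) (auto simp: word.average_def)
  also have "\<dots> = free_scale (q (1 / of_nat (fact k))) (\<Sum>\<sigma> | \<sigma> permutes {..<k}. permute_reps k \<sigma> p)"
    by (simp only: free.linear_extension_scale free.linear_extension_sum permute_reps_def)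
  \<comment> \<open>\<open>p\<close> is written as the mean of k! copies of itself, so that the
    difference can be formed under the sum.\<close>
  finally have "symmetrize p - p = free_scale (q (1 / of_nat (fact k))) (\<Sum>\<sigma> | \<sigma> permutes {..<k}. permute_reps k \<sigma> p)
     - free_scale (q (1 / of_nat (fact k))) (\<Sum>\<sigma> | \<sigma> permutes {..<k}. p)"
    by (simp only: word.average_const_sum)
  also have "\<dots> = free_scale (q (1 / of_nat (fact k))) (\<Sum>\<sigma> | \<sigma> permutes {..<k}. permute_reps k \<sigma> p - p)"
    by (simp only: free.scale_right_diff_distrib sum_subtractf)
  also have "\<dots> \<in> rel"
    using s p(1) by (intro free.subspace_scale free.subspace_sum word_relations_subspace)
      (simp add: permute_tensors_cls cls_eq_iff)
  finally show thesis using that p by blast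
qed

text \<open>The representatives in the definition of the coalgebra are arbitrary; weight by weight
  they are exchanged for homogeneous ones. Statements about a whole component of the coalgebra are
  reduced to this normal form.\<close>

lemma component_S_elim:
  assumes "c \<in> component S n"
  obtains p where "c = cls p" "p \<in> homogeneous_reps n" "symmetrize p - p \<in> rel"
proof -
  obtain K P where c: "c = cls (\<Sum>k<K. P k)" and P: "\<And>k. k < (K::nat) \<Longrightarrow> cls (P k) \<in> symmetric_power M k n"
    using assms by (auto simp: symmetric_coalgebra_def)
  have "\<exists>p. cls (P k) = cls p \<and> p \<in> homogeneous_reps n \<and> symmetrize p - p \<in> rel" if k: "k < K" for k
  proof -
    obtain p where "cls (P k) = cls p"
      "Poly_Mapping.keys p \<subseteq> {w \<in> words M. length w = k \<and> word_degree w = n}" "symmetrize p - p \<in> rel"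
      by (rule symmetric_power_elim[OF P[OF k]])
    then show ?thesis unfolding homogeneous_reps_def by blast
  qed
  then obtain p where p: "\<And>k. k < K \<Longrightarrow> cls (P k) = cls (p k)"
    "\<And>k. k < K \<Longrightarrow> p k \<in> homogeneous_reps n" "\<And>k. k < K \<Longrightarrow> symmetrize (p k) - p k \<in> rel"
    by metis
  show thesis
  proof (rule that[of "\<Sum>k<K. p k"])
    show "c = cls (\<Sum>k<K. p k)"
      using p(1) unfolding c cls_eq_iff sum_subtractf[symmetric]
      by (intro free.subspace_sum) auto
    show "(\<Sum>k<K. p k) \<in> homogeneous_reps n"
      using p(2) by (intro free.subspace_sum homogeneous_reps_subspace) auto
    show "symmetrize (\<Sum>k<K. p k) - (\<Sum>k<K. p k) \<in> rel"
      using p(3) unfolding symmetrize.sum sum_subtractf[symmetric] by (intro free.subspace_sum) auto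
  qed
qed

lemma component_S_subset: "component S n \<subseteq> component T n"
  by (auto simp: component_T elim!: component_S_elim)

text \<open>Sorting the words by length splits \<open>symmetrize p\<close> into weights. Each part
  is invariant already as a combination of words, before passing to classes, by
  \<open>average_permute\<close>.\<close>

lemma cls_symmetrize_in_S:
  assumes p: "p \<in> homogeneous_reps n"
  shows "cls (symmetrize p) \<in> component S n"
proof -
  obtain K where K: "\<And>w. w \<in> Poly_Mapping.keys p \<Longrightarrow> length w < K"
    using finite_nat_set_iff_bounded[of "length ` Poly_Mapping.keys p"] by auto
  define P where "P k = linear_extension free_scale (\<lambda>w. if length w = k then word.average gen w else 0) p" for k
  have "symmetrize p = (\<Sum>k<K. P k)"
    unfolding symmetrize_def P_def free.linear_extension_sum[symmetric]
    by (rule free.linear_extension_cong) (use K in auto)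
  moreover have "cls (P k) \<in> symmetric_power M k n" for k
  proof -
    have "P k \<in> {p. Poly_Mapping.keys p \<subseteq> {w \<in> words M. length w = k \<and> word_degree w = n}}" (is "_ \<in> ?A")
      unfolding P_def
    proof (rule free.linear_extension_subspace[OF keys_subspace])
      fix w assume "w \<in> Poly_Mapping.keys p"
      then have w: "w \<in> words M" "word_degree w = n" using p by (auto simp: homogeneous_reps_def)
      show "(if length w = k then word.average gen w else 0) \<in> ?A"
      proof (cases "length w = k")
        case True
        have "gen w' \<in> ?A" if "mset w' = mset w" for w'
          using words_mset[OF that, of M] word_degree_mset[OF that] mset_eq_length[OF that] w True by simp
        then have "word.average gen w \<in> ?A"
          by (rule word.average_subspace[OF keys_subspace])
        then show ?thesis using True by simp
      qed (simp add: free.subspace_0[OF keys_subspace])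
    qed
    moreover have "permute_reps k \<sigma> (P k) = P k" if s: "\<sigma> permutes {..<k}" for \<sigma>
    proof -
      interpret pr: module_hom free_scale free_scale "permute_reps k \<sigma>" by (rule permute_reps_hom)
      have 1: "permute_reps k \<sigma> (word.average gen w) = word.average gen w" if "length w = k" for w
      proof -
        have "permute_reps k \<sigma> (word.average gen w) = word.average (\<lambda>w. permute_reps k \<sigma> (gen w)) w"
          by (rule word.average_hom[OF word.rational_module_axioms permute_reps_hom])
        also have "\<dots> = word.average (\<lambda>w. sgn_pow (koszul_exponent \<sigma> w) (gen (permute_list \<sigma> w))) w"
          using that by (intro word.average_cong)
            (auto simp: permute_reps_def signed_term_def dest: mset_eq_length)
        also have "\<dots> = word.average gen w"
          by (rule word.average_permute) (use s that in simp)
        finally show ?thesis .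
      qed
      show ?thesis
        unfolding P_def module_hom_linear_extension[OF permute_reps_hom]
        by (rule free.linear_extension_cong) (auto simp: 1)
    qed
    ultimately show ?thesis
      by (auto simp: symmetric_power_def tensor_power_def permute_tensors_cls)
  qed
  ultimately show ?thesis by (auto simp: symmetric_coalgebra_def)
qed

lemma symmetrize_class_T: "x \<in> component T n \<Longrightarrow> symmetrize_class x \<in> component S n"
  by (auto simp: component_T cls_symmetrize_in_S)

lemma symmetrize_class_S: "x \<in> component S n \<Longrightarrow> symmetrize_class x = x"
  by (elim component_S_elim) (simp only: symmetrize_class cls_eq_iff)

lemma symmetrize_class_gadd: "x \<in> component T n \<Longrightarrow> y \<in> component T n \<Longrightarrow>
    symmetrize_class (gadd T x y) = gadd S (symmetrize_class x) (symmetrize_class y)"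
  by (auto simp: component_T gadd_T gadd_S symmetrize.add)

lemma symmetrize_class_gscale: "x \<in> component T n \<Longrightarrow>
    symmetrize_class (gscale T r x) = gscale S r (symmetrize_class x)"
  by (auto simp: component_T gscale_T gscale_S symmetrize.scale)

section \<open>The diagonal of the symmetric coalgebra\<close>

definition symmetrize_pairs ::
  "((int \<times> ('r, 'm) tensors) \<times> (int \<times> ('r, 'm) tensors) \<Rightarrow>\<^sub>0 'r) \<Rightarrow>
     ((int \<times> ('r, 'm) tensors) \<times> (int \<times> ('r, 'm) tensors) \<Rightarrow>\<^sub>0 'r)" where
  "symmetrize_pairs = linear_extension free_scale
     (\<lambda>((i, x), (j, y)). gen ((i, symmetrize_class x), (j, symmetrize_class y)))"

lemma symmetrize_pairs_hom: "module_hom free_scale free_scale symmetrize_pairs"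
  unfolding symmetrize_pairs_def by (rule free.linear_extension_module_hom)

sublocale symmetrize_pairs: module_hom free_scale free_scale symmetrize_pairs
  by (rule symmetrize_pairs_hom)

lemma symmetrize_pairs_gen [simp]: "symmetrize_pairs (gen ((i, x), (j, y))) =
    gen ((i, symmetrize_class x), (j, symmetrize_class y))"
  by (simp add: symmetrize_pairs_def)

lemma symmetrize_pairs_relTT: "p \<in> relTT \<Longrightarrow> symmetrize_pairs p \<in> relSS"
  unfolding symmetrize_pairs_def
  by (rule free.linear_extension_tensor_relations[of _ _ T T])
    (auto simp: symmetrize_class_gadd symmetrize_class_gscale symmetrize_class_T
      intro: tensor_relations_base)

lemma relSS_subset_relTT: "relSS \<subseteq> relTT"
  unfolding tensor_relations_def[of S S] gadd_S gscale_S
  by (rule free.span_minimal) (use component_S_subset in \<open>auto intro!: tensor_relations_base\<close>)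

text \<open>Injectivity of the map from \<open>S \<otimes> S\<close> to
  \<open>T \<otimes> T\<close>: the tensor square of the retraction fixes generators built from
  symmetric classes and sends relations over \<open>T\<close> to relations over \<open>S\<close>.
  This yields uniqueness of the diagonal.\<close>

lemma residue_relTT_eqD:
  assumes "\<forall>((i, x), (j, y)) \<in> Poly_Mapping.keys p. x \<in> component S i \<and> y \<in> component S j"
    and "\<forall>((i, x), (j, y)) \<in> Poly_Mapping.keys p'. x \<in> component S i \<and> y \<in> component S j"
    and "residue relTT p = residue relTT p'"
  shows "residue relSS p = residue relSS p'"
proof -
  have *: "symmetrize_pairs p = p"
    if "\<forall>((i, x), (j, y)) \<in> Poly_Mapping.keys p. x \<in> component S i \<and> y \<in> component S j" for p
  proof -
    have "symmetrize_pairs p = linear_extension free_scale gen p"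
      unfolding symmetrize_pairs_def using that
      by (intro free.linear_extension_cong) (auto simp: symmetrize_class_S)
    then show ?thesis by (simp add: linear_extension_gen_id)
  qed
  have "symmetrize_pairs (p - p') \<in> relSS"
    using assms(3) by (intro symmetrize_pairs_relTT) (simp add: free.residue_eq_iff)
  then show ?thesis using *[OF assms(1)] *[OF assms(2)]
    by (simp add: symmetrize_pairs.diff free.residue_eq_iff)
qed

definition splitting :: "(int \<times> 'm) list \<Rightarrow> (int \<times> 'm) list \<Rightarrow>
    ((int \<times> ('r, 'm) tensors) \<times> (int \<times> ('r, 'm) tensors) \<Rightarrow>\<^sub>0 'r)" where
  "splitting u v = gen ((word_degree u, cls (gen u)), (word_degree v, cls (gen v)))"

definition cut :: "((int \<times> 'm) list \<Rightarrow>\<^sub>0 'r) \<Rightarrow>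
    ((int \<times> ('r, 'm) tensors) \<times> (int \<times> ('r, 'm) tensors) \<Rightarrow>\<^sub>0 'r)" where
  "cut = linear_extension free_scale (\<lambda>w. \<Sum>l\<le>length w. splitting (take l w) (drop l w))"

lemma cut_hom: "module_hom free_scale free_scale cut"
  unfolding cut_def by (rule free.linear_extension_module_hom)

sublocale cut: module_hom free_scale free_scale cut
  by (rule cut_hom)

lemma cls_gen_in_T: "w \<in> words M \<Longrightarrow> word_degree w = n \<Longrightarrow> cls (gen w) \<in> component T n"
  by (auto simp: component_T intro: gen_homogeneous_reps)

lemma cls_gen_gadd:
  assumes "u \<in> words M" "v \<in> words M" "x \<in> component M i" "y \<in> component M i"
  shows "cls (gen (u @ (i, gadd M x y) # v)) = gadd T (cls (gen (u @ (i, x) # v))) (cls (gen (u @ (i, y) # v)))"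
  using multilinear_mod_add[OF gen_multilinear assms] by (simp add: gadd_T cls_eq_iff diff_diff_eq)

lemma cls_gen_gscale:
  assumes "u \<in> words M" "v \<in> words M" "x \<in> component M i"
  shows "cls (gen (u @ (i, gscale M r x) # v)) = gscale T r (cls (gen (u @ (i, x) # v)))"
  using multilinear_mod_scale[OF gen_multilinear assms] by (simp add: gscale_T cls_eq_iff)

lemma splitting_multilinear1:
  assumes "v \<in> words M" shows "multilinear_mod free_scale M relTT (\<lambda>u. splitting u v)"
  using assms unfolding splitting_def
  by (intro multilinear_modI)
    (auto simp: cls_gen_gadd cls_gen_gscale intro!: tensor_relations_base cls_gen_in_T)

lemma splitting_multilinear2:
  assumes "u \<in> words M" shows "multilinear_mod free_scale M relTT (splitting u)"
  using assms unfolding splitting_def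
  by (intro multilinear_modI)
    (auto simp: cls_gen_gadd cls_gen_gscale intro!: tensor_relations_base cls_gen_in_T)

lemma cut_rel: "p \<in> rel \<Longrightarrow> cut p \<in> relTT"
  unfolding cut_def
  by (rule free.linear_extension_word_relations[OF
        free.multilinear_mod_split[OF _ splitting_multilinear1 splitting_multilinear2]]) simp_all

lemma deconcatenation_cls: "deconcatenation M (cls p) = residue relTT (cut p)"
proof -
  have "deconcatenation M = induced cut relTT"
    by (simp add: deconcatenation_def cut_def splitting_def)
  then show ?thesis by (simp add: induced_residue[OF cut_hom] cut_rel)
qed

text \<open>A symbol \<open>gen ((i, x), (j, y))\<close> is linear in the class \<open>x\<close>
  only modulo the tensor relations. The representatives for which the expansion is valid form a
  submodule, which contains the words of degree \<open>i\<close>.\<close>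

lemma expand_on_generators:
  assumes V: "module.subspace free_scale V"
    and f_add: "\<And>x y. x \<in> component T i \<Longrightarrow> y \<in> component T i \<Longrightarrow> f (gadd T x y) - f x - f y \<in> V"
    and f_scale: "\<And>r x. x \<in> component T i \<Longrightarrow> f (gscale T r x) - free_scale r (f x) \<in> V"
    and p: "p \<in> homogeneous_reps i"
  shows "f (cls p) - linear_extension free_scale (\<lambda>w. f (cls (gen w))) p \<in> V"
proof -
  let ?L = "linear_extension free_scale (\<lambda>w. f (cls (gen w)))"
  interpret lin: module_hom free_scale free_scale ?L
    by (rule free.linear_extension_module_hom)
  let ?P = "\<lambda>p. f (cls p) - ?L p"
  have add: "?P (a + b) \<in> V"
    if "a \<in> homogeneous_reps i" "b \<in> homogeneous_reps i" "?P a \<in> V" "?P b \<in> V" for a b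
  proof -
    have "f (cls (a + b)) - f (cls a) - f (cls b) + ?P a + ?P b \<in> V"
      using f_add[of "cls a" "cls b"] that
      by (intro free.subspace_add[OF V]) (simp_all add: component_T gadd_T)
    then show ?thesis by (simp add: lin.add algebra_simps)
  qed
  have scale: "?P (free_scale r a) \<in> V" if "a \<in> homogeneous_reps i" "?P a \<in> V" for r a
  proof -
    have "f (cls (free_scale r a)) - free_scale r (f (cls a)) + free_scale r (?P a) \<in> V"
      using f_scale[of "cls a" r] that
      by (intro free.subspace_add[OF V] free.subspace_scale[OF V]) (simp_all add: component_T gscale_T)
    then show ?thesis by (simp add: lin.scale free.scale_right_diff_distrib)
  qed
  \<comment> \<open>Nothing is prescribed for \<open>f\<close> at the zero class; its value is
    controlled by scaling with 0.\<close>
  have zero: "?P 0 \<in> V"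
    using f_scale[of "cls 0" 0] free.subspace_0[OF homogeneous_reps_subspace, of i]
    by (simp add: component_T gscale_T)
  have "linear_extension free_scale gen p \<in> {p \<in> homogeneous_reps i. ?P p \<in> V}"
  proof (rule free.linear_extension_subspace)
    show "free.subspace {p \<in> homogeneous_reps i. ?P p \<in> V}"
      using add scale zero homogeneous_reps_subspace[of i]
      by (auto simp: free.subspace_def)
    show "gen w \<in> {p \<in> homogeneous_reps i. ?P p \<in> V}" if "w \<in> Poly_Mapping.keys p" for w
      using p that by (auto simp: homogeneous_reps_def free.subspace_0[OF V])
  qed
  then show ?thesis by (simp add: linear_extension_gen_id)
qed

lemma tensor_expand_left:
  assumes "p \<in> homogeneous_reps i" "y \<in> component T j"
  shows "gen ((i, cls p), (j, y)) - linear_extension free_scale (\<lambda>w. gen ((i, cls (gen w)), (j, y))) p \<in> relTT"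
  by (rule expand_on_generators[where f = "\<lambda>x. gen ((i, x), (j, y))"])
    (use assms in \<open>auto intro: tensor_relations_base\<close>)

lemma tensor_expand_right:
  assumes "p \<in> homogeneous_reps j" "y \<in> component T i"
  shows "gen ((i, y), (j, cls p)) - linear_extension free_scale (\<lambda>w. gen ((i, y), (j, cls (gen w)))) p \<in> relTT"
  by (rule expand_on_generators[where f = "\<lambda>x. gen ((i, y), (j, x))"])
    (use assms in \<open>auto intro: tensor_relations_base\<close>)

lemma average_gen_homogeneous:
  assumes "w \<in> words M"
  shows "word.average gen w \<in> homogeneous_reps (word_degree w)"
proof (rule word.average_subspace[OF homogeneous_reps_subspace])
  fix w' assume "mset w' = mset w"
  from words_mset[OF this, of M] word_degree_mset[OF this] assms
  show "gen w' \<in> homogeneous_reps (word_degree w)"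
    by (intro gen_homogeneous_reps) auto
qed

lemma average_linear_extension:
  assumes "module_hom free_scale free_scale f"
  shows "f (word.average gen w) = pair.average (\<lambda>w. f (gen w)) w"
  by (rule word.average_hom[OF pair.rational_module_axioms assms])

text \<open>\<open>symmetrize_pairs\<close> puts averaged classes into both slots. They are expanded
  one slot at a time, the left one while the right still holds its averaged class.\<close>

lemma splitting_average:
  assumes u: "u \<in> words M" and v: "v \<in> words M"
  shows "symmetrize_pairs (splitting u v) - pair.average (\<lambda>u. pair.average (splitting u) v) u \<in> relTT"
proof -
  let ?y = "cls (word.average gen v)"
  have y: "?y \<in> component T (word_degree v)"
    using average_gen_homogeneous[OF v] by (simp add: component_T)
  have 1: "symmetrize_pairs (splitting u v)
      - pair.average (\<lambda>u'. gen ((word_degree u, cls (gen u')), (word_degree v, ?y))) u \<in> relTT"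
    using tensor_expand_left[OF average_gen_homogeneous[OF u] y]
    by (simp add: splitting_def average_linear_extension[OF free.linear_extension_module_hom])
  have 2: "gen ((word_degree u, cls (gen u')), (word_degree v, ?y)) - pair.average (splitting u') v \<in> relTT"
    if "mset u' = mset u" for u'
  proof -
    have u': "u' \<in> words M" "word_degree u' = word_degree u"
      using that u words_mset word_degree_mset by blast+
    have "gen ((word_degree u, cls (gen u')), (word_degree v, ?y))
      - pair.average (\<lambda>v'. gen ((word_degree u, cls (gen u')), (word_degree v, cls (gen v')))) v \<in> relTT"
      using tensor_expand_right[OF average_gen_homogeneous[OF v] cls_gen_in_T[OF u']]
      by (simp add: average_linear_extension[OF free.linear_extension_module_hom])
    moreover have "pair.average (\<lambda>v'. gen ((word_degree u, cls (gen u')), (word_degree v, cls (gen v')))) v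
      = pair.average (splitting u') v"
    proof (rule pair.average_cong)
      fix v' assume m: "mset v' = mset v"
      show "gen ((word_degree u, cls (gen u')), (word_degree v, cls (gen v'))) = splitting u' v'"
        by (simp only: splitting_def u' word_degree_mset[OF m])
    qed
    ultimately show ?thesis by simp
  qed
  have "pair.average (\<lambda>u'. gen ((word_degree u, cls (gen u')), (word_degree v, ?y))) u
    - pair.average (\<lambda>u. pair.average (splitting u) v) u \<in> relTT"
    unfolding pair.average_diff[symmetric] by (rule pair.average_subspace) (use 2 in auto)
  from free.subspace_add[OF _ 1 this] show ?thesis by simp
qed

text \<open>The number of cuts depends on the length only, so cutting commutes with averaging.
  Retracting both halves averages each of them, which the full average absorbs; hence the
  deconcatenation of a symmetrized word comes from \<open>S \<otimes> S\<close>.\<close>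

lemma symmetrize_pairs_cut_average:
  assumes w: "w \<in> words M"
  shows "symmetrize_pairs (cut (word.average gen w)) - cut (word.average gen w) \<in> relTT"
proof -
  have c: "cut (word.average gen w) = (\<Sum>l\<le>length w. pair.average (\<lambda>w. splitting (take l w) (drop l w)) w)"
    unfolding average_linear_extension[OF cut_hom] pair.average_sum[symmetric]
    by (rule pair.average_cong) (auto simp: cut_def dest: mset_eq_length)
  have "symmetrize_pairs (pair.average (\<lambda>w. splitting (take l w) (drop l w)) w)
     - pair.average (\<lambda>w. splitting (take l w) (drop l w)) w \<in> relTT" if "l \<le> length w" for l
  proof -
    have "symmetrize_pairs (pair.average (\<lambda>w. splitting (take l w) (drop l w)) w)
      - pair.average (\<lambda>w. pair.average (\<lambda>u. pair.average (splitting u) (drop l w)) (take l w)) w \<in> relTT"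
      unfolding pair.average_hom[OF pair.rational_module_axioms symmetrize_pairs_hom] pair.average_diff[symmetric]
      using words_mset[of _ w M] w
      by (intro pair.average_subspace tensor_relations_subspace splitting_average words_take words_drop) blast+
    moreover have "pair.average (\<lambda>w. pair.average (\<lambda>u. pair.average (splitting u) (drop l w)) (take l w)) w
      = pair.average (\<lambda>w. splitting (take l w) (drop l w)) w"
      using pair.average_take[OF that, of "\<lambda>u v. pair.average (splitting u) v"] pair.average_drop[OF that, of splitting]
      by simp
    ultimately show ?thesis by simp
  qed
  then show ?thesis
    unfolding c symmetrize_pairs.sum sum_subtractf[symmetric] by (intro free.subspace_sum) auto
qed

text \<open>A symmetric representative equals its symmetrization only modulo relations;
  \<open>cut\<close> and the squared retraction respect relations, so the error terms lie in
  \<open>relTT\<close>.\<close>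

lemma symmetrize_pairs_cut:
  assumes p: "p \<in> homogeneous_reps n" and s: "symmetrize p - p \<in> rel"
  shows "symmetrize_pairs (cut p) - cut p \<in> relTT"
proof -
  have 1: "symmetrize_pairs (cut (symmetrize p)) - cut (symmetrize p) \<in> relTT"
  proof -
    have "symmetrize_pairs (cut (symmetrize p)) - cut (symmetrize p) =
      linear_extension free_scale (\<lambda>w. symmetrize_pairs (cut (word.average gen w)) - cut (word.average gen w)) p"
      unfolding free.linear_extension_diff symmetrize_def
      by (simp only: module_hom_linear_extension[OF cut_hom] module_hom_linear_extension[OF symmetrize_pairs_hom])
    also have "\<dots> \<in> relTT"
      using p by (intro free.linear_extension_subspace symmetrize_pairs_cut_average)
        (auto simp: homogeneous_reps_def)
    finally show ?thesis .
  qed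
  have 2: "cut (symmetrize p - p) \<in> relTT" by (rule cut_rel[OF s])
  have 3: "symmetrize_pairs (cut (symmetrize p - p)) \<in> relTT"
    using symmetrize_pairs_relTT[OF 2] relSS_subset_relTT by blast
  have "symmetrize_pairs (cut p) - cut p = (symmetrize_pairs (cut (symmetrize p)) - cut (symmetrize p))
     - symmetrize_pairs (cut (symmetrize p - p)) + cut (symmetrize p - p)"
    by (simp add: cut.diff symmetrize_pairs.diff)
  also have "\<dots> \<in> relTT"
    by (intro free.subspace_add free.subspace_diff 1 2 3) simp_all
  finally show ?thesis .
qed

text \<open>The retracted cut has its entries in \<open>S\<close> and represents the
  deconcatenation, and injectivity excludes any other candidate. An explicit coset thus replaces the
  definite description.\<close>

lemma symmetric_diagonal_cls:
  assumes p: "p \<in> homogeneous_reps n" and s: "symmetrize p - p \<in> rel"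
  shows "symmetric_diagonal M (cls p) = residue relSS (symmetrize_pairs (cut p))"
proof -
  let ?reps = "\<lambda>n. {p. \<forall>((i, x), (j, y)) \<in> Poly_Mapping.keys p.
      x \<in> component S i \<and> y \<in> component S j \<and> i + j = n}"
  have comp: "component (tensor S S) n = residue relSS ` ?reps n" for n
    by (simp add: tensor_def quotient_family_def)
  have ind: "induced (\<lambda>p. p) relTT (residue relSS p) = residue relTT p" for p
    by (rule induced_residue[OF free.module_hom_ident]) (use relSS_subset_relTT in auto)
  \<comment> \<open>Written as a condition on supports, the set is visibly a submodule.\<close>
  have reps: "?reps n = {p. Poly_Mapping.keys p \<subseteq> {((i, x), (j, y)). x \<in> component S i \<and> y \<in> component S j \<and> i + j = n}}" for n
    by auto
  have "symmetrize_pairs (cut p) = linear_extension free_scale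
      (\<lambda>w. \<Sum>l\<le>length w. symmetrize_pairs (splitting (take l w) (drop l w))) p"
    unfolding cut_def by (simp only: module_hom_linear_extension[OF symmetrize_pairs_hom] symmetrize_pairs.sum)
  also have "\<dots> \<in> ?reps n"
    unfolding reps
  proof (intro free.linear_extension_subspace free.subspace_sum keys_subspace)
    fix w l assume "w \<in> Poly_Mapping.keys p"
    then have w: "w \<in> words M" "word_degree w = n" using p by (auto simp: homogeneous_reps_def)
    have "cls (word.average gen u) \<in> component S (word_degree u)" if "u \<in> words M" for u
      using cls_symmetrize_in_S[OF gen_homogeneous_reps[OF that refl]] by simp
    then show "symmetrize_pairs (splitting (take l w) (drop l w)) \<in>
      {p. Poly_Mapping.keys p \<subseteq> {((i, x), (j, y)). x \<in> component S i \<and> y \<in> component S j \<and> i + j = n}}"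
      using w word_degree_take_drop[of l w] by (simp add: splitting_def)
  qed
  finally have r: "symmetrize_pairs (cut p) \<in> ?reps n" .
  have e: "residue relTT (symmetrize_pairs (cut p)) = deconcatenation M (cls p)"
    using symmetrize_pairs_cut[OF p s] by (simp add: deconcatenation_cls free.residue_eq_iff)
  show ?thesis
    unfolding symmetric_diagonal_def
  proof (rule the_equality, intro conjI exI)
    show "residue relSS (symmetrize_pairs (cut p)) \<in> component (tensor S S) n"
      using r by (simp only: comp imageI)
    show "induced (\<lambda>p. p) relTT (residue relSS (symmetrize_pairs (cut p))) = deconcatenation M (cls p)"
      by (simp only: ind e)
  next
    fix z assume z: "(\<exists>n. z \<in> component (tensor S S) n) \<and> induced (\<lambda>p. p) relTT z = deconcatenation M (cls p)"
    then obtain m p' where p': "z = residue relSS p'" "p' \<in> ?reps m" unfolding comp by blast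
    have "residue relTT p' = residue relTT (symmetrize_pairs (cut p))" using z ind p'(1) e by simp
    then show "z = residue relSS (symmetrize_pairs (cut p))"
      unfolding p'(1) by (intro residue_relTT_eqD) (use p'(2) r in fast)+
  qed
qed

section \<open>Evaluation of cochains and cup brackets on representatives\<close>

definition eval_class :: "('r \<Rightarrow> 'b::ab_group_add \<Rightarrow> 'b) \<Rightarrow> ((int \<times> 'm) list \<Rightarrow> 'b) \<Rightarrow> ('r, 'm) tensors \<Rightarrow> 'b" where
  "eval_class scale F c = the_elem (linear_extension scale F ` c)"

lemma eval_class_cls:
  assumes "module scale" "multilinear_mod scale M {0} F"
  shows "eval_class scale F (cls p) = linear_extension scale F p"
proof -
  interpret m: module scale by fact
  interpret lin: module_hom free_scale scale "linear_extension scale F"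
    by (rule m.linear_extension_module_hom)
  have "linear_extension scale F p' = linear_extension scale F p" if "p' \<in> cls p" for p'
    using m.linear_extension_word_relations[OF assms(2), of "p' - p"] that
    by (simp add: free.mem_residue lin.diff m.subspace_0 m.subspace_single_0)
  then have "linear_extension scale F ` cls p = {linear_extension scale F p}"
    by (rule image_eq_singleton[OF free.self_mem_residue[OF word_relations_subspace]])
  then show ?thesis by (simp add: eval_class_def)
qed

text \<open>The bracket of values of \<open>F\<close> vanishes on the relations over
  \<open>T\<close>, so it may be evaluated on the plain deconcatenation \<open>cut p\<close> rather
  than on the diagonal, whose slots hold symmetrized classes.\<close>

lemma cup_bracket_cls:
  assumes "module scale" "multilinear_mod scale M {0} F"
    and p: "p \<in> homogeneous_reps n" and s: "symmetrize p - p \<in> rel"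
    and br: "\<And>x. module_hom scale scale (br x)" "\<And>y. module_hom scale scale (\<lambda>x. br x y)"
  shows "cup_bracket scale br M e (eval_class scale F) (eval_class scale F) (cls p) =
    linear_extension scale (\<lambda>w. \<Sum>l\<le>length w.
      sgn_pow (e * word_degree (take l w)) (br (F (take l w)) (F (drop l w)))) p"
proof -
  interpret m: module scale by fact
  let ?E = "eval_class scale F"
  let ?f = "\<lambda>((i, u), (j, v)). sgn_pow (e * i) (br (?E u) (?E v))"
  note E = eval_class_cls[OF assms(1,2)]
  interpret F: module_hom free_scale scale "linear_extension scale F"
    by (rule m.linear_extension_module_hom)
  interpret f: module_hom free_scale scale "linear_extension scale ?f"
    by (rule m.linear_extension_module_hom)
  have Eadd: "?E (gadd T x y) = ?E x + ?E y" if "x \<in> component T i" "y \<in> component T i" for x y i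
    using that by (auto simp: component_T gadd_T E F.add)
  have Escale: "?E (gscale T r x) = scale r (?E x)" if "x \<in> component T i" for x r i
    using that by (auto simp: component_T gscale_T E F.scale)
  note b = module_hom.add[OF br(1)] module_hom.add[OF br(2)] module_hom.scale[OF br(1)] module_hom.scale[OF br(2)]
  have f0: "linear_extension scale ?f x = 0" if "x \<in> relTT" for x
  proof -
    have "linear_extension scale ?f x \<in> {0}"
      by (rule m.linear_extension_tensor_relations[OF m.subspace_single_0 that])
        (auto simp: Eadd Escale b sgn_pow_add m.scale_sgn_pow)
    then show ?thesis by simp
  qed
  have fp: "linear_extension scale ?f (cut p) = linear_extension scale (\<lambda>w. \<Sum>l\<le>length w.
      sgn_pow (e * word_degree (take l w)) (br (F (take l w)) (F (drop l w)))) p"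
    unfolding cut_def module_hom_linear_extension[OF f.module_hom_axioms] f.sum
    by (simp add: splitting_def E)
  have "linear_extension scale ?f x = linear_extension scale ?f (cut p)"
    if "x \<in> symmetric_diagonal M (cls p)" for x
  proof -
    have "x - symmetrize_pairs (cut p) \<in> relTT"
      using that relSS_subset_relTT unfolding symmetric_diagonal_cls[OF p s] by (auto simp: free.mem_residue)
    from free.subspace_add[OF _ this symmetrize_pairs_cut[OF p s]] have "x - cut p \<in> relTT" by simp
    from f0[OF this] show ?thesis by (simp add: f.diff)
  qed
  moreover have "symmetrize_pairs (cut p) \<in> symmetric_diagonal M (cls p)"
    unfolding symmetric_diagonal_cls[OF p s] by (simp add: free.self_mem_residue)
  ultimately have "linear_extension scale ?f ` symmetric_diagonal M (cls p) = {linear_extension scale ?f (cut p)}"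
    by (intro image_eq_singleton)
  then show ?thesis unfolding cup_bracket_def by (simp add: fp)
qed

end

section \<open>Differential Batalin-Vilkovisky algebras\<close>

context differential_BV_algebra
begin

lemma Delta_hom: "module_hom scale scale \<Delta>"
  using Delta_degree by (simp add: linear_of_degree_def)

lemma d_hom: "module_hom scale scale d"
  using d_derivation by (simp add: derivation_of_degree_def linear_of_degree_def)

sublocale Delta: module_hom scale scale \<Delta>
  by (rule Delta_hom)

sublocale d: module_hom scale scale d
  by (rule d_hom)

lemma Delta_in: "x \<in> A n \<Longrightarrow> \<Delta> x \<in> A (n - 1)"
  using Delta_degree by (force simp: linear_of_degree_def)

lemma d_in: "x \<in> A n \<Longrightarrow> d x \<in> A (n + 1)"
  using d_derivation by (force simp: derivation_of_degree_def linear_of_degree_def)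

lemma d_mult: "x \<in> A m \<Longrightarrow> d (x * y) = d x * y + sgn_pow m (x * d y)" if "y \<in> A n"
  using d_derivation that by (auto simp: derivation_of_degree_def)

lemma bracket_hom_right: "module_hom scale scale (bracket x)"
  using bracket_Lie[unfolded graded_Lie_bracket_def, THEN conjunct1] by blast

lemma bracket_hom_left: "module_hom scale scale (\<lambda>x. bracket x y)"
  using bracket_Lie[unfolded graded_Lie_bracket_def, THEN conjunct2, THEN conjunct1] by blast

sublocale bracket_right: module_hom scale scale "bracket x"
  by (rule bracket_hom_right)

sublocale bracket_left: module_hom scale scale "\<lambda>x. bracket x y"
  by (rule bracket_hom_left)

lemma bracket_in:
  assumes "x \<in> A m" "y \<in> A n"
  shows "bracket x y \<in> A (m + n - 1)"
proof -
  have "\<forall>i j. \<forall>x \<in> A (i + 1). \<forall>y \<in> A (j + 1). bracket x y \<in> A (i + j + 1)"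
    using bracket_Lie[unfolded graded_Lie_bracket_def, THEN conjunct2, THEN conjunct2, THEN conjunct1] .
  from this[rule_format, of x "m - 1" y "n - 1"] assms show ?thesis by (simp add: algebra_simps)
qed

lemma bracket_antisymmetric:
  assumes "x \<in> A m" "y \<in> A n"
  shows "bracket x y = - sgn_pow ((m - 1) * (n - 1)) (bracket y x)"
proof -
  have "\<forall>i j. \<forall>x \<in> A (i + 1). \<forall>y \<in> A (j + 1). bracket x y = - sgn_pow (i * j) (bracket y x)"
    using bracket_Lie[unfolded graded_Lie_bracket_def, THEN conjunct2, THEN conjunct2, THEN conjunct2, THEN conjunct1] .
  from this[rule_format, of x "m - 1" y "n - 1"] assms show ?thesis by (simp only: diff_add_cancel)
qed

lemma bracket_Jacobi:
  assumes "x \<in> A l" "y \<in> A m" "z \<in> A n"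
  shows "bracket x (bracket y z) =
    bracket (bracket x y) z + sgn_pow ((l - 1) * (m - 1)) (bracket y (bracket x z))"
proof -
  have "\<forall>i j k. \<forall>x \<in> A (i + 1). \<forall>y \<in> A (j + 1). \<forall>z \<in> A (k + 1).
     bracket x (bracket y z) = bracket (bracket x y) z + sgn_pow (i * j) (bracket y (bracket x z))"
    using bracket_Lie[unfolded graded_Lie_bracket_def, THEN conjunct2, THEN conjunct2, THEN conjunct2, THEN conjunct2] .
  from this[rule_format, of x "l - 1" y "m - 1" z "n - 1"] assms show ?thesis by (simp only: diff_add_cancel)
qed

text \<open>Antisymmetry converts the derivation form of the Jacobi identity into the cyclic one,
  which matches the rotation of three blocks of a word.\<close>

lemma bracket_Jacobi_cyclic:
  assumes "x \<in> A l" "y \<in> A m" "z \<in> A n"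
  shows "sgn_pow ((l - 1) * (n - 1)) (bracket (bracket x y) z)
    + sgn_pow ((m - 1) * (l - 1)) (bracket (bracket y z) x)
    + sgn_pow ((n - 1) * (m - 1)) (bracket (bracket z x) y) = 0"
proof -
  have 1: "bracket x (bracket y z) = - sgn_pow ((l - 1) * (m + n - 2)) (bracket (bracket y z) x)"
    using bracket_antisymmetric[OF assms(1) bracket_in[OF assms(2,3)]] by (simp add: algebra_simps)
  have 2: "bracket y (bracket x z) = - sgn_pow ((m - 1) * (l + n - 2)) (bracket (bracket x z) y)"
    using bracket_antisymmetric[OF assms(2) bracket_in[OF assms(1,3)]] by (simp add: algebra_simps)
  have 3: "bracket x z = - sgn_pow ((l - 1) * (n - 1)) (bracket z x)"
    by (rule bracket_antisymmetric[OF assms(1,3)])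
  have 4: "bracket (bracket x z) y = - sgn_pow ((l - 1) * (n - 1)) (bracket (bracket z x) y)"
    by (subst 3) (simp add: bracket_left.neg bracket_left.hom_sgn_pow)
  have 5: "a + (b + c) = 0" if "- b = a + c" for a b c :: 'a
    using that by (metis add.left_commute add.right_inverse)
  show ?thesis
    using bracket_Jacobi[OF assms] unfolding 1 2[unfolded 4]
    by (cases "even l"; cases "even m"; cases "even n")
      (simp_all add: sgn_pow_def bracket_left.neg bracket_right.neg algebra_simps, (erule 5)+)
qed

text \<open>The bracket is an expression in the product and \<Delta>. As \<open>d\<close> is a
  derivation of the product and anticommutes with \<Delta>, expanding all three brackets leaves the
  same terms on both sides.\<close>

lemma d_bracket:
  assumes x: "x \<in> A m" and y: "y \<in> A n"
  shows "d (bracket x y) = bracket (d x) y + sgn_pow (m - 1) (bracket x (d y))"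
proof -
  have dD: "d (\<Delta> z) = - \<Delta> (d z)" for z
    using d_Delta[of z] by (simp add: eq_neg_iff_add_eq_0)
  note E = Delta_generates[OF x y] Delta_generates[OF d_in[OF x] y] Delta_generates[OF x d_in[OF y]]
    d_mult[OF y x] d_mult[OF y Delta_in[OF x]] d_mult[OF Delta_in[OF y] x]
  show ?thesis
    unfolding E
    by (cases "even m")
      (simp_all add: sgn_pow_def E d.diff d.add d.neg Delta.add Delta.diff Delta.neg dD algebra_simps)
qed

lemma bracket_ker_Delta:
  assumes "x \<in> A m" "y \<in> A n" "\<Delta> x = 0" "\<Delta> y = 0"
  shows "bracket x y \<in> range \<Delta>"
proof -
  have "bracket x y = \<Delta> (sgn_pow m (x * y))"
    using Delta_generates[OF assms(1,2)] assms(3,4) by (simp add: Delta.hom_sgn_pow)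
  then show ?thesis by simp
qed

section \<open>The homology of the Lie algebra\<close>

text \<open>Boundaries are images of arbitrary elements, whereas the rules for \<open>d\<close> and
  the bracket are stated for homogeneous ones; the direct sum decomposition bridges the gap.\<close>

lemma homogeneous_induct [case_names zero add homogeneous]:
  assumes "P 0" "\<And>x y. P x \<Longrightarrow> P y \<Longrightarrow> P (x + y)" "\<And>n x. x \<in> A n \<Longrightarrow> P x"
  shows "P x"
proof -
  obtain c where c: "\<forall>n. c n \<in> A n" "x = (\<Sum>n | c n \<noteq> 0. c n)"
    using direct_sum[of x] by auto
  have "P (c n)" for n using assms(3) c(1) by blast
  then have "P (\<Sum>n\<in>I. c n)" for I
    by (induction I rule: infinite_finite_induct) (auto intro: assms(1,2))
  then show ?thesis using c by simp
qed

lemma subspace_range_Delta: "subspace (range \<Delta>)"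
  using Delta.subspace_image[OF subspace_UNIV] by simp

lemma subspace_range_d: "subspace (range d)"
  using d.subspace_image[OF subspace_UNIV] by simp

lemma bracket_boundary_left:
  assumes y: "y \<in> A n" "d y = 0"
  shows "bracket (d a) y \<in> range d"
proof (induction a rule: homogeneous_induct)
  case zero
  then show ?case using subspace_0[OF subspace_range_d] by simp
next
  case (add x y)
  then show ?case by (simp add: d.add bracket_left.add subspace_add[OF subspace_range_d])
next
  case (homogeneous m x)
  then show ?case using d_bracket[OF homogeneous y(1)] y(2) by simp (metis rangeI)
qed

lemma bracket_boundary_right:
  assumes x: "x \<in> A m" "d x = 0"
  shows "bracket x (d b) \<in> range d"
proof (induction b rule: homogeneous_induct)
  case zero
  then show ?case using subspace_0[OF subspace_range_d] by simp
next
  case (add x y)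
  then show ?case by (simp add: d.add bracket_right.add subspace_add[OF subspace_range_d])
next
  case (homogeneous n y)
  have "bracket x (d y) = d (sgn_pow (m - 1) (bracket x y))"
    using d_bracket[OF x(1) homogeneous] x(2) by (simp add: d.hom_sgn_pow) (simp add: sgn_pow_def)
  then show ?case by simp
qed

text \<open>For homogeneous \<open>y\<close> the element \<open>d y\<close> is a homogeneous cycle,
  so the mixed case applies while \<open>a\<close> stays arbitrary.\<close>

lemma bracket_boundaries: "bracket (d a) (d b) \<in> range d"
proof (induction b rule: homogeneous_induct)
  case zero
  then show ?case using subspace_0[OF subspace_range_d] by simp
next
  case (add x y)
  then show ?case by (simp add: d.add bracket_right.add subspace_add[OF subspace_range_d])
next
  case (homogeneous n y)
  then show ?case using bracket_boundary_left[OF d_in] d_squared by blast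
qed

text \<open>Surjectivity of the inclusion on homology gives every class a representative in ker
  \<Delta>. The bracket of two such representatives is a cycle in im \<Delta>, so the projection
  kills it, and injectivity of the projection on homology makes it a boundary.\<close>

lemma homology_abelian:
  assumes formal: "kaehlerian_formality scale A \<Delta> d"
  shows "abelian_bracket (homology scale (regrade A) UNIV d) (homology_bracket bracket (range d))"
proof -
  let ?K = "d ` ker \<Delta>"
  have K: "subspace (ker \<Delta>)"
    unfolding ker_def by (rule Delta.subspace_kernel)
  have dK: "subspace ?K" by (rule d.subspace_image[OF K])
  have id: "module_hom scale scale (\<lambda>x. x)" by (rule module_hom_ident)
  have comp: "component (homology scale G X D) n = residue (D ` X) ` {x \<in> G n \<inter> X. D x = 0}" for G X D n
    by (simp add: homology_def quotient_family_def)
  have gz: "gzero (homology scale G X D) = D ` X" for G X D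
    by (simp add: homology_def quotient_family_def)
  \<comment> \<open>That the projection is a chain map to a zero differential means that
    \<open>d\<close> sends ker \<Delta> into im \<Delta>; this makes the induced map on homology
    well defined.\<close>
  have sub: "?K \<subseteq> range \<Delta>"
  proof
    fix z assume "z \<in> ?K"
    then obtain x where "x \<in> ker \<Delta>" "z = d x" by auto
    then have "residue (range \<Delta>) z = range \<Delta>"
      using formal by (auto simp: kaehlerian_formality_def gz)
    then show "z \<in> range \<Delta>" by (simp add: residue_eq_0_iff[OF subspace_range_Delta])
  qed
  have ind_d: "induced (\<lambda>x. x) (range d) (residue ?K x) = residue (range d) x" for x
    by (rule induced_residue[OF id dK subspace_range_d]) auto
  have ind_D: "induced (\<lambda>x. x) (range \<Delta>) (residue ?K x) = residue (range \<Delta>) x" for x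
    by (rule induced_residue[OF id dK subspace_range_Delta]) (use sub in auto)
  have rep: "\<exists>z \<in> A m. \<Delta> z = 0 \<and> d z = 0 \<and> X = residue (range d) z"
    if X: "X \<in> component (homology scale A UNIV d) m" for X m
  proof -
    have "induced (\<lambda>x. x) (range d) ` component (homology scale A (ker \<Delta>) d) m
        = component (homology scale A UNIV d) m"
      using formal by (auto simp: kaehlerian_formality_def bij_betw_def)
    then obtain Z where "Z \<in> component (homology scale A (ker \<Delta>) d) m"
      "X = induced (\<lambda>x. x) (range d) Z" using X by auto
    then obtain z where "z \<in> A m \<inter> ker \<Delta>" "d z = 0" "X = induced (\<lambda>x. x) (range d) (residue ?K z)"
      by (auto simp: comp)
    then show ?thesis unfolding ind_d by (auto simp: ker_def)
  qed
  have boundary: "w \<in> range d" if w: "w \<in> A m" "d w = 0" "w \<in> range \<Delta>" for w m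
  proof -
    have "\<Delta> w = 0" using w(3) Delta_squared by auto
    then have "residue ?K w \<in> component (homology scale A (ker \<Delta>) d) m"
      "residue ?K 0 \<in> component (homology scale A (ker \<Delta>) d) m"
      using w subspace_0[OF subspace_A] by (auto simp: comp ker_def)
    moreover have "induced (\<lambda>x. x) (range \<Delta>) (residue ?K w) = induced (\<lambda>x. x) (range \<Delta>) (residue ?K 0)"
      unfolding ind_D using w(3) by (simp add: residue_eq_iff[OF subspace_range_Delta])
    moreover have "inj_on (induced (\<lambda>x. x) (range \<Delta>)) (component (homology scale A (ker \<Delta>) d) m)"
      using formal by (auto simp: kaehlerian_formality_def bij_betw_def)
    ultimately have "residue ?K w = residue ?K 0" by (auto dest: inj_onD)
    then have "w \<in> ?K" by (simp add: residue_eq_iff[OF dK])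
    then show ?thesis by auto
  qed
  show ?thesis
    unfolding abelian_bracket_def gz
  proof (intro allI ballI)
    fix i j X Y
    assume "X \<in> component (homology scale (regrade A) UNIV d) i"
      "Y \<in> component (homology scale (regrade A) UNIV d) j"
    then have "X \<in> component (homology scale A UNIV d) (1 - i)" "Y \<in> component (homology scale A UNIV d) (1 - j)"
      by (simp_all add: comp regrade_def)
    then obtain x y where x: "x \<in> A (1 - i)" "\<Delta> x = 0" "d x = 0" "X = residue (range d) x"
      and y: "y \<in> A (1 - j)" "\<Delta> y = 0" "d y = 0" "Y = residue (range d) y"
      using rep by meson
    have xy: "bracket x y \<in> range d"
      by (rule boundary[OF bracket_in[OF x(1) y(1)] _ bracket_ker_Delta[OF x(1) y(1) x(2) y(2)]])
        (use d_bracket[OF x(1) y(1)] x y in simp)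
    \<comment> \<open>\<open>homology_bracket\<close> runs over all representatives, inhomogeneous
      ones included, so the bracket has to be controlled after changing both arguments by arbitrary
      boundaries.\<close>
    have "residue (range d) (bracket x' y') = range d" if "x' \<in> X" "y' \<in> Y" for x' y'
    proof -
      have "x' - x \<in> range d" "y' - y \<in> range d"
        using that x(4) y(4) by (simp_all add: mem_residue)
      then obtain a b where "x' - x = d a" "y' - y = d b" by blast
      then have "x' = x + d a" "y' = y + d b" by (simp_all add: algebra_simps)
      then have "bracket x' y' = bracket x y + bracket x (d b) + bracket (d a) y + bracket (d a) (d b)"
        by (simp add: bracket_left.add bracket_right.add)
      also have "\<dots> \<in> range d"
        by (intro subspace_add[OF subspace_range_d] xy bracket_boundaries
            bracket_boundary_left[OF y(1,3)] bracket_boundary_right[OF x(1,3)])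
      finally show ?thesis by (simp add: residue_eq_0_iff[OF subspace_range_d])
    qed
    moreover have "x \<in> X" "y \<in> Y"
      using x(4) y(4) self_mem_residue[OF subspace_range_d] by auto
    ultimately have 1: "(\<Union>y'\<in>Y. residue (range d) (bracket x' y')) = range d" if "x' \<in> X" for x'
      using that by (intro SUP_eq_const) blast+
    show "homology_bracket bracket (range d) X Y = d ` UNIV"
      unfolding homology_bracket_def
    proof (rule SUP_eq_const)
      show "X \<noteq> {}" using \<open>x \<in> X\<close> by blast
    qed (rule 1)
  qed
qed

end


section \<open>Sums over decompositions of a word into three parts\<close>

context rational_module
begin

text \<open>The iterated diagonal, with \<open>G\<close> evaluated on the three blocks; the third
  length is determined by the other two.\<close>

definition triple_sum ::
  "((int \<times> 'm) list \<Rightarrow> (int \<times> 'm) list \<Rightarrow> (int \<times> 'm) list \<Rightarrow> 'b) \<Rightarrow> (int \<times> 'm) list \<Rightarrow> 'b" where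
  "triple_sum G w = (\<Sum>(a, b) | a + b \<le> length w.
     average (\<lambda>w. G (take a w) (take b (drop a w)) (drop (a + b) w)) w)"

definition rotate_args ::
  "((int \<times> 'm) list \<Rightarrow> (int \<times> 'm) list \<Rightarrow> (int \<times> 'm) list \<Rightarrow> 'b) \<Rightarrow>
    (int \<times> 'm) list \<Rightarrow> (int \<times> 'm) list \<Rightarrow> (int \<times> 'm) list \<Rightarrow> 'b" where
  "rotate_args G u v w = sgn_pow (word_degree u * (word_degree v + word_degree w)) (G v w u)"

text \<open>Carrying a leading block of length \<open>c\<close> behind blocks of lengths
  \<open>a\<close> and \<open>b\<close> turns the term for \<open>(a, b)\<close> into the rotated
  term for \<open>(c, a)\<close>. The sum over all triples of lengths is merely reindexed.\<close>

lemma triple_sum_rotate: "triple_sum (rotate_args G) w = triple_sum G w"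
proof -
  let ?F = "\<lambda>a b w. G (take a w) (take b (drop a w)) (drop (a + b) w)"
  let ?F' = "\<lambda>a b w. rotate_args G (take a w) (take b (drop a w)) (drop (a + b) w)"
  have eq: "average (?F a b) w = average (?F' (length w - (a + b)) a) w" if ab: "a + b \<le> length w" for a b
  proof -
    define c where "c = length w - (a + b)"
    have "average (?F a b) w = average (\<lambda>w. sgn_pow (word_degree (take c w) * word_degree (drop c w))
        (?F a b (drop c w @ take c w))) w"
      by (rule average_rotate[symmetric]) (simp add: c_def)
    also have "\<dots> = average (?F' c a) w"
    proof (rule average_cong)
      fix w' assume "mset w' = mset w"
      then have L: "length w' = a + b + c" using ab by (auto simp: c_def dest: mset_eq_length)
      have 1: "take a (drop c w' @ take c w') = take a (drop c w')" using L by simp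
      have 2: "take b (drop a (drop c w' @ take c w')) = drop (c + a) w'" using L by (simp add: add.commute)
      have 3: "drop (a + b) (drop c w' @ take c w') = take c w'" using L by simp
      have 4: "word_degree (drop c w') = word_degree (take a (drop c w')) + word_degree (drop (c + a) w')"
        using word_degree_take_drop[of a "drop c w'"] by (simp add: add.commute)
      show "sgn_pow (word_degree (take c w') * word_degree (drop c w')) (?F a b (drop c w' @ take c w')) = ?F' c a w'"
        unfolding rotate_args_def 1 2 3 4 by (rule refl)
    qed
    finally show ?thesis unfolding c_def .
  qed
  show ?thesis
    unfolding triple_sum_def
  proof (rule sum.reindex_bij_witness[where j = "\<lambda>(c, a). (a, length w - (c + a))"
          and i = "\<lambda>(a, b). (length w - (a + b), a)"], goal_cases)
    case (5 p)
    then obtain c a where "p = (c, a)" "c + a \<le> length w" by auto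
    then show ?case using eq[of a "length w - (c + a)"] by simp
  qed auto
qed

text \<open>The three rotated sums coincide and their total vanishes termwise, so three times the
  sum is zero; 3 is invertible.\<close>

lemma triple_sum_eq_0:
  assumes "w \<in> words M"
    and 0: "\<And>u1 u2 u3. u1 \<in> words M \<Longrightarrow> u2 \<in> words M \<Longrightarrow> u3 \<in> words M \<Longrightarrow>
      G u1 u2 u3 + rotate_args G u1 u2 u3 + rotate_args (rotate_args G) u1 u2 u3 = 0"
  shows "triple_sum G w = 0"
proof -
  have three: "of_nat 3 = 1 + 1 + (1 :: 'r)" by simp
  have "triple_sum G w + triple_sum (rotate_args G) w + triple_sum (rotate_args (rotate_args G)) w
     = triple_sum (\<lambda>u v w. G u v w + rotate_args G u v w + rotate_args (rotate_args G) u v w) w"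
    unfolding triple_sum_def by (simp add: average_add sum.distrib split_def)
  also have "\<dots> = 0"
    unfolding triple_sum_def
  proof (rule sum.neutral, clarify)
    fix a b
    have "average (\<lambda>w. G (take a w) (take b (drop a w)) (drop (a + b) w)
        + rotate_args G (take a w) (take b (drop a w)) (drop (a + b) w)
        + rotate_args (rotate_args G) (take a w) (take b (drop a w)) (drop (a + b) w)) w \<in> {0}"
    proof (rule average_subspace[OF subspace_single_0])
      fix w' assume "mset w' = mset w"
      then have "w' \<in> words M" using words_mset assms(1) by blast
      then show "G (take a w') (take b (drop a w')) (drop (a + b) w')
        + rotate_args G (take a w') (take b (drop a w')) (drop (a + b) w')
        + rotate_args (rotate_args G) (take a w') (take b (drop a w')) (drop (a + b) w') \<in> {0}"
        by (simp add: 0)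
    qed
    then show "average (\<lambda>w. G (take a w) (take b (drop a w)) (drop (a + b) w)
        + rotate_args G (take a w) (take b (drop a w)) (drop (a + b) w)
        + rotate_args (rotate_args G) (take a w) (take b (drop a w)) (drop (a + b) w)) w = 0"
      by simp
  qed
  finally have "scale (of_nat 3) (triple_sum G w) = 0"
    unfolding triple_sum_rotate by (simp only: three scale_left_distrib scale_one)
  then show ?thesis using scale_q_divide[of 3 "triple_sum G w"] by simp
qed

end

section \<open>The twisting cochain\<close>

lemma graded_homD:
  assumes "graded_hom p M N f"
  shows "x \<in> component M i \<Longrightarrow> f x \<in> component N (i + p)"
    and "x \<in> component M i \<Longrightarrow> y \<in> component M i \<Longrightarrow> f (gadd M x y) = gadd N (f x) (f y)"
    and "x \<in> component M i \<Longrightarrow> f (gscale M r x) = gscale N r (f x)"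
  using assms by (simp_all add: graded_hom_def)

locale BV_contraction = differential_BV_algebra scale A bracket \<Delta> d
  for scale :: "'r::comm_ring_1 \<Rightarrow> 'a::ring \<Rightarrow> 'a" and A bracket \<Delta> d +
  fixes q :: "rat \<Rightarrow> 'r" and H :: "('r, 'a set) graded_module"
    and nabla :: "'a set \<Rightarrow> 'a" and h :: "'a \<Rightarrow> 'a"
  assumes rationals: "contains_rationals q"
    and H_eq: "H = homology scale (regrade A) UNIV \<Delta>"
    and contraction: "contraction (ker_module scale A \<Delta>) d H (\<lambda>_. gzero H) (residue (range \<Delta>)) nabla h"
begin

sublocale rational_module scale q
  by unfold_locales (rule rationals)

sublocale retract: symmetric_retract q "suspension H"
  by unfold_locales (rule rationals)

abbreviation "sH \<equiv> suspension H"

section \<open>The contraction in terms of elements\<close>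

lemma component_H: "component H i = residue (range \<Delta>) ` {x \<in> A (1 - i). \<Delta> x = 0}"
  by (simp add: H_eq homology_def quotient_family_def regrade_def)

lemma gzero_H: "gzero H = range \<Delta>"
  by (simp add: H_eq homology_def quotient_gzero)

lemma gadd_H: "gadd H (residue (range \<Delta>) x) (residue (range \<Delta>) y) = residue (range \<Delta>) (x + y)"
  unfolding H_eq homology_def by (rule quotient_gadd[OF subspace_range_Delta])

lemma gscale_H: "gscale H r (residue (range \<Delta>) x) = residue (range \<Delta>) (scale r x)"
  unfolding H_eq homology_def by (rule quotient_gscale[OF subspace_range_Delta])

lemma component_sH: "component sH i = component H (i - 1)"
  by (simp add: suspension_def)

lemma gadd_sH: "gadd sH = gadd H"
  by (simp add: suspension_def)

lemma gscale_sH: "gscale sH = gscale H"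
  by (simp add: suspension_def)

lemma range_Delta_in_component_H: "range \<Delta> \<in> component H i"
  unfolding component_H using residue_0[of "range \<Delta>"] subspace_0[OF subspace_A, of "1 - i"]
  by (intro image_eqI[of _ _ 0]) auto

lemma component_ker_module: "component (ker_module scale A \<Delta>) i = {x \<in> A (1 - i). \<Delta> x = 0}"
  by (auto simp: ker_module_def submodule_family_def regrade_def ker_def)

lemma ker_module_simps:
  "gadd (ker_module scale A \<Delta>) = (+)" "gscale (ker_module scale A \<Delta>) = scale"
  "gzero (ker_module scale A \<Delta>) = 0"
  by (auto simp: ker_module_def submodule_family_def)

lemma nabla_hom: "graded_hom 0 H (ker_module scale A \<Delta>) nabla"
  using contraction unfolding contraction_def by (elim conjE)

lemma h_hom: "graded_hom 1 (ker_module scale A \<Delta>) (ker_module scale A \<Delta>) h"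
  using contraction unfolding contraction_def by (elim conjE)

lemma nabla_in: "y \<in> component H i \<Longrightarrow> nabla y \<in> A (1 - i) \<and> \<Delta> (nabla y) = 0"
  using graded_homD(1)[OF nabla_hom] by (simp add: component_ker_module)

lemma nabla_gadd: "x \<in> component H i \<Longrightarrow> y \<in> component H i \<Longrightarrow> nabla (gadd H x y) = nabla x + nabla y"
  using graded_homD(2)[OF nabla_hom] by (simp add: ker_module_simps)

lemma nabla_gscale: "x \<in> component H i \<Longrightarrow> nabla (gscale H r x) = scale r (nabla x)"
  using graded_homD(3)[OF nabla_hom] by (simp add: ker_module_simps)

lemma nabla_zero: "nabla (range \<Delta>) = 0"
proof -
  have "gscale H 0 (range \<Delta>) = range \<Delta>"
    using gscale_H[of 0 0] by (simp add: residue_0)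
  then show ?thesis using nabla_gscale[OF range_Delta_in_component_H, of 0] by simp
qed

lemma d_nabla: "y \<in> component H i \<Longrightarrow> d (nabla y) = 0"
  using contraction nabla_zero unfolding contraction_def gzero_H by metis

lemma residue_nabla: "y \<in> component H i \<Longrightarrow> residue (range \<Delta>) (nabla y) = y"
  using contraction unfolding contraction_def by blast

lemma h_in: "x \<in> A n \<Longrightarrow> \<Delta> x = 0 \<Longrightarrow> h x \<in> A (n - 1) \<and> \<Delta> (h x) = 0"
  using graded_homD(1)[OF h_hom, of x "1 - n"] by (simp add: component_ker_module)

lemma h_add: "x \<in> A n \<Longrightarrow> \<Delta> x = 0 \<Longrightarrow> y \<in> A n \<Longrightarrow> \<Delta> y = 0 \<Longrightarrow> h (x + y) = h x + h y"
  using graded_homD(2)[OF h_hom, of x "1 - n" y] by (simp add: component_ker_module ker_module_simps)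

lemma h_scale: "x \<in> A n \<Longrightarrow> \<Delta> x = 0 \<Longrightarrow> h (scale r x) = scale r (h x)"
  using graded_homD(3)[OF h_hom, of x "1 - n"] by (simp add: component_ker_module ker_module_simps)

lemma h_zero: "h 0 = 0"
  using h_scale[of 0 0 0] subspace_0[OF subspace_A] by simp

text \<open>This is the side condition \<pi> h = 0 and the source of (iii): from weight two on, the
  values of the cochain on words are values of \<open>h\<close>.\<close>

lemma h_range:
  assumes "x \<in> A n" "\<Delta> x = 0"
  shows "h x \<in> range \<Delta>"
proof -
  have "x \<in> component (ker_module scale A \<Delta>) (1 - n)" using assms by (simp add: component_ker_module)
  then have "residue (range \<Delta>) (h x) = range \<Delta>"
    using contraction unfolding contraction_def gzero_H by blast
  then show ?thesis by (simp add: residue_eq_0_iff[OF subspace_range_Delta])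
qed

text \<open>Both \<open>h (d x)\<close> and the image under \<open>nabla\<close> of the class of
  \<open>x\<close> vanish, so only - Id remains of the homotopy identity.\<close>

lemma d_h:
  assumes "x \<in> A n" "\<Delta> x = 0" "x \<in> range \<Delta>" "d x = 0"
  shows "d (h x) = - x"
proof -
  have "x \<in> component (ker_module scale A \<Delta>) (1 - n)" using assms by (simp add: component_ker_module)
  then have "d (h x) + h (d x) = nabla (residue (range \<Delta>) x) + scale (-1) x"
    using contraction unfolding contraction_def ker_module_simps by blast
  moreover have "residue (range \<Delta>) x = range \<Delta>"
    using assms(3) by (simp add: residue_eq_0_iff[OF subspace_range_Delta])
  ultimately show ?thesis by (simp add: assms(4) h_zero nabla_zero)
qed

text \<open>The cup bracket \<open>[F, F]\<close>, evaluated on a single word instead of a symmetric tensor.\<close>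

definition bracket_sum :: "((int \<times> 'a set) list \<Rightarrow> 'a) \<Rightarrow> (int \<times> 'a set) list \<Rightarrow> 'a" where
  "bracket_sum F w = (\<Sum>l\<le>length w.
     sgn_pow (-1 * word_degree (take l w)) (bracket (F (take l w)) (F (drop l w))))"

section \<open>The recursion on words\<close>

text \<open>The recursion passes through cuts of rearranged words and so is not structural.
  \<open>stage n\<close> is the cochain on words of length at most \<open>n\<close> and 0 on longer
  ones; each stage adds one length, and \<open>nabla\<close> starts the construction.\<close>

primrec stage :: "nat \<Rightarrow> (int \<times> 'a set) list \<Rightarrow> 'a" where
  "stage 0 w = 0"
| "stage (Suc n) w =
    (if length w = Suc n
     then if n = 0 then nabla (snd (hd w)) else h (scale (- q (1/2)) (average (bracket_sum (stage n)) w))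
     else stage n w)"

definition tau :: "(int \<times> 'a set) list \<Rightarrow> 'a" where
  "tau w = stage (length w) w"

lemma stage_conv_tau: "stage n w = (if length w \<le> n then tau w else 0)"
  by (induction n) (auto simp: tau_def le_Suc_eq)

lemma tau_Nil [simp]: "tau [] = 0"
  by (simp add: tau_def)

lemma tau_single [simp]: "tau [(i, x)] = nabla x"
  by (simp add: tau_def)

lemma bracket_sum_stage:
  assumes "length w = Suc n"
  shows "bracket_sum (stage n) w = bracket_sum tau w"
  unfolding bracket_sum_def
proof (rule sum.cong[OF refl])
  fix l assume "l \<in> {..length w}"
  \<comment> \<open>In the two extreme cuts one factor is the empty word, where both functions are
    0; in all others both halves are short enough for stage \<open>n\<close>.\<close>
  then consider "l = 0" | "l = Suc n" | "0 < l" "l \<le> n" using assms by force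
  then show "sgn_pow (-1 * word_degree (take l w)) (bracket (stage n (take l w)) (stage n (drop l w)))
    = sgn_pow (-1 * word_degree (take l w)) (bracket (tau (take l w)) (tau (drop l w)))"
  proof cases
    case 3
    then show ?thesis using assms by (simp add: stage_conv_tau)
  qed (use assms in \<open>simp_all add: stage_conv_tau bracket_left.zero bracket_right.zero\<close>)
qed

lemma tau_rec:
  assumes "length w \<ge> 2"
  shows "tau w = h (scale (- q (1/2)) (average (bracket_sum tau) w))"
proof -
  obtain n where n: "length w = Suc n" "n \<noteq> 0" using assms by (cases "length w") auto
  have "average (bracket_sum (stage n)) w = average (bracket_sum tau) w"
    by (rule average_cong) (metis bracket_sum_stage n(1) mset_eq_length)
  then show ?thesis by (simp add: tau_def n)
qed

text \<open>A word of degree \<open>n\<close> in the suspension goes to degree \<open>n - 1\<close>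
  of the Lie algebra, that is, to \<open>A (2 - n)\<close>. The bracket then gives
  \<open>A (3 - n)\<close> for the cup square, and \<open>h\<close>, of lower degree 1, leads back
  to \<open>A (2 - n)\<close>.\<close>

definition ker_valued :: "((int \<times> 'a set) list \<Rightarrow> 'a) \<Rightarrow> bool" where
  "ker_valued F \<longleftrightarrow> (\<forall>w\<in>words sH. F w \<in> A (2 - word_degree w) \<and> \<Delta> (F w) = 0)"

lemma bracket_sum_in:
  assumes F: "ker_valued F" and w: "w \<in> words sH"
  shows "bracket_sum F w \<in> A (3 - word_degree w)" "bracket_sum F w \<in> range \<Delta>"
proof -
  have *: "bracket (F (take l w)) (F (drop l w)) \<in> A (3 - word_degree w)"
    "bracket (F (take l w)) (F (drop l w)) \<in> range \<Delta>" for l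
  proof -
    have u: "F (take l w) \<in> A (2 - word_degree (take l w))" "\<Delta> (F (take l w)) = 0"
      and v: "F (drop l w) \<in> A (2 - word_degree (drop l w))" "\<Delta> (F (drop l w)) = 0"
      using F w by (auto simp: ker_valued_def)
    show "bracket (F (take l w)) (F (drop l w)) \<in> range \<Delta>"
      by (rule bracket_ker_Delta[OF u(1) v(1) u(2) v(2)])
    have e: "2 - word_degree (take l w) + (2 - word_degree (drop l w)) - 1 = 3 - word_degree w"
      using word_degree_take_drop[of l w] by simp
    show "bracket (F (take l w)) (F (drop l w)) \<in> A (3 - word_degree w)"
      using bracket_in[OF u(1) v(1)] unfolding e .
  qed
  show "bracket_sum F w \<in> A (3 - word_degree w)" "bracket_sum F w \<in> range \<Delta>"
    unfolding bracket_sum_def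
    by (intro subspace_sum subspace_A subspace_range_Delta sgn_pow_subspace *)+
qed

lemma average_bracket_sum_in:
  assumes F: "ker_valued F" and w: "w \<in> words sH"
  shows "average (bracket_sum F) w \<in> A (3 - word_degree w)"
    "average (bracket_sum F) w \<in> range \<Delta>" "\<Delta> (average (bracket_sum F) w) = 0"
proof -
  have *: "bracket_sum F w' \<in> A (3 - word_degree w)" "bracket_sum F w' \<in> range \<Delta>" if "mset w' = mset w" for w'
    using bracket_sum_in[OF F, of w'] words_mset[OF that, of sH] word_degree_mset[OF that] w by auto
  show "average (bracket_sum F) w \<in> A (3 - word_degree w)"
    by (rule average_subspace[OF subspace_A *(1)])
  show r: "average (bracket_sum F) w \<in> range \<Delta>"
    by (rule average_subspace[OF subspace_range_Delta *(2)])
  then show "\<Delta> (average (bracket_sum F) w) = 0" using Delta_squared by auto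
qed

lemma ker_valued_stage: "ker_valued (stage n)"
proof (induction n)
  case 0
  then show ?case by (simp add: ker_valued_def subspace_0[OF subspace_A])
next
  case (Suc n)
  show ?case
    unfolding ker_valued_def
  proof
    fix w assume w: "w \<in> words sH"
    consider "length w \<noteq> Suc n" | "length w = Suc n" "n = 0" | "length w = Suc n" "n \<noteq> 0" by blast
    then show "stage (Suc n) w \<in> A (2 - word_degree w) \<and> \<Delta> (stage (Suc n) w) = 0"
    proof cases
      case 1
      then show ?thesis using Suc w by (simp add: ker_valued_def)
    next
      case 2
      then obtain i x where wx: "w = [(i, x)]" by (metis length_Suc_conv length_0_conv prod.exhaust)
      have e: "1 - (i - 1) = 2 - i" by simp
      show ?thesis using nabla_in[of x "i - 1"] w by (simp add: wx component_sH 2 e)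
    next
      case 3
      let ?X = "average (bracket_sum (stage n)) w"
      note X = average_bracket_sum_in[OF Suc w]
      have e: "3 - word_degree w - 1 = 2 - word_degree w" by simp
      show ?thesis
        using h_in[OF subspace_scale[OF subspace_A X(1)], of "- q (1/2)"] 3
        by (simp only: stage.simps if_True if_False e Delta.scale X(3) scale_zero_right) simp
    qed
  qed
qed

lemma ker_valued_tau: "ker_valued tau"
  using ker_valued_stage by (auto simp: tau_def ker_valued_def)

lemma tau_in: "w \<in> words sH \<Longrightarrow> tau w \<in> A (2 - word_degree w)"
  using ker_valued_tau by (simp add: ker_valued_def)

lemma Delta_tau: "w \<in> words sH \<Longrightarrow> \<Delta> (tau w) = 0"
  using ker_valued_tau by (simp add: ker_valued_def)

lemma tau_range:
  assumes "w \<in> words sH" "length w \<noteq> 1"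
  shows "tau w \<in> range \<Delta>"
proof (cases "w = []")
  case True
  then show ?thesis using subspace_0[OF subspace_range_Delta] by simp
next
  case False
  then have l: "length w \<ge> 2" using assms(2) by (cases w rule: remdups_adj.cases) auto
  note X = average_bracket_sum_in[OF ker_valued_tau assms(1)]
  show ?thesis
    unfolding tau_rec[OF l] by (rule h_range[OF subspace_scale[OF subspace_A X(1)]]) (simp add: Delta.scale Delta.neg X(3))
qed

lemma bracket_sum_multilinear:
  assumes F: "multilinear_mod scale sH {0} F"
  shows "multilinear_mod scale sH {0} (bracket_sum F)"
  unfolding bracket_sum_def
proof (rule multilinear_mod_split[OF subspace_single_0])
  have a: "F (u @ (i, gadd sH x y) # v) = F (u @ (i, x) # v) + F (u @ (i, y) # v)"
    if "u \<in> words sH" "v \<in> words sH" "x \<in> component sH i" "y \<in> component sH i" for u v i x y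
    using multilinear_mod_add[OF F that] by (simp add: algebra_simps)
  have s: "F (u @ (i, gscale sH r x) # v) = scale r (F (u @ (i, x) # v))"
    if "u \<in> words sH" "v \<in> words sH" "x \<in> component sH i" for u v i x r
    using multilinear_mod_scale[OF F that] by simp
  show "multilinear_mod scale sH {0} (\<lambda>u. sgn_pow (-1 * word_degree u) (bracket (F u) (F v)))" for v
    by (rule multilinear_modI)
      (simp_all add: a s bracket_left.add bracket_left.scale sgn_pow_add scale_sgn_pow)
  show "multilinear_mod scale sH {0} (\<lambda>v. sgn_pow (-1 * word_degree u) (bracket (F u) (F v)))" for u
    by (rule multilinear_modI)
      (simp_all add: a s bracket_right.add bracket_right.scale sgn_pow_add scale_sgn_pow)
qed

text \<open>\<open>h\<close> is linear only on elements of ker \<Delta> of a common degree, so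
  \<open>ker_valued_stage\<close> is needed before it can be pulled through sums and
  multiples.\<close>

lemma stage_multilinear: "multilinear_mod scale sH {0} (stage n)"
proof (induction n)
  case 0
  then show ?case by (simp add: multilinear_mod_def)
next
  case (Suc n)
  let ?G = "average (bracket_sum (stage n))"
  have G: "multilinear_mod scale sH {0} ?G"
    by (intro multilinear_average subspace_single_0 bracket_sum_multilinear Suc)
  have G_in: "scale c (?G w) \<in> A (3 - word_degree w) \<and> \<Delta> (scale c (?G w)) = 0" if "w \<in> words sH" for w c
    using average_bracket_sum_in[OF ker_valued_stage that] by (simp add: Delta.scale subspace_scale[OF subspace_A])
  show ?case
  proof (rule multilinear_modI)
    fix u v i x y
    assume uv: "u \<in> words sH" "v \<in> words sH" and x: "x \<in> component sH i" and y: "y \<in> component sH i"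
    note add = multilinear_mod_add[OF _ uv x y]
    show "stage (Suc n) (u @ (i, gadd sH x y) # v) - stage (Suc n) (u @ (i, x) # v)
      - stage (Suc n) (u @ (i, y) # v) \<in> {0}"
    proof (cases "length u + length v = n")
      case False
      then show ?thesis using add[OF Suc] by simp
    next
      case len: True
      show ?thesis
      proof (cases "n = 0")
        case True
        then show ?thesis using len x y by (simp add: nabla_gadd gadd_sH component_sH)
      next
        case False
        have "?G (u @ (i, gadd sH x y) # v) = ?G (u @ (i, x) # v) + ?G (u @ (i, y) # v)"
          using add[OF G] by (simp add: algebra_simps)
        then show ?thesis
          using len False G_in[of "u @ (i, x) # v" "- q (1/2)"] G_in[of "u @ (i, y) # v" "- q (1/2)"] uv x y
          by (simp add: scale_right_distrib del: scale_minus_left)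
            (subst h_add, auto)
      qed
    qed
  next
    fix u v i x r
    assume uv: "u \<in> words sH" "v \<in> words sH" and x: "x \<in> component sH i"
    note sc = multilinear_mod_scale[OF _ uv x]
    show "stage (Suc n) (u @ (i, gscale sH r x) # v) - scale r (stage (Suc n) (u @ (i, x) # v)) \<in> {0}"
    proof (cases "length u + length v = n")
      case False
      then show ?thesis using sc[OF Suc] by simp
    next
      case len: True
      show ?thesis
      proof (cases "n = 0")
        case True
        then show ?thesis using len x by (simp add: nabla_gscale gscale_sH component_sH)
      next
        case False
        have "scale (- q (1/2)) (?G (u @ (i, gscale sH r x) # v)) = scale r (scale (- q (1/2)) (?G (u @ (i, x) # v)))"
          using sc[OF G] by (simp add: mult.commute)
        then show ?thesis
          using len False G_in[of "u @ (i, x) # v" "- q (1/2)"] uv x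
          by (simp del: scale_minus_left scale_scale) (rule h_scale, auto)
      qed
    qed
  qed
qed

text \<open>All words in such an identity have the same length, so a single stage computes the
  cochain on each of them.\<close>

lemma tau_multilinear: "multilinear_mod scale sH {0} tau"
proof (rule multilinear_modI)
  fix u v i x y
  assume "u \<in> words sH" "v \<in> words sH" "x \<in> component sH i" "y \<in> component sH i"
  from multilinear_mod_add[OF stage_multilinear this, of "Suc (length u + length v)"]
  show "tau (u @ (i, gadd sH x y) # v) - tau (u @ (i, x) # v) - tau (u @ (i, y) # v) \<in> {0}"
    by (simp only: tau_def length_append list.size add_Suc_right add_0_right)
next
  fix u v i x r
  assume "u \<in> words sH" "v \<in> words sH" "x \<in> component sH i"
  from multilinear_mod_scale[OF stage_multilinear this, of "Suc (length u + length v)"]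
  show "tau (u @ (i, gscale sH r x) # v) - scale r (tau (u @ (i, x) # v)) \<in> {0}"
    by (simp only: tau_def length_append list.size add_Suc_right add_0_right)
qed

lemma average_eq_on_words:
  assumes "w \<in> words sH" "\<And>w'. w' \<in> words sH \<Longrightarrow> length w' = length w \<Longrightarrow> F w' = G w'"
  shows "average F w = average G w"
proof (rule average_cong)
  fix w' assume "mset w' = mset w"
  from words_mset[OF this, of sH] mset_eq_length[OF this] assms show "F w' = G w'" by simp
qed

section \<open>The cup square is a cycle; the master equation on words\<close>

text \<open>The sign is that of two nested cup brackets: the cut before \<open>w\<close> contributes
  the degrees of \<open>u\<close> and \<open>v\<close>, the cut before \<open>v\<close> that of
  \<open>u\<close>, and only the degree of \<open>v\<close> survives modulo 2.\<close>

lemma triple_bracket_sum_eq_0: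
  assumes w: "w \<in> words sH"
  shows "triple_sum (\<lambda>u v w. sgn_pow (word_degree v) (bracket (bracket (tau u) (tau v)) (tau w))) w = 0"
proof (rule triple_sum_eq_0[OF w])
  fix u v w assume "u \<in> words sH" "v \<in> words sH" "w \<in> words sH"
  note J = bracket_Jacobi_cyclic[OF this[THEN tau_in]]
  let ?u = "word_degree u" and ?v = "word_degree v" and ?w = "word_degree w"
  \<comment> \<open>The sign relating the rotated terms to the cyclic Jacobi identity for the
    degrees of the values: it is read off from the first term and fits the other two modulo
    2.\<close>
  let ?e = "?v + (2 - ?u - 1) * (2 - ?w - 1)"
  have "sgn_pow ?v (bracket (bracket (tau u) (tau v)) (tau w))
    + sgn_pow (?u * (?v + ?w) + ?w) (bracket (bracket (tau v) (tau w)) (tau u))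
    + sgn_pow (?u * (?v + ?w) + (?v * (?w + ?u) + ?u)) (bracket (bracket (tau w) (tau u)) (tau v))
    = sgn_pow ?e (sgn_pow ((2 - ?u - 1) * (2 - ?w - 1)) (bracket (bracket (tau u) (tau v)) (tau w))
    + sgn_pow ((2 - ?v - 1) * (2 - ?u - 1)) (bracket (bracket (tau v) (tau w)) (tau u))
    + sgn_pow ((2 - ?w - 1) * (2 - ?v - 1)) (bracket (bracket (tau w) (tau u)) (tau v)))"
    unfolding sgn_pow_add sgn_pow_sgn_pow
    by (intro arg_cong2[where f = "(+)"] sgn_pow_cong) auto
  then show "sgn_pow ?v (bracket (bracket (tau u) (tau v)) (tau w))
    + rotate_args (\<lambda>u v w. sgn_pow (word_degree v) (bracket (bracket (tau u) (tau v)) (tau w))) u v w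
    + rotate_args (rotate_args (\<lambda>u v w. sgn_pow (word_degree v) (bracket (bracket (tau u) (tau v)) (tau w)))) u v w = 0"
    unfolding J rotate_args_def sgn_pow_sgn_pow sgn_pow_zero .
qed

text \<open>
  Once the master equation holds for shorter words, cocommutativity reduces the boundary of the
  cup square to a sum over decompositions into three blocks; the graded Jacobi identity says that the
  three rotations of this sum add up to zero, while each rotation leaves the sum unchanged.
\<close>

lemma d_average_bracket_sum:
  assumes w: "w \<in> words sH"
    and IH: "\<And>u. u \<in> words sH \<Longrightarrow> length u < length w \<Longrightarrow> d (tau u) = scale (q (1/2)) (average (bracket_sum tau) u)"
  shows "d (average (bracket_sum tau) w) = 0"
proof -
  define k where "k = length w"
  \<comment> \<open>The terms of the Leibniz rule in which \<open>d\<close> falls on the left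
    factor.\<close>
  define P where "P l = average (\<lambda>w. sgn_pow (word_degree (take l w))
    (bracket (d (tau (take l w))) (tau (drop l w)))) w" for l
  have "d (average (bracket_sum tau) w) = average (\<lambda>w. d (bracket_sum tau w)) w"
    by (rule average_hom[OF rational_module_axioms d_hom])
  also have "\<dots> = average (\<lambda>w. \<Sum>l\<le>k.
      sgn_pow (word_degree (take l w)) (bracket (d (tau (take l w))) (tau (drop l w)))
      - bracket (tau (take l w)) (d (tau (drop l w)))) w"
  proof (rule average_eq_on_words[OF w])
    fix w' assume w': "w' \<in> words sH" "length w' = length w"
    have "d (sgn_pow (-1 * word_degree (take l w')) (bracket (tau (take l w')) (tau (drop l w')))) =
      sgn_pow (word_degree (take l w')) (bracket (d (tau (take l w'))) (tau (drop l w')))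
      - bracket (tau (take l w')) (d (tau (drop l w')))" for l
      using d_bracket[OF tau_in[of "take l w'"] tau_in[of "drop l w'"]] w'
      by (simp add: d.hom_sgn_pow sgn_pow_def d.neg)
    then show "d (bracket_sum tau w') = (\<Sum>l\<le>k.
      sgn_pow (word_degree (take l w')) (bracket (d (tau (take l w'))) (tau (drop l w')))
      - bracket (tau (take l w')) (d (tau (drop l w'))))"
      by (simp add: bracket_sum_def d.sum w' k_def)
  qed
  also have "\<dots> = (\<Sum>l\<le>k. P l) - (\<Sum>l\<le>k. average (\<lambda>w. bracket (tau (take l w)) (d (tau (drop l w)))) w)"
    by (simp add: average_sum average_diff P_def sum_subtractf)
  \<comment> \<open>Exchanging the halves and antisymmetry turn the terms with \<open>d\<close> on
    the right factor into the negatives of the others. As they are subtracted, the total is twice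
    the sum of the \<open>P l\<close>.\<close>
  also have "(\<Sum>l\<le>k. average (\<lambda>w. bracket (tau (take l w)) (d (tau (drop l w)))) w) = (\<Sum>l\<le>k. - P (k - l))"
  proof (rule sum.cong[OF refl])
    fix l assume "l \<in> {..k}"
    then have l: "l \<le> k" by simp
    let ?F = "\<lambda>w. bracket (tau (take l w)) (d (tau (drop l w)))"
    define m where "m = k - l"
    have "average ?F w = average (\<lambda>w. sgn_pow (word_degree (take m w) * word_degree (drop m w))
        (?F (drop m w @ take m w))) w"
      by (rule average_rotate[symmetric]) (simp add: m_def k_def)
    also have "\<dots> = average (\<lambda>w. - sgn_pow (word_degree (take m w)) (bracket (d (tau (take m w))) (tau (drop m w)))) w"
    proof (rule average_eq_on_words[OF w])
      fix w' assume w': "w' \<in> words sH" "length w' = length w"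
      have 1: "take l (drop m w' @ take m w') = drop m w'" "drop l (drop m w' @ take m w') = take m w'"
        using w'(2) l by (auto simp: m_def k_def)
      have 2: "bracket (tau (drop m w')) (d (tau (take m w'))) =
        - sgn_pow ((2 - word_degree (drop m w') - 1) * (2 - word_degree (take m w') + 1 - 1))
           (bracket (d (tau (take m w'))) (tau (drop m w')))"
        using w' by (intro bracket_antisymmetric tau_in d_in) auto
      show "sgn_pow (word_degree (take m w') * word_degree (drop m w')) (?F (drop m w' @ take m w'))
        = - sgn_pow (word_degree (take m w')) (bracket (d (tau (take m w'))) (tau (drop m w')))"
        unfolding 1 2 sgn_pow_neg sgn_pow_sgn_pow by (intro arg_cong[where f = uminus] sgn_pow_cong) auto
    qed
    also have "\<dots> = - P m" by (simp add: average_uminus P_def)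
    finally show "average ?F w = - P (k - l)" by (simp add: m_def)
  qed
  also have "(\<Sum>l\<le>k. - P (k - l)) = - (\<Sum>l\<le>k. P l)"
    unfolding sum_negf by (rule arg_cong[where f = uminus],
      rule sum.reindex_bij_witness[where i = "\<lambda>l. k - l" and j = "\<lambda>l. k - l"]) auto
  finally have 1: "d (average (bracket_sum tau) w) = (\<Sum>l\<le>k. P l) + (\<Sum>l\<le>k. P l)" by simp
  let ?J = "\<lambda>u v w. sgn_pow (word_degree v) (bracket (bracket (tau u) (tau v)) (tau w))"
  have P: "P l = scale (q (1/2)) (\<Sum>m\<le>l. average (\<lambda>w. ?J (take m w) (take (l - m) (drop m w)) (drop l w)) w)"
    if l: "l \<le> k" for l
  proof -
    let ?f = "\<lambda>u v. sgn_pow (word_degree u) (bracket (scale (q (1/2)) (bracket_sum tau u)) (tau v))"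
    have "P l = average (\<lambda>w. average (\<lambda>u. ?f u (drop l w)) (take l w)) w"
      unfolding P_def
    proof (rule average_eq_on_words[OF w])
      fix w' assume w': "w' \<in> words sH" "length w' = length w"
      let ?u = "take l w'" and ?v = "drop l w'"
      let ?g = "\<lambda>x. sgn_pow (word_degree ?u) (bracket (scale (q (1/2)) x) (tau ?v))"
      have g: "module_hom scale scale ?g"
        by (rule module_hom.intro[OF module_axioms module_axioms], unfold_locales)
          (simp_all add: scale_right_distrib bracket_left.add sgn_pow_add bracket_left.scale scale_sgn_pow
             mult.commute)
      have "sgn_pow (word_degree ?u) (bracket (d (tau ?u)) (tau ?v)) = ?g (average (bracket_sum tau) ?u)"
      \<comment> \<open>For the cut with empty right half the hypothesis on shorter words does not
        reach the left half, but the other factor is \<open>tau [] = 0\<close>.\<close>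
      proof (cases "l = k")
        case True
        then show ?thesis using w' by (simp add: k_def bracket_right.zero)
      next
        case False
        then show ?thesis using IH[of ?u] w' l by (simp add: k_def)
      qed
      also have "\<dots> = average (\<lambda>u. ?g (bracket_sum tau u)) ?u"
        by (rule average_hom[OF rational_module_axioms g])
      also have "\<dots> = average (\<lambda>u. ?f u ?v) ?u"
      proof (rule average_cong)
        fix u assume m: "mset u = mset ?u"
        show "?g (bracket_sum tau u) = ?f u ?v" by (simp only: word_degree_mset[OF m])
      qed
      finally show "sgn_pow (word_degree ?u) (bracket (d (tau ?u)) (tau ?v)) = average (\<lambda>u. ?f u ?v) ?u" .
    qed
    \<comment> \<open>The inner average, brought in by the master equation for the left half, is
      absorbed by the outer one.\<close>
    also have "\<dots> = average (\<lambda>w. ?f (take l w) (drop l w)) w"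
      by (rule average_take) (use l in \<open>simp add: k_def\<close>)
    also have "\<dots> = average (\<lambda>w. scale (q (1/2)) (\<Sum>m\<le>l. ?J (take m w) (take (l - m) (drop m w)) (drop l w))) w"
    proof (rule average_eq_on_words[OF w])
      fix w' assume w': "w' \<in> words sH" "length w' = length w"
      have "sgn_pow (word_degree (take l w')) (bracket (sgn_pow (-1 * word_degree (take m w'))
          (bracket (tau (take m w')) (tau (take (l - m) (drop m w'))))) (tau (drop l w')))
        = ?J (take m w') (take (l - m) (drop m w')) (drop l w')" if "m \<le> l" for m
      proof -
        have "take l w' = take m w' @ take (l - m) (drop m w')"
          using that by (metis le_add_diff_inverse take_add)
        then have "word_degree (take l w') = word_degree (take m w') + word_degree (take (l - m) (drop m w'))"
          by (metis word_degree_append)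
        then show ?thesis
          unfolding bracket_left.hom_sgn_pow sgn_pow_sgn_pow by (intro sgn_pow_cong) simp
      qed
      then show "?f (take l w') (drop l w') =
          scale (q (1/2)) (\<Sum>m\<le>l. ?J (take m w') (take (l - m) (drop m w')) (drop l w'))"
        using l w' by (simp add: bracket_sum_def k_def bracket_left.scale bracket_left.sum sgn_pow_sum
            scale_sgn_pow[symmetric] min_absorb1 min_absorb2 drop_take)
    qed
    finally show ?thesis by (simp only: average_scale average_sum)
  qed
  have "(\<Sum>l\<le>k. P l) = scale (q (1/2)) (\<Sum>l\<le>k. \<Sum>m\<le>l.
      average (\<lambda>w. ?J (take m w) (take (l - m) (drop m w)) (drop l w)) w)"
    unfolding scale_sum_right by (rule sum.cong[OF refl]) (simp add: P scale_sum_right)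
  also have "(\<Sum>l\<le>k. \<Sum>m\<le>l. average (\<lambda>w. ?J (take m w) (take (l - m) (drop m w)) (drop l w)) w)
     = triple_sum ?J w"
    unfolding triple_sum_def
    by (subst sum.Sigma, simp, simp)
      (rule sum.reindex_bij_witness[where j = "\<lambda>(l, m). (m, l - m)" and i = "\<lambda>(a, b). (a + b, a)"],
        auto simp: k_def)
  also have "\<dots> = 0" by (rule triple_bracket_sum_eq_0[OF w])
  finally show ?thesis using 1 by simp
qed

text \<open>From length two on, the cup square \<open>X\<close> lies in im \<Delta> and is a cycle
  because the equation holds on shorter words; so d h X = - X, and the sign cancels that of - 1/2.
  On at most one letter both sides are zero: every cut has an empty half, and the values of
  \<open>nabla\<close> are cycles.\<close>

theorem d_tau:
  "w \<in> words sH \<Longrightarrow> d (tau w) = scale (q (1/2)) (average (bracket_sum tau) w)"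
proof (induction "length w" arbitrary: w rule: less_induct)
  case less
  note w = less.prems
  consider "length w \<le> 1" | "length w \<ge> 2" by linarith
  then show ?case
  proof cases
    case 1
    have "average (bracket_sum tau) w = average (\<lambda>_. 0) w"
    proof (rule average_eq_on_words[OF w])
      fix w' :: "(int \<times> 'a set) list" assume "length w' = length w"
      then have "take l w' = [] \<or> drop l w' = []" for l using 1 by (cases l) auto
      then have "bracket (tau (take l w')) (tau (drop l w')) = 0" for l
        by (metis tau_Nil bracket_left.zero bracket_right.zero)
      then show "bracket_sum tau w' = 0" by (simp add: bracket_sum_def)
    qed
    moreover have "d (tau w) = 0"
    proof (cases w)
      case Nil
      then show ?thesis by (simp add: d.zero)
    next
      case (Cons a v)
      then obtain i x where "w = [(i, x)]" using 1 by (cases a) auto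
      then show ?thesis using d_nabla w by (simp add: component_sH)
    qed
    ultimately show ?thesis by simp
  next
    case 2
    let ?X = "average (bracket_sum tau) w"
    note X = average_bracket_sum_in[OF ker_valued_tau w]
    have "d ?X = 0" by (rule d_average_bracket_sum[OF w]) (use less in blast)
    then have "d (h (scale (- q (1/2)) ?X)) = - scale (- q (1/2)) ?X"
      using X by (intro d_h[of _ "3 - word_degree w"] subspace_scale subspace_A subspace_range_Delta)
        (simp_all add: d.scale Delta.scale d.neg Delta.neg)
    then show ?thesis by (simp add: tau_rec[OF 2])
  qed
qed

section \<open>Passage from words to the symmetric coalgebra\<close>

definition twisting_cochain :: "('r, 'a set) tensors \<Rightarrow> 'a" where
  "twisting_cochain = retract.eval_class scale tau"

lemma twisting_cochain_cls: "twisting_cochain (retract.cls p) = linear_extension scale tau p"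
  unfolding twisting_cochain_def by (rule retract.eval_class_cls[OF module_axioms tau_multilinear])

lemma twisting_cochain_graded_hom:
  "graded_hom (-1) (symmetric_coalgebra sH) (Lie_module scale A) twisting_cochain"
proof -
  interpret lin: module_hom free_scale scale "linear_extension scale tau"
    by (rule linear_extension_module_hom)
  have L: "component (Lie_module scale A) j = A (1 - j)" "gadd (Lie_module scale A) = (+)"
    "gscale (Lie_module scale A) = scale" for j
    by (auto simp: Lie_module_def submodule_family_def regrade_def)
  show ?thesis
    unfolding graded_hom_def L
  proof (intro allI ballI conjI)
    fix i x assume x: "x \<in> component (symmetric_coalgebra sH) i"
    then obtain p where p: "x = retract.cls p" "p \<in> retract.homogeneous_reps i"
      by (rule retract.component_S_elim)
    have "tau w \<in> A (1 - (i + -1))" if "w \<in> Poly_Mapping.keys p" for w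
      using that p(2) tau_in[of w] by (auto simp: retract.homogeneous_reps_def)
    then show "twisting_cochain x \<in> A (1 - (i + -1))"
      unfolding p(1) twisting_cochain_cls by (rule linear_extension_subspace[OF subspace_A])
    show "twisting_cochain (gscale (symmetric_coalgebra sH) r x) = scale r (twisting_cochain x)" for r
      by (simp add: p(1) retract.gscale_S retract.gscale_T twisting_cochain_cls lin.scale)
    fix y assume "y \<in> component (symmetric_coalgebra sH) i"
    then obtain p' where "y = retract.cls p'" by (rule retract.component_S_elim)
    then show "twisting_cochain (gadd (symmetric_coalgebra sH) x y) = twisting_cochain x + twisting_cochain y"
      by (simp add: p(1) retract.gadd_S retract.gadd_T twisting_cochain_cls lin.add)
  qed
qed

text \<open>On words the equation involves the averaged bracket sum. Averaging the function is
  symmetrizing the argument, and a symmetric representative differs from its symmetrization by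
  relations, on which the multilinear bracket sum vanishes.\<close>

lemma twisting_cochain_master:
  assumes "c \<in> component (symmetric_coalgebra sH) n"
  shows "d (twisting_cochain c) =
    scale (q (1/2)) (cup_bracket scale bracket sH (-1) twisting_cochain twisting_cochain c)"
proof -
  obtain p where p: "c = retract.cls p" "p \<in> retract.homogeneous_reps n"
    "retract.symmetrize p - p \<in> retract.rel"
    using assms by (rule retract.component_S_elim)
  interpret B: module_hom free_scale scale "linear_extension scale (bracket_sum tau)"
    by (rule linear_extension_module_hom)
  have "linear_extension scale (bracket_sum tau) (retract.symmetrize p - p) \<in> {0}"
    by (rule linear_extension_word_relations[OF bracket_sum_multilinear[OF tau_multilinear]
          subspace_single_0 p(3)])
  then have 1: "linear_extension scale (bracket_sum tau) (retract.symmetrize p) =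
      linear_extension scale (bracket_sum tau) p"
    by (simp add: B.diff)
  have "d (twisting_cochain c) = linear_extension scale (\<lambda>w. d (tau w)) p"
    unfolding p(1) twisting_cochain_cls by (rule module_hom_linear_extension[OF d_hom])
  also have "\<dots> = linear_extension scale (\<lambda>w. scale (q (1/2)) (average (bracket_sum tau) w)) p"
    by (rule linear_extension_cong) (use p(2) d_tau in \<open>auto simp: retract.homogeneous_reps_def\<close>)
  also have "\<dots> = scale (q (1/2)) (linear_extension scale (average (bracket_sum tau)) p)"
    by (rule linear_extension_scale)
  also have "linear_extension scale (average (bracket_sum tau)) p =
      linear_extension scale (bracket_sum tau) (retract.symmetrize p)"
    unfolding retract.symmetrize_def module_hom_linear_extension[OF B.module_hom_axioms]
      retract.word.average_hom[OF rational_module_axioms B.module_hom_axioms]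
    by simp
  also have "\<dots> = cup_bracket scale bracket sH (-1) twisting_cochain twisting_cochain c"
    unfolding 1 p(1) twisting_cochain_def
    by (subst retract.cup_bracket_cls[OF module_axioms tau_multilinear p(2,3) bracket_hom_right bracket_hom_left])
      (simp add: bracket_sum_def[abs_def])
  finally show ?thesis .
qed

lemma Delta_twisting_cochain:
  assumes "c \<in> component (symmetric_coalgebra sH) n"
  shows "\<Delta> (twisting_cochain c) = 0"
proof -
  obtain p where p: "c = retract.cls p" "p \<in> retract.homogeneous_reps n"
    using assms by (rule retract.component_S_elim)
  have "\<Delta> (twisting_cochain c) = linear_extension scale (\<lambda>w. \<Delta> (tau w)) p"
    unfolding p(1) twisting_cochain_cls by (rule module_hom_linear_extension[OF Delta_hom])
  also have "\<dots> = 0"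
    unfolding linear_extension_def using p(2) Delta_tau
    by (intro sum.neutral) (auto simp: retract.homogeneous_reps_def)
  finally show ?thesis .
qed

lemma twisting_cochain_range:
  assumes "c \<in> symmetric_power sH k n" "k \<noteq> 1"
  shows "twisting_cochain c \<in> range \<Delta>"
proof -
  obtain p where p: "c = retract.cls p"
    "Poly_Mapping.keys p \<subseteq> {w \<in> words sH. length w = k \<and> word_degree w = n}"
    using assms(1) by (rule retract.symmetric_power_elim)
  show ?thesis
    unfolding p(1) twisting_cochain_cls
    by (rule linear_extension_subspace[OF subspace_range_Delta]) (use p(2) tau_range assms(2) in auto)
qed

text \<open>In weight one this is the identity \<pi> \<open>nabla\<close> = Id; in every other
  weight the cochain has values in im \<Delta>, which is the zero class.\<close>

lemma universal_twisting_cochain: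
  "universal_twisting_cochain H (\<lambda>c. residue (range \<Delta>) (twisting_cochain c))"
  unfolding universal_twisting_cochain_def
proof (intro conjI allI ballI impI)
  show "graded_hom (-1) (symmetric_coalgebra sH) H (\<lambda>c. residue (range \<Delta>) (twisting_cochain c))"
    using twisting_cochain_graded_hom Delta_twisting_cochain
    by (auto simp: graded_hom_def component_H gadd_H gscale_H Lie_module_def submodule_family_def regrade_def)
  show "residue (range \<Delta>) (twisting_cochain (retract.cls (gen [(j, x)]))) = x"
    if "x \<in> component sH j" for j x
    using that residue_nabla by (simp add: twisting_cochain_cls component_sH)
  show "residue (range \<Delta>) (twisting_cochain c) = gzero H"
    if "k \<noteq> 1" "c \<in> symmetric_power sH k n" for k n c
    using twisting_cochain_range[OF that(2,1)] by (simp add: gzero_H residue_eq_0_iff[OF subspace_range_Delta])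
qed

end

theorem theorem3p8:
  fixes q :: "rat \<Rightarrow> 'r::comm_ring_1"
    and scale :: "'r \<Rightarrow> 'a::ring \<Rightarrow> 'a"
    and A :: "int \<Rightarrow> 'a set"
    and bracket :: "'a \<Rightarrow> 'a \<Rightarrow> 'a"
    and \<Delta> d :: "'a \<Rightarrow> 'a"
    and H :: "('r, 'a set) graded_module"
    and \<pi> :: "'a \<Rightarrow> 'a set"
    and nabla :: "'a set \<Rightarrow> 'a"
    and h :: "'a \<Rightarrow> 'a"
  assumes "contains_rationals q"
    and "differential_BV_algebra scale A bracket \<Delta> d"
    and "kaehlerian_formality scale A \<Delta> d"
    and "H = homology scale (regrade A) UNIV \<Delta>"
    and "\<pi> = residue (range \<Delta>)"
    and "contraction (ker_module scale A \<Delta>) d H (\<lambda>_. gzero H) \<pi> nabla h"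
  shows "abelian_bracket (homology scale (regrade A) UNIV d) (homology_bracket bracket (range d)) \<and>
    (\<exists>\<tau>. graded_hom (-1) (symmetric_coalgebra (suspension H)) (Lie_module scale A) \<tau> \<and>
       (\<forall>n. \<forall>c \<in> component (symmetric_coalgebra (suspension H)) n.
          d (\<tau> c) = scale (q (1 / 2)) (cup_bracket scale bracket (suspension H) (-1) \<tau> \<tau> c)) \<and>
       (\<forall>n. \<forall>c \<in> component (symmetric_coalgebra (suspension H)) n. \<Delta> (\<tau> c) = 0) \<and>
       universal_twisting_cochain H (\<lambda>c. \<pi> (\<tau> c)) \<and>
       (\<forall>k \<ge> 2. \<forall>n. \<forall>c \<in> symmetric_power (suspension H) k n. \<tau> c \<in> range \<Delta>))"
proof -
  interpret differential_BV_algebra scale A bracket \<Delta> d by (rule assms(2))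
  interpret BV_contraction scale A bracket \<Delta> d q H nabla h
    by unfold_locales (use assms in auto)
  show ?thesis
    unfolding assms(5)
    using homology_abelian[OF assms(3)] twisting_cochain_graded_hom twisting_cochain_master
      Delta_twisting_cochain universal_twisting_cochain twisting_cochain_range
    by (intro conjI exI[of _ twisting_cochain]) auto
qed

end
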